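(* Let $n\ge 2$ be an integer, let $q\in\left(2,\frac{2n}{n-1}\right)$ (note $\frac{2n}{n-1}=\frac{2\cdot 2n}{2n-2}$ is the critical Sobolev exponent in real dimension $2n$), and for every positive integer $k$ put $\lambda_k=\lambda_{k,q}:=\frac{4k(k+n)}{q-2}$. If $\lambda\in(\lambda_{k,q},\lambda_{k+1,q}]$, then the equation $$-\Delta_{g_{FS}}u+\lambda u=\lambda u^{q-1}$$ has at least $k$ positive solutions on $(\mathbb{C}\mathbf{P}^n,g_{FS})$ which are invariant under the action of $U(n)$.
   Context: $g_{FS}$ is the Fubini–Study metric on $\mathbb{C}\mathbf{P}^n$, normalized so that the eigenvalues of $-\Delta_{g_{FS}}$ are $4k(k+n)$, $k=0,1,2,\dots$ (holomorphic sectional curvature $4$, diameter $\pi/2$). $\Delta_{g_{FS}}$ is the Laplace–Beltrami operator (nonpositive). The unitary group $U(n)$ acts isometrically on $\mathbb{C}\mathbf{P}^n$ by $A\cdot[z_0:z_1:\dots:z_n]=[z_0:A(z_1,\dots,z_n)]$; this is a cohomogeneity one action fixing $p_0=[1:0:\dots:0]$, with orbit space isometric to $[0,\pi/2]$ (the quotient map is the distance to $p_0$). A solution is called invariant if it is constant on the orbits of this action. *)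

theory Defs
  imports "HOL-Analysis.Analysis"
begin

text \<open>Model: C^{n+1} = complex^'m with CARD('m) = n+1 (viewed as real Euclidean space R^{2n+2}),
  distinguished coordinate i0 (the z_0 coordinate). CP^n = unit sphere S^{2n+1} modulo U(1)
  (Hopf fibration, a Riemannian submersion onto (CP^n, g_FS) with holomorphic sectional curvature 4).
  Functions on CP^n are identified with U(1)-invariant functions on the unit sphere.\<close>

definition unit_sphere :: "(complex^'m) set" where
  "unit_sphere = {z. norm z = 1}"

definition hopf_invariant :: "(complex^'m \<Rightarrow> real) \<Rightarrow> bool" where
  "hopf_invariant u \<longleftrightarrow> (\<forall>z\<in>unit_sphere. \<forall>\<theta>::real. u (\<chi> i. cis \<theta> * z $ i) = u z)"

definition ext0 :: "(complex^'m \<Rightarrow> real) \<Rightarrow> complex^'m \<Rightarrow> real" where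
  "ext0 u w = u (inverse (norm w) *\<^sub>R w)"

definition C2_on :: "'a::euclidean_space set \<Rightarrow> ('a \<Rightarrow> real) \<Rightarrow> bool" where
  "C2_on S F \<longleftrightarrow> (\<exists>(D1 :: 'a \<Rightarrow> 'a \<Rightarrow>\<^sub>L real) (D2 :: 'a \<Rightarrow> 'a \<Rightarrow>\<^sub>L ('a \<Rightarrow>\<^sub>L real)).
      (\<forall>x\<in>S. (F has_derivative blinfun_apply (D1 x)) (at x)) \<and>
      (\<forall>x\<in>S. (D1 has_derivative blinfun_apply (D2 x)) (at x)) \<and>
      continuous_on S D2)"

definition euclid_laplacian :: "('a::euclidean_space \<Rightarrow> real) \<Rightarrow> 'a \<Rightarrow> real" where
  "euclid_laplacian F x = (\<Sum>b\<in>Basis. deriv (deriv (\<lambda>t. F (x + t *\<^sub>R b))) 0)"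

text \<open>Laplace--Beltrami operator of g_FS (nonpositive convention) applied to a function on CP^n,
  computed through the Hopf fibration: for U(1)-invariant u on S^{2n+1},
  (Delta_FS u)([z]) = (Delta_{S^{2n+1}} u)(z) = (Delta_{R^{2n+2}} ext0 u)(z).\<close>
definition laplacian_FS :: "(complex^'m \<Rightarrow> real) \<Rightarrow> complex^'m \<Rightarrow> real" where
  "laplacian_FS u z = euclid_laplacian (ext0 u) z"

definition Un_block :: "'m \<Rightarrow> (complex^'m^'m) set" where
  "Un_block i0 = {A. A ** (\<chi> i j. cnj (A $ j $ i)) = mat 1 \<and>
      (\<forall>j. A $ i0 $ j = (if j = i0 then 1 else 0)) \<and>
      (\<forall>i. A $ i $ i0 = (if i = i0 then 1 else 0))}"

definition Un_invariant :: "'m \<Rightarrow> (complex^'m \<Rightarrow> real) \<Rightarrow> bool" where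
  "Un_invariant i0 u \<longleftrightarrow> (\<forall>A\<in>Un_block i0. \<forall>z\<in>unit_sphere. u (A *v z) = u z)"

definition positive_solution :: "real \<Rightarrow> real \<Rightarrow> (complex^'m \<Rightarrow> real) \<Rightarrow> bool" where
  "positive_solution lam q u \<longleftrightarrow>
     hopf_invariant u \<and> C2_on (- {0}) (ext0 u) \<and>
     (\<forall>z\<in>unit_sphere. u z > 0) \<and>
     (\<forall>z\<in>unit_sphere. - laplacian_FS u z + lam * u z = lam * u z powr (q - 1))"

end

theory Submission
  imports Defs
begin

text \<open>
  In terms of \<open>s = 1 - \<bar>z\<^sub>0\<bar>\<^sup>2\<close>, an invariant function \<open>u = W s\<close> solves the equation iff
  \<open>s (1 - s) W'' + (n - (n + 1) s) W' + \<kappa> (W\<^sup>q\<^sup>-\<^sup>1 - W) = 0\<close> on \<open>[0, 1]\<close> with \<open>\<kappa> = lam / 4\<close>.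
  We shoot from \<open>s = 0\<close> with \<open>W 0 = a \<in> (0, 1)\<close>, after clipping the nonlinearity to a bounded
  Lipschitz function. The flux \<open>p = s\<^sup>n (1 - s) W'\<close> extends continuously to \<open>s = 1\<close>, and the
  solution is regular there iff \<open>p 1 = 0\<close>. Let \<open>A\<^sub>j\<close> be the open set of \<open>a\<close> for which \<open>p\<close> has at
  least \<open>j\<close> sign changes. Small \<open>a\<close> do not lie in \<open>A\<^sub>1\<close>, whereas \<open>A\<^sub>k\<^sub>-\<^sub>1\<close> contains values close to
  1, by Sturm comparison of \<open>W - 1\<close> with the Jacobi polynomial of degree \<open>k\<close>. Zeros of \<open>p\<close> are simple
  and can only be lost through the end \<open>s = 1\<close>, one at a time; hence \<open>p 1 = 0\<close> for \<open>a = Inf A\<^sub>j\<close>, and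
  these infima increase strictly with \<open>j\<close>. Together with \<open>u = 1\<close> this yields \<open>k\<close> solutions.
  Since \<open>W\<^sup>q\<^sup>-\<^sup>1 - W \<ge> -1\<close>, the solutions with \<open>p 1 = 0\<close> obey a bound that does not depend on the level
  of clipping, so clipping is harmless.
\<close>

section \<open>The singular initial value problem\<close>

text \<open>The obstacle is the right end. Unless p(1) = 0, \<open>W\<close> has a logarithmic
  singularity at s = 1, so neither \<open>W\<close> nor its dependence on a is controlled there. The
  flux is: p' = -\<kappa> s^(n-1) F(W) is bounded independently of a, so p is Lipschitz on [0, 1]
  uniformly in a and depends continuously on a up to s = 1. Sign changes are therefore counted for
  p, and by strict inequalities at points instead of zeros, which makes the count open in a. A zero
  z of p, wherever it lies, bounds the slope of \<open>W\<close> on [1/2, z] by a universal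
  constant; the arguments near s = 1 (no sign change for small a, at most one lost in a limit) rest
  on this. The eigenvalue enters once. Linearised at 1, the equation has zeroth-order coefficient
  \<kappa> (q - 2), whereas the Jacobi polynomial of degree k satisfies it with k (k + n) instead;
  the lower bound on \<open>lam\<close> says that the former is larger. The k zeros yield k
  alternating signs of p, hence k - 1 sign changes and k - 1 solutions below 1 at s = 0; the
  constant supplies the last one.\<close>

lemma diff_le_of_deriv_le:
  fixes f h :: "real \<Rightarrow> real"
  assumes "a \<le> b" and "continuous_on {a..b} f" and "continuous_on {a..b} h"
    and df: "\<And>x. a < x \<Longrightarrow> x < b \<Longrightarrow> (f has_real_derivative f' x) (at x)"
    and dh: "\<And>x. a < x \<Longrightarrow> x < b \<Longrightarrow> (h has_real_derivative h' x) (at x)"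
    and le: "\<And>x. a < x \<Longrightarrow> x < b \<Longrightarrow> f' x \<le> h' x"
  shows "f b - f a \<le> h b - h a"
proof -
  have "(\<lambda>x. h x - f x) a \<le> (\<lambda>x. h x - f x) b"
  proof (rule DERIV_nonneg_imp_increasing_open[OF assms(1)])
    fix x assume x: "a < x" "x < b"
    have "((\<lambda>x. h x - f x) has_real_derivative h' x - f' x) (at x)"
      using df[OF x] dh[OF x] by (auto intro!: derivative_eq_intros)
    then show "\<exists>y. ((\<lambda>x. h x - f x) has_real_derivative y) (at x) \<and> 0 \<le> y"
      using le[OF x] by (intro exI[of _ "h' x - f' x"]) auto
  qed (intro continuous_intros assms)
  then show ?thesis by simp
qed

lemma abs_diff_le_of_deriv_bound:
  fixes f h :: "real \<Rightarrow> real"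
  assumes "a \<le> b" and "continuous_on {a..b} f" and "continuous_on {a..b} h"
    and df: "\<And>x. a < x \<Longrightarrow> x < b \<Longrightarrow> (f has_real_derivative f' x) (at x)"
    and dh: "\<And>x. a < x \<Longrightarrow> x < b \<Longrightarrow> (h has_real_derivative h' x) (at x)"
    and le: "\<And>x. a < x \<Longrightarrow> x < b \<Longrightarrow> \<bar>f' x\<bar> \<le> h' x"
  shows "\<bar>f b - f a\<bar> \<le> h b - h a"
proof -
  have "f b - f a \<le> h b - h a"
    by (rule diff_le_of_deriv_le[OF assms(1-3) df dh]) (use le in \<open>auto simp: abs_le_iff\<close>)
  moreover have "- f b - - f a \<le> h b - h a"
  proof (rule diff_le_of_deriv_le[where f = "\<lambda>x. - f x" and f' = "\<lambda>x. - f' x"])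
    show "continuous_on {a..b} (\<lambda>x. - f x)" by (intro continuous_intros assms)
    show "- f' x \<le> h' x" if "a < x" "x < b" for x using le[OF that] by linarith
  qed (use assms(1,3) in \<open>auto intro: DERIV_minus df dh\<close>)
  ultimately show ?thesis by linarith
qed

lemma small_step_exists:
  fixes B e :: real
  assumes "0 \<le> B" "0 < e"
  obtains \<delta> where "0 < \<delta>" "\<delta> \<le> 1/2" "B * \<delta> \<le> e"
proof
  show "0 < min (1/2) (e / (B + 1))" "min (1/2) (e / (B + 1)) \<le> 1/2" using assms by (simp, intro min.cobounded1)
  have "B * min (1/2) (e / (B + 1)) \<le> (B + 1) * (e / (B + 1))" using assms by (intro mult_mono) auto
  then show "B * min (1/2) (e / (B + 1)) \<le> e" using assms by simp
qed

section \<open>Picard operator for the integrated equation\<close>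

locale lipschitz_reaction =
  fixes n :: nat and \<kappa> C L :: real and F :: "real \<Rightarrow> real"
  assumes n_pos: "n \<ge> 1" and kappa_pos: "\<kappa> > 0" and L_pos: "L > 0"
    and F_lipschitz: "\<And>x y. \<bar>F x - F y\<bar> \<le> L * \<bar>x - y\<bar>"
    and F_bounded: "\<And>x. \<bar>F x\<bar> \<le> C"
begin

lemma C_nonneg: "0 \<le> C"
  using F_bounded[of 0] by linarith

lemma F_continuous: "continuous_on S F"
proof -
  have "L-lipschitz_on S F"
    using F_lipschitz L_pos by (intro lipschitz_onI) (auto simp: dist_real_def)
  then show ?thesis by (rule lipschitz_on_continuous_on)
qed

text \<open>Exponent of the weight (1 - s) powr (-\<beta>): integrating \<kappa> L (1 - s) powr
  (-\<beta> - 1) produces the factor \<kappa> L / \<beta> = 1/2, the contraction constant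
  below.\<close>

definition \<beta> :: real where "\<beta> = 2 * \<kappa> * L"

lemma beta_pos: "\<beta> > 0"
  using kappa_pos L_pos by (simp add: \<beta>_def)

text \<open>The substitution r = \<sigma> x turns the integral of r^(n-1) F(v r) over [0, \<sigma>]
  into \<sigma>^n times this average. The factor s^n of the flux thus cancels, W' becomes -\<kappa>
  \<open>avg\<close> / (1 - s), and the singularity at s = 0 disappears from the Picard
  operator.\<close>

definition avg :: "(real \<Rightarrow> real) \<Rightarrow> real \<Rightarrow> real" where
  "avg v \<sigma> = integral {0..1} (\<lambda>x. x ^ (n - 1) * F (v (\<sigma> * x)))"

definition picard :: "real \<Rightarrow> (real \<Rightarrow> real) \<Rightarrow> real \<Rightarrow> real" where
  "picard a v s = a - \<kappa> * integral {0..s} (\<lambda>\<sigma>. avg v \<sigma> / (1 - \<sigma>))"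

lemma avg_integrable:
  assumes "continuous_on {0..<1} v" "0 \<le> \<sigma>" "\<sigma> < 1"
  shows "(\<lambda>x. x ^ (n - 1) * F (v (\<sigma> * x))) integrable_on {0..1}"
proof (rule integrable_continuous_interval)
  have "\<sigma> * x < 1" if "0 \<le> x" "x \<le> 1" for x
    using that assms mult_left_le[of x \<sigma>] by linarith
  then have "continuous_on {0..1} (\<lambda>x. v (\<sigma> * x))"
    using assms(2) by (intro continuous_on_compose2[OF assms(1)] continuous_intros) auto
  then show "continuous_on {0..1} (\<lambda>x. x ^ (n - 1) * F (v (\<sigma> * x)))"
    by (intro continuous_intros continuous_on_compose2[OF F_continuous[of UNIV]]) auto
qed

lemma avg_continuous:
  assumes "continuous_on {0..<1} v"
  shows "continuous_on {0..<1} (avg v)"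
proof -
  have "\<sigma> * x < 1" if "0 \<le> \<sigma>" "\<sigma> < 1" "0 \<le> x" "x \<le> 1" for \<sigma> x :: real
    using that mult_left_le[of x \<sigma>] by linarith
  then have "continuous_on ({0..<1} \<times> cbox 0 1) (\<lambda>y. v (fst y * snd y))"
    by (intro continuous_on_compose2[OF assms] continuous_intros) auto
  then have "continuous_on ({0..<1} \<times> cbox 0 1) (\<lambda>y. (snd y) ^ (n - 1) * F (v (fst y * snd y)))"
    by (intro continuous_intros continuous_on_compose2[OF F_continuous[of UNIV]]) auto
  then show ?thesis
    unfolding avg_def using integral_continuous_on_param[of "{0..<1}" 0 1 "\<lambda>\<sigma> x. x ^ (n - 1) * F (v (\<sigma> * x))"]
    by (simp add: case_prod_unfold)
qed

lemma avg_bounded: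
  assumes "continuous_on {0..<1} v" "0 \<le> \<sigma>" "\<sigma> < 1"
  shows "\<bar>avg v \<sigma>\<bar> \<le> C"
proof -
  have "norm (avg v \<sigma>) \<le> integral {0..1} (\<lambda>x::real. C)"
    unfolding avg_def
  proof (rule integral_norm_bound_integral[OF avg_integrable[OF assms]])
    fix x :: real assume x: "x \<in> {0..1}"
    have "norm (x ^ (n - 1) * F (v (\<sigma> * x))) = x ^ (n - 1) * \<bar>F (v (\<sigma> * x))\<bar>"
      using x by (simp add: abs_mult)
    also have "\<dots> \<le> 1 * C" using x F_bounded C_nonneg
      by (intro mult_mono power_le_one) auto
    finally show "norm (x ^ (n - 1) * F (v (\<sigma> * x))) \<le> C" by simp
  qed auto
  then show ?thesis by simp
qed

lemma avg_diff:
  assumes "continuous_on {0..<1} v" "continuous_on {0..<1} u" "0 \<le> \<sigma>" "\<sigma> < 1" "D \<ge> 0"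
    and D: "\<And>r. 0 \<le> r \<Longrightarrow> r \<le> \<sigma> \<Longrightarrow> \<bar>v r - u r\<bar> \<le> D"
  shows "\<bar>avg v \<sigma> - avg u \<sigma>\<bar> \<le> L * D"
proof -
  note i = avg_integrable[OF assms(1,3,4)] avg_integrable[OF assms(2,3,4)]
  have "norm (integral {0..1} (\<lambda>x. x ^ (n - 1) * F (v (\<sigma> * x)) - x ^ (n - 1) * F (u (\<sigma> * x))))
      \<le> integral {0..1} (\<lambda>x::real. L * D)"
  proof (rule integral_norm_bound_integral)
    fix x :: real assume x: "x \<in> {0..1}"
    have "norm (x ^ (n - 1) * F (v (\<sigma> * x)) - x ^ (n - 1) * F (u (\<sigma> * x)))
        = x ^ (n - 1) * \<bar>F (v (\<sigma> * x)) - F (u (\<sigma> * x))\<bar>"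
      using x by (simp add: abs_mult flip: right_diff_distrib)
    also have "\<dots> \<le> 1 * (L * D)"
    proof (rule mult_mono)
      have "\<bar>F (v (\<sigma> * x)) - F (u (\<sigma> * x))\<bar> \<le> L * \<bar>v (\<sigma> * x) - u (\<sigma> * x)\<bar>" by (rule F_lipschitz)
      also have "\<dots> \<le> L * D" using x assms(3) L_pos
        by (intro mult_left_mono D) (auto simp: mult_left_le)
      finally show "\<bar>F (v (\<sigma> * x)) - F (u (\<sigma> * x))\<bar> \<le> L * D" .
    qed (use x in \<open>auto intro: power_le_one\<close>)
    finally show "norm (x ^ (n - 1) * F (v (\<sigma> * x)) - x ^ (n - 1) * F (u (\<sigma> * x))) \<le> L * D" by simp
  qed (use i in \<open>auto intro: integrable_diff\<close>)
  then show ?thesis unfolding avg_def using i by (simp add: integral_diff)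
qed

lemma picard_0: "picard a v 0 = a"
  by (simp add: picard_def)

lemma picard_deriv_within:
  assumes "continuous_on {0..<1} v" "0 \<le> s" "s \<le> T" "T < 1"
  shows "(picard a v has_real_derivative - \<kappa> * (avg v s / (1 - s))) (at s within {0..T})"
proof -
  have "continuous_on {0..T} (\<lambda>\<sigma>. avg v \<sigma> / (1 - \<sigma>))"
    using assms by (intro continuous_intros continuous_on_subset[OF avg_continuous[OF assms(1)]]) auto
  then have "((\<lambda>s. integral {0..s} (\<lambda>\<sigma>. avg v \<sigma> / (1 - \<sigma>))) has_real_derivative avg v s / (1 - s))
      (at s within {0..T})"
    using assms by (intro integral_has_real_derivative) auto
  then show ?thesis unfolding picard_def
    by (auto intro!: derivative_eq_intros)
qed

lemma picard_continuous:
  assumes "continuous_on {0..<1} v"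
  shows "continuous_on {0..<1} (picard a v)"
proof -
  have "isCont (picard a v) s \<or> s = 0 \<and> continuous (at 0 within {0..1/2}) (picard a v)" if "s \<in> {0..<1}" for s
  proof (cases "s = 0")
    case True then show ?thesis
      using DERIV_continuous[OF picard_deriv_within[OF assms, of 0 "1/2" a]] by simp
  next
    case False
    have "(picard a v has_real_derivative - \<kappa> * (avg v s / (1 - s))) (at s within {0..(1+s)/2})"
      using that by (intro picard_deriv_within[OF assms]) auto
    then have "(picard a v has_real_derivative - \<kappa> * (avg v s / (1 - s))) (at s)"
      using that False by (simp add: at_within_Icc_at)
    then show ?thesis using DERIV_isCont by blast
  qed
  moreover have "at (0::real) within {0..1/2} = at 0 within {0..<1}"
    by (rule at_within_nhd[of _ "{-1/2<..<1/2}"]) auto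
  ultimately have "continuous (at s within {0..<1}) (picard a v)" if "s \<in> {0..<1}" for s
    using that continuous_at_imp_continuous_at_within by metis
  then show ?thesis by (simp add: continuous_on_eq_continuous_within)
qed

lemma picard_deriv:
  assumes "continuous_on {0..<1} v" "0 < s" "s < 1"
  shows "(picard a v has_real_derivative - \<kappa> * (avg v s / (1 - s))) (at s)"
proof -
  have "(picard a v has_real_derivative - \<kappa> * (avg v s / (1 - s))) (at s within {0..(1+s)/2})"
    using assms by (intro picard_deriv_within[OF assms(1)]) auto
  then show ?thesis
    using assms by (simp add: at_within_Icc_at)
qed

text \<open>A bounded reaction gives W' = O(1 / (1 - s)), that is, logarithmic growth. The coarser
  power bound is chosen because it is the weight of the norm in which the operator
  contracts.\<close>

lemma picard_bound:
  assumes "continuous_on {0..<1} v" "0 \<le> s" "s < 1"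
  shows "\<bar>picard a v s\<bar> \<le> \<bar>a\<bar> + \<kappa> * C / \<beta> * (1 - s) powr (-\<beta>)"
proof -
  have "\<bar>picard a v s - picard a v 0\<bar> \<le> (\<kappa> * C / \<beta>) * (1 - s) powr (-\<beta>) - (\<kappa> * C / \<beta>) * (1 - 0) powr (-\<beta>)"
  proof (rule abs_diff_le_of_deriv_bound[where f' = "\<lambda>s. - \<kappa> * (avg v s / (1 - s))"
        and h = "\<lambda>s. (\<kappa> * C / \<beta>) * (1 - s) powr (-\<beta>)" and h' = "\<lambda>s. \<kappa> * C * (1 - s) powr (-\<beta> - 1)"])
    fix x assume x: "0 < x" "x < s"
    show "((\<lambda>s. (\<kappa> * C / \<beta>) * (1 - s) powr (-\<beta>)) has_real_derivative \<kappa> * C * (1 - x) powr (-\<beta> - 1)) (at x)"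
      using x assms beta_pos by (auto intro!: derivative_eq_intros simp: divide_simps)
    have "\<bar>avg v x\<bar> * (1 - x) powr (-1) \<le> C * (1 - x) powr (-\<beta> - 1)"
      using x assms beta_pos C_nonneg
      by (intro mult_mono avg_bounded powr_mono') auto
    then show "\<bar>- \<kappa> * (avg v x / (1 - x))\<bar> \<le> \<kappa> * C * (1 - x) powr (-\<beta> - 1)"
      using x assms kappa_pos by (simp add: abs_mult powr_minus divide_inverse mult.assoc)
  qed (use assms beta_pos picard_deriv[OF assms(1)] in \<open>auto intro!: continuous_intros continuous_on_subset[OF picard_continuous]\<close>)
  moreover have "0 \<le> \<kappa> * C / \<beta>" using kappa_pos C_nonneg beta_pos by simp
  ultimately show ?thesis by (simp add: picard_0)
qed

lemma picard_diff:
  assumes "continuous_on {0..<1} v" "continuous_on {0..<1} u" "0 \<le> s" "s < 1" "D \<ge> 0"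
    and D: "\<And>r. 0 \<le> r \<Longrightarrow> r < 1 \<Longrightarrow> \<bar>v r - u r\<bar> \<le> D * (1 - r) powr (-\<beta>)"
  shows "\<bar>picard a v s - picard b u s\<bar> \<le> \<bar>a - b\<bar> + D / 2 * (1 - s) powr (-\<beta>)"
proof -
  have "\<bar>(picard a v s - picard b u s) - (picard a v 0 - picard b u 0)\<bar>
     \<le> D / 2 * (1 - s) powr (-\<beta>) - D / 2 * (1 - 0) powr (-\<beta>)"
  proof (rule abs_diff_le_of_deriv_bound[where f = "\<lambda>s. picard a v s - picard b u s"
        and f' = "\<lambda>s. - \<kappa> * (avg v s / (1 - s)) - - \<kappa> * (avg u s / (1 - s))"
        and h = "\<lambda>s. D / 2 * (1 - s) powr (-\<beta>)" and h' = "\<lambda>s. \<kappa> * L * D * (1 - s) powr (-\<beta> - 1)"])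
    fix x assume x: "0 < x" "x < s"
    show "((\<lambda>s. D / 2 * (1 - s) powr (-\<beta>)) has_real_derivative \<kappa> * L * D * (1 - x) powr (-\<beta> - 1)) (at x)"
      using x assms beta_pos by (auto intro!: derivative_eq_intros simp: divide_simps \<beta>_def)
    show "((\<lambda>s. picard a v s - picard b u s) has_real_derivative
         - \<kappa> * (avg v x / (1 - x)) - - \<kappa> * (avg u x / (1 - x))) (at x)"
      using x assms by (intro DERIV_diff picard_deriv) auto
    have "\<bar>avg v x - avg u x\<bar> \<le> L * (D * (1 - x) powr (-\<beta>))"
    proof (rule avg_diff)
      fix r assume r: "0 \<le> r" "r \<le> x"
      have "\<bar>v r - u r\<bar> \<le> D * (1 - r) powr (-\<beta>)" using r x assms by (intro D) auto
      also have "\<dots> \<le> D * (1 - x) powr (-\<beta>)"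
        using r x assms beta_pos by (intro mult_left_mono powr_mono2') auto
      finally show "\<bar>v r - u r\<bar> \<le> D * (1 - x) powr (-\<beta>)" .
    qed (use x assms in auto)
    then have "\<kappa> * \<bar>avg v x - avg u x\<bar> / (1 - x) \<le> \<kappa> * (L * (D * (1 - x) powr (-\<beta>))) / (1 - x)"
      using x assms kappa_pos by (intro divide_right_mono mult_left_mono) auto
    also have "\<dots> = \<kappa> * L * D * (1 - x) powr (-\<beta> - 1)"
      using x assms by (simp add: powr_diff)
    also have "\<kappa> * \<bar>avg v x - avg u x\<bar> / (1 - x) = \<bar>- \<kappa> * (avg v x / (1 - x)) - - \<kappa> * (avg u x / (1 - x))\<bar>"
    proof -
      have "- \<kappa> * (avg v x / (1 - x)) - - \<kappa> * (avg u x / (1 - x)) = - (\<kappa> * (avg v x - avg u x) / (1 - x))"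
        using x assms by (simp add: divide_simps) (simp add: algebra_simps)
      then show ?thesis using x assms kappa_pos by (simp only: abs_minus_cancel abs_divide abs_mult) auto
    qed
    finally show "\<bar>- \<kappa> * (avg v x / (1 - x)) - - \<kappa> * (avg u x / (1 - x))\<bar> \<le> \<kappa> * L * D * (1 - x) powr (-\<beta> - 1)" .
  qed (use assms in \<open>auto intro!: continuous_intros continuous_on_subset[OF picard_continuous]\<close>)
  then show ?thesis using assms(5) by (simp add: picard_0)
qed

text \<open>In the variable \<open>\<tau> = - ln (1 - s)\<close>, the Picard operator is a contraction on bounded
  continuous functions for the sup norm with weight \<open>exp (- \<beta> \<tau>) = (1 - s) powr \<beta>\<close>.\<close>

definition unweight :: "(real \<Rightarrow>\<^sub>C real) \<Rightarrow> real \<Rightarrow> real" where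
  "unweight \<phi> s = (1 - s) powr (-\<beta>) * apply_bcontfun \<phi> (- ln (1 - s))"

text \<open>Only \<tau> \<ge> 0 corresponds to points of [0, 1), whereas the bounded continuous
  functions live on the whole line; \<open>max 0 \<tau>\<close> freezes the value at \<tau> = 0 on
  the negative side.\<close>

definition weighted :: "(real \<Rightarrow> real) \<Rightarrow> real \<Rightarrow> real" where
  "weighted v \<tau> = exp (- \<beta> * max 0 \<tau>) * v (1 - exp (- max 0 \<tau>))"

lemma unweight_continuous: "continuous_on {0..<1} (unweight \<phi>)"
  unfolding unweight_def
  by (intro continuous_intros continuous_on_compose2[OF continuous_on_apply_bcontfun[of UNIV]]) auto

lemma weighted_picard_bcontfun:
  assumes "continuous_on {0..<1} v"
  shows "weighted (picard a v) \<in> bcontfun"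
proof (rule bcontfun_normI)
  show "continuous_on UNIV (weighted (picard a v))"
    unfolding weighted_def
    by (intro continuous_intros continuous_on_compose2[OF picard_continuous[OF assms]]) (auto simp: max_def)
  show "norm (weighted (picard a v) \<tau>) \<le> \<bar>a\<bar> + \<kappa> * C / \<beta>" for \<tau>
  proof -
    define t where "t = max 0 \<tau>"
    have t: "t \<ge> 0" unfolding t_def by (rule max.cobounded1)
    have "\<bar>picard a v (1 - exp (- t))\<bar> \<le> \<bar>a\<bar> + \<kappa> * C / \<beta> * (1 - (1 - exp (-t))) powr (-\<beta>)"
      using t by (intro picard_bound[OF assms]) auto
    also have "\<dots> = \<bar>a\<bar> + \<kappa> * C / \<beta> * exp (\<beta> * t)" by (simp add: powr_def mult.commute)
    finally have "exp (- \<beta> * t) * \<bar>picard a v (1 - exp (- t))\<bar> \<le> exp (- \<beta> * t) * (\<bar>a\<bar> + \<kappa> * C / \<beta> * exp (\<beta> * t))"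
      by (intro mult_left_mono) auto
    also have "\<dots> = exp (- \<beta> * t) * \<bar>a\<bar> + \<kappa> * C / \<beta>"
      by (simp add: algebra_simps exp_minus)
    also have "exp (- \<beta> * t) * \<bar>a\<bar> \<le> 1 * \<bar>a\<bar>"
      using t beta_pos by (intro mult_right_mono) auto
    finally show ?thesis by (simp add: weighted_def t_def abs_mult)
  qed
qed

definition picard_op :: "real \<Rightarrow> (real \<Rightarrow>\<^sub>C real) \<Rightarrow> (real \<Rightarrow>\<^sub>C real)" where
  "picard_op a \<phi> = Bcontfun (weighted (picard a (unweight \<phi>)))"

lemma picard_op_apply: "apply_bcontfun (picard_op a \<phi>) = weighted (picard a (unweight \<phi>))"
  unfolding picard_op_def by (simp add: Bcontfun_inverse weighted_picard_bcontfun unweight_continuous)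

lemma unweight_dist:
  assumes "r < 1"
  shows "\<bar>unweight \<phi> r - unweight \<psi> r\<bar> \<le> dist \<phi> \<psi> * (1 - r) powr (-\<beta>)"
proof -
  have "\<bar>unweight \<phi> r - unweight \<psi> r\<bar> = (1 - r) powr (-\<beta>) * \<bar>apply_bcontfun \<phi> (- ln (1 - r)) - apply_bcontfun \<psi> (- ln (1 - r))\<bar>"
    unfolding unweight_def by (simp add: abs_mult flip: right_diff_distrib)
  also have "\<dots> \<le> (1 - r) powr (-\<beta>) * dist \<phi> \<psi>"
    using dist_bounded[of \<phi> "- ln (1 - r)" \<psi>] by (intro mult_left_mono) (auto simp: dist_real_def)
  finally show ?thesis by (simp add: mult.commute)
qed

lemma picard_op_dist: "dist (picard_op a \<phi>) (picard_op b \<psi>) \<le> \<bar>a - b\<bar> + dist \<phi> \<psi> / 2"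
proof (rule dist_bound)
  fix \<tau> :: real
  define t where "t = max 0 \<tau>"
  have t: "t \<ge> 0" unfolding t_def by (rule max.cobounded1)
  have "\<bar>picard a (unweight \<phi>) (1 - exp (-t)) - picard b (unweight \<psi>) (1 - exp (-t))\<bar>
      \<le> \<bar>a - b\<bar> + dist \<phi> \<psi> / 2 * (1 - (1 - exp (-t))) powr (-\<beta>)"
    using t by (intro picard_diff unweight_continuous unweight_dist) auto
  also have "\<dots> = \<bar>a - b\<bar> + dist \<phi> \<psi> / 2 * exp (\<beta> * t)" by (simp add: powr_def mult.commute)
  finally have "exp (- \<beta> * t) * \<bar>picard a (unweight \<phi>) (1 - exp (-t)) - picard b (unweight \<psi>) (1 - exp (-t))\<bar>
      \<le> exp (- \<beta> * t) * (\<bar>a - b\<bar> + dist \<phi> \<psi> / 2 * exp (\<beta> * t))"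
    by (intro mult_left_mono) auto
  also have "\<dots> = exp (- \<beta> * t) * \<bar>a - b\<bar> + dist \<phi> \<psi> / 2"
    by (simp add: algebra_simps exp_minus)
  also have "exp (- \<beta> * t) * \<bar>a - b\<bar> \<le> 1 * \<bar>a - b\<bar>"
    using t beta_pos by (intro mult_right_mono) auto
  finally show "dist (apply_bcontfun (picard_op a \<phi>) \<tau>) (apply_bcontfun (picard_op b \<psi>) \<tau>) \<le> \<bar>a - b\<bar> + dist \<phi> \<psi> / 2"
    by (simp add: picard_op_apply weighted_def t_def dist_real_def abs_mult flip: right_diff_distrib)
qed

lemma picard_op_fixed_point: "\<exists>\<phi>. picard_op a \<phi> = \<phi>"
  using banach_fix_type[of "1/2" "picard_op a"] picard_op_dist[of a _ a] by auto

section \<open>Solutions of the initial value problem\<close>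

definition sol :: "real \<Rightarrow> real \<Rightarrow> real" where
  "sol a = unweight (SOME \<phi>. picard_op a \<phi> = \<phi>)"

lemma sol_continuous: "continuous_on {0..<1} (sol a)"
  unfolding sol_def by (rule unweight_continuous)

lemma sol_fixed:
  assumes "0 \<le> s" "s < 1"
  shows "sol a s = picard a (sol a) s"
proof -
  define \<phi> where "\<phi> = (SOME \<phi>. picard_op a \<phi> = \<phi>)"
  have "picard_op a \<phi> = \<phi>" unfolding \<phi>_def by (rule someI_ex[OF picard_op_fixed_point])
  then have "apply_bcontfun \<phi> = weighted (picard a (unweight \<phi>))" using picard_op_apply by metis
  moreover have "(1 - s) powr (-\<beta>) * exp (\<beta> * ln (1 - s)) = 1"
    using assms by (simp add: powr_def flip: exp_add)
  ultimately have "unweight \<phi> s = picard a (unweight \<phi>) s"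
    using assms unfolding unweight_def[of \<phi> s] by (simp add: weighted_def max_def)
  then show ?thesis by (simp add: sol_def \<phi>_def)
qed

lemma sol_0: "sol a 0 = a"
  using sol_fixed[of 0] by (simp add: picard_0)

text \<open>For two fixed points \<open>picard_op_dist\<close> reads d \<le> |a - b| + d / 2. The
  weight blows up at s = 1, so uniform closeness is obtained only on intervals [0, T] with T <
  1.\<close>

lemma sol_dep:
  assumes "0 \<le> s" "s < 1"
  shows "\<bar>sol a s - sol b s\<bar> \<le> 2 * \<bar>a - b\<bar> * (1 - s) powr (-\<beta>)"
proof -
  define \<phi> where "\<phi> a = (SOME \<phi>. picard_op a \<phi> = \<phi>)" for a
  have "picard_op a (\<phi> a) = \<phi> a" for a unfolding \<phi>_def by (rule someI_ex[OF picard_op_fixed_point])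
  then have "dist (\<phi> a) (\<phi> b) \<le> 2 * \<bar>a - b\<bar>"
    using picard_op_dist[of a "\<phi> a" b "\<phi> b"] by simp
  have "\<bar>sol a s - sol b s\<bar> \<le> dist (\<phi> a) (\<phi> b) * (1 - s) powr (-\<beta>)"
    unfolding sol_def \<phi>_def using assms by (intro unweight_dist) auto
  also have "\<dots> \<le> 2 * \<bar>a - b\<bar> * (1 - s) powr (-\<beta>)"
    by (intro mult_right_mono) (fact, simp)
  finally show ?thesis .
qed

section \<open>The flux and its value at the right end\<close>

definition flux0 :: "real \<Rightarrow> real \<Rightarrow> real" where
  "flux0 a s = - \<kappa> * integral {0..s} (\<lambda>r. r ^ (n - 1) * F (sol a r))"

lemma flux0_eq:
  assumes "0 < s" "s < 1"
  shows "flux0 a s = - \<kappa> * (s ^ n * avg (sol a) s)"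
proof -
  define f where "f r = r ^ (n - 1) * F (sol a r)" for r
  have "((\<lambda>x. x ^ (n - 1) * F (sol a (s * x))) has_integral avg (sol a) s) {0..1}"
    unfolding avg_def using assms by (intro integrable_integral avg_integrable sol_continuous) auto
  then have "((\<lambda>x. s ^ (n - 1) * (x ^ (n - 1) * F (sol a (s * x)))) has_integral s ^ (n - 1) * avg (sol a) s) {0..1}"
    by (rule has_integral_mult_right)
  then have "((\<lambda>x. f (s * x)) has_integral s ^ (n - 1) * avg (sol a) s) (cbox 0 1)"
    by (simp add: f_def power_mult_distrib mult.assoc)
  then have "((\<lambda>x. f (s * (inverse s * x + 0))) has_integral s * (s ^ (n - 1) * avg (sol a) s)) ((\<lambda>x. s * x) ` {0..1})"
    using has_integral_affinity[of "\<lambda>x. f (s * x)" "s ^ (n - 1) * avg (sol a) s" 0 1 "inverse s" 0] assms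
    by (simp add: field_simps)
  then have "(f has_integral s * (s ^ (n - 1) * avg (sol a) s)) {0..s}"
    using assms by (simp add: image_mult_atLeastAtMost_if mult.assoc[symmetric])
  moreover have "s * s ^ (n - 1) = s ^ n" using n_pos by (simp flip: power_Suc)
  ultimately show ?thesis unfolding flux0_def f_def
    by (simp add: integral_unique mult.assoc[symmetric])
qed

lemma flux0_deriv:
  assumes "0 < s" "s < 1"
  shows "(flux0 a has_real_derivative - \<kappa> * s ^ (n - 1) * F (sol a s)) (at s)"
proof -
  have "continuous_on {0..(1+s)/2} (\<lambda>r. r ^ (n - 1) * F (sol a r))"
    using assms by (intro continuous_intros continuous_on_compose2[OF F_continuous[of UNIV]]
        continuous_on_subset[OF sol_continuous]) auto
  then have "((\<lambda>s. integral {0..s} (\<lambda>r. r ^ (n - 1) * F (sol a r))) has_real_derivative s ^ (n - 1) * F (sol a s))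
      (at s within {0..(1+s)/2})"
    using assms by (intro integral_has_real_derivative) auto
  then have "((\<lambda>s. integral {0..s} (\<lambda>r. r ^ (n - 1) * F (sol a r))) has_real_derivative s ^ (n - 1) * F (sol a s)) (at s)"
    using assms by (simp add: at_within_Icc_at)
  then show ?thesis unfolding flux0_def
    by (auto intro!: derivative_eq_intros)
qed

lemma sol_deriv:
  assumes "0 < s" "s < 1"
  shows "(sol a has_real_derivative flux0 a s / (s ^ n * (1 - s))) (at s)"
proof -
  have "(picard a (sol a) has_real_derivative - \<kappa> * (avg (sol a) s / (1 - s))) (at s)"
    using assms by (intro picard_deriv sol_continuous) auto
  then have "(sol a has_real_derivative - \<kappa> * (avg (sol a) s / (1 - s))) (at s)"
  proof (rule has_field_derivative_transform_within_open[where S = "{0<..<1}"])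
    show "\<And>x. x \<in> {0<..<1} \<Longrightarrow> picard a (sol a) x = sol a x" using sol_fixed by simp
  qed (use assms in auto)
  moreover have "- \<kappa> * (avg (sol a) s / (1 - s)) = flux0 a s / (s ^ n * (1 - s))"
    using assms by (simp add: flux0_eq)
  ultimately show ?thesis by simp
qed

text \<open>The derivative of the flux involves \<open>W\<close> only through the bounded function
  \<open>F\<close>, so it stays below \<open>\<kappa> * C\<close> even where \<open>W\<close> itself
  diverges; this gives p a value at s = 1.\<close>

lemma flux0_lipschitz: "(\<kappa> * C)-lipschitz_on {0..<1} (flux0 a)"
proof (rule lipschitz_onI)
  have cont: "continuous_on {0..t} (flux0 a)" if "t < 1" for t
  proof -
    have "continuous_on {0..t} (\<lambda>r. r ^ (n - 1) * F (sol a r))"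
      using that by (intro continuous_intros continuous_on_compose2[OF F_continuous[of UNIV]]
        continuous_on_subset[OF sol_continuous]) auto
    then have "continuous_on {0..t} (\<lambda>s. integral {0..s} (\<lambda>r. r ^ (n - 1) * F (sol a r)))"
      by (intro indefinite_integral_continuous_1 integrable_continuous_interval)
    then show ?thesis unfolding flux0_def by (intro continuous_intros)
  qed
  have le: "\<bar>flux0 a y - flux0 a x\<bar> \<le> \<kappa> * C * y - \<kappa> * C * x" if "0 \<le> x" "x \<le> y" "y < 1" for x y
  proof (rule abs_diff_le_of_deriv_bound[where f' = "\<lambda>s. - \<kappa> * s ^ (n - 1) * F (sol a s)" and h' = "\<lambda>s. \<kappa> * C"])
    fix r assume r: "x < r" "r < y"
    have "r ^ (n - 1) * \<bar>F (sol a r)\<bar> \<le> 1 * C"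
      using r that F_bounded C_nonneg by (intro mult_mono power_le_one) auto
    then show "\<bar>- \<kappa> * r ^ (n - 1) * F (sol a r)\<bar> \<le> \<kappa> * C"
      using r that kappa_pos by (simp add: abs_mult mult.assoc)
  qed (use that in \<open>auto simp: flux0_deriv[simplified] intro!: derivative_eq_intros continuous_intros continuous_on_subset[OF cont[of y]]\<close>)
  fix x y :: real assume xy: "x \<in> {0..<1}" "y \<in> {0..<1}"
  show "dist (flux0 a x) (flux0 a y) \<le> \<kappa> * C * dist x y"
    using le[of x y] le[of y x] xy
    by (cases "x \<le> y") (auto simp: dist_real_def algebra_simps abs_minus_commute)
qed (use kappa_pos C_nonneg in auto)

text \<open>The continuous extension of \<open>flux0\<close> to s = 1, uniquely determined on
  [0, 1]; the values elsewhere are arbitrary.\<close>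

definition flux :: "real \<Rightarrow> real \<Rightarrow> real" where
  "flux a = (SOME g. (\<kappa> * C)-lipschitz_on {0..1} g \<and> (\<forall>x\<in>{0..<1}. g x = flux0 a x))"

lemma flux_lipschitz: "(\<kappa> * C)-lipschitz_on {0..1} (flux a)"
  and flux_eq_flux0: "0 \<le> s \<Longrightarrow> s < 1 \<Longrightarrow> flux a s = flux0 a s"
proof -
  have "\<exists>g. (\<kappa> * C)-lipschitz_on {0..1} g \<and> (\<forall>x\<in>{0..<1}. g x = flux0 a x)"
    using lipschitz_extend_closure[OF flux0_lipschitz] by simp
  from someI_ex[OF this, folded flux_def]
  show "(\<kappa> * C)-lipschitz_on {0..1} (flux a)" "0 \<le> s \<Longrightarrow> s < 1 \<Longrightarrow> flux a s = flux0 a s" by auto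
qed

lemma flux_0: "flux a 0 = 0"
  by (simp add: flux_eq_flux0 flux0_def)

lemma flux_deriv:
  assumes "0 < s" "s < 1"
  shows "(flux a has_real_derivative - \<kappa> * s ^ (n - 1) * F (sol a s)) (at s)"
  using assms by (intro has_field_derivative_transform_within_open[OF flux0_deriv, where S = "{0<..<1}"])
    (auto simp: flux_eq_flux0)

lemma sol_deriv_flux:
  assumes "0 < s" "s < 1"
  shows "(sol a has_real_derivative flux a s / (s ^ n * (1 - s))) (at s)"
  using sol_deriv[OF assms] assms by (simp add: flux_eq_flux0)

lemma flux_continuous: "continuous_on {0..1} (flux a)"
  using flux_lipschitz by (rule lipschitz_on_continuous_on)

lemma flux_lipschitzD:
  assumes "0 \<le> s" "s \<le> 1" "0 \<le> t" "t \<le> 1"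
  shows "\<bar>flux a s - flux a t\<bar> \<le> \<kappa> * C * \<bar>s - t\<bar>"
  using lipschitz_onD[OF flux_lipschitz, of s t] assms by (simp add: dist_real_def)

lemma sol_isCont: "0 < s \<Longrightarrow> s < 1 \<Longrightarrow> isCont (sol a) s"
  using DERIV_isCont[OF sol_deriv] by blast

text \<open>A flux of size B (1 - r) cancels the singular factor of W', and s \<ge> 1/2 bounds 1 /
  r^n by 2^n. This is applied with B = \<kappa> C and, in the bootstrap at s = 1, with values of B
  that shrink.\<close>

lemma sol_increment_bound:
  assumes "1/2 \<le> s" "s \<le> t" "t < 1" "B \<ge> 0"
    and B: "\<And>r. s < r \<Longrightarrow> r < t \<Longrightarrow> \<bar>flux b r\<bar> \<le> B * (1 - r)"
  shows "\<bar>sol b t - sol b s\<bar> \<le> 2 ^ n * B * (t - s)"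
proof -
  have "\<bar>sol b t - sol b s\<bar> \<le> 2 ^ n * B * t - 2 ^ n * B * s"
  proof (rule abs_diff_le_of_deriv_bound[where f' = "\<lambda>r. flux b r / (r ^ n * (1 - r))" and h' = "\<lambda>r. 2 ^ n * B"])
    fix r assume r: "s < r" "r < t"
    have "(1/2) ^ n \<le> r ^ n" using r assms by (intro power_mono) auto
    then have "1 \<le> 2 ^ n * r ^ n" by (simp add: power_divide field_simps)
    have "\<bar>flux b r / (r ^ n * (1 - r))\<bar> = \<bar>flux b r\<bar> / (r ^ n * (1 - r))"
      using r assms by simp
    also have "\<dots> \<le> B * (1 - r) / (r ^ n * (1 - r))"
      using r assms by (intro divide_right_mono B) auto
    also have "\<dots> = B / r ^ n" using r assms by simp
    also have "\<dots> \<le> 2 ^ n * B"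
      using r assms mult_left_mono[OF \<open>1 \<le> 2 ^ n * r ^ n\<close> \<open>B \<ge> 0\<close>] by (simp add: field_simps)
    finally show "\<bar>flux b r / (r ^ n * (1 - r))\<bar> \<le> 2 ^ n * B" .
  qed (use assms in \<open>auto intro!: sol_deriv_flux derivative_eq_intros continuous_intros
      continuous_on_subset[OF sol_continuous]\<close>)
  then show ?thesis by (simp add: algebra_simps)
qed

text \<open>A zero \<open>z\<close> of the flux forces \<open>\<bar>p s\<bar> \<le> \<kappa> C (z - s) \<le> \<kappa> C (1 - s)\<close> for \<open>s \<le> z\<close>,
  which cancels the singular factor \<open>1 / (1 - s)\<close> uniformly in the position of \<open>z\<close>.\<close>

lemma flux_le_before_zero:
  assumes "flux b z = 0" "0 \<le> r" "r \<le> z" "z \<le> 1"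
  shows "\<bar>flux b r\<bar> \<le> \<kappa> * C * (1 - r)"
proof -
  have "\<bar>flux b r\<bar> \<le> \<kappa> * C * \<bar>r - z\<bar>"
    using flux_lipschitzD[of r z b] assms by simp
  also have "\<dots> \<le> \<kappa> * C * (1 - r)"
    using assms kappa_pos C_nonneg by (intro mult_left_mono) auto
  finally show ?thesis .
qed

section \<open>Control before a zero of the flux, and uniqueness at equilibria\<close>

definition K :: real where "K = 2 ^ n * (\<kappa> * C)"

lemma K_nonneg: "0 \<le> K"
  using kappa_pos C_nonneg by (simp add: K_def)

lemma sol_lipschitz_before_zero:
  assumes "flux b z = 0" "1/2 \<le> s" "s \<le> t" "t \<le> z" "z \<le> 1" "t < 1"
  shows "\<bar>sol b t - sol b s\<bar> \<le> K * (t - s)"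
  unfolding K_def using assms kappa_pos C_nonneg
  by (intro sol_increment_bound flux_le_before_zero[of b z]) auto

text \<open>Backward Gronwall argument for the pair (W - e, p), which vanishes at s. The system is
  regular only on compact parts of (0, 1), so the constant depends on the left end x; the pair
  vanishes at every such x, and x -> 0 gives a = e by continuity of \<open>W\<close> at 0.\<close>

lemma equilibrium_unique_interior:
  assumes "F e = 0" "0 < s" "s < 1" "sol a s = e" "flux a s = 0"
  shows "a = e"
proof -
  have const: "sol a x = e" if x: "0 < x" "x \<le> s" for x
  proof -
    \<comment> \<open>The first summand bounds 1 / (r^n (1 - r)) on [x, s], the second is a
      Lipschitz constant for p' as a function of \<open>W\<close>. Together they absorb the two
      cross terms in the derivative of y^2 + p^2, which makes \<open>E\<close>
      nondecreasing.\<close>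
    define M where "M = 1 / (x ^ n * (1 - s)) + \<kappa> * L"
    define E where "E r = ((sol a r - e)\<^sup>2 + (flux a r)\<^sup>2) * exp (M * r)" for r
    have "E x \<le> E s"
    proof (rule DERIV_nonneg_imp_increasing_open[where f = E])
      show "continuous_on {x..s} E" unfolding E_def[abs_def] using x assms
        by (intro continuous_intros continuous_on_subset[OF sol_continuous] continuous_on_subset[OF flux_continuous]) auto
      fix r assume r: "x < r" "r < s"
      define y p u v where "y = sol a r - e" and "p = flux a r"
        and "u = 1 / (r ^ n * (1 - r))" and "v = - \<kappa> * r ^ (n - 1) * F (sol a r)"
      have 1: "(sol a has_real_derivative p * u) (at r)"
        using sol_deriv_flux[of r a] r x assms by (simp add: p_def u_def)
      have 2: "(flux a has_real_derivative v) (at r)"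
        using flux_deriv[of r a] r x assms by (simp add: v_def)
      have D: "(E has_real_derivative (2 * y * (p * u) + 2 * p * v + M * (y\<^sup>2 + p\<^sup>2)) * exp (M * r)) (at r)"
        unfolding E_def using 1 2
        by (auto intro!: derivative_eq_intros simp: y_def p_def algebra_simps power2_eq_square)
      have u0: "0 \<le> u" using r x assms by (simp add: u_def)
      have u: "u \<le> 1 / (x ^ n * (1 - s))"
        unfolding u_def using r x assms by (intro divide_left_mono mult_mono power_mono mult_pos_pos) auto
      have "\<bar>v\<bar> = \<kappa> * r ^ (n - 1) * \<bar>F (sol a r) - F e\<bar>"
        using r x kappa_pos assms by (simp add: v_def abs_mult)
      also have "\<dots> \<le> \<kappa> * 1 * (L * \<bar>sol a r - e\<bar>)"
        using r x kappa_pos assms L_pos by (intro mult_mono F_lipschitz power_le_one) auto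
      finally have v: "\<bar>v\<bar> \<le> \<kappa> * L * \<bar>y\<bar>" by (simp add: y_def)
      have yp: "2 * (\<bar>y\<bar> * \<bar>p\<bar>) \<le> y\<^sup>2 + p\<^sup>2"
        using zero_le_power2[of "\<bar>y\<bar> - \<bar>p\<bar>"] by (simp add: power2_diff)
      have "\<bar>2 * y * (p * u)\<bar> = (2 * (\<bar>y\<bar> * \<bar>p\<bar>)) * u" using u0 by (simp add: abs_mult)
      also have "\<dots> \<le> (y\<^sup>2 + p\<^sup>2) * (1 / (x ^ n * (1 - s)))"
        using u u0 yp by (intro mult_mono) auto
      finally have a1: "\<bar>2 * y * (p * u)\<bar> \<le> (y\<^sup>2 + p\<^sup>2) * (1 / (x ^ n * (1 - s)))" .
      have "\<bar>2 * p * v\<bar> = 2 * \<bar>p\<bar> * \<bar>v\<bar>" by (simp add: abs_mult)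
      also have "\<dots> \<le> 2 * \<bar>p\<bar> * (\<kappa> * L * \<bar>y\<bar>)" using v by (intro mult_left_mono) auto
      also have "\<dots> = \<kappa> * L * (2 * (\<bar>y\<bar> * \<bar>p\<bar>))" by simp
      also have "\<dots> \<le> \<kappa> * L * (y\<^sup>2 + p\<^sup>2)" using yp kappa_pos L_pos by (intro mult_left_mono) auto
      finally have a2: "\<bar>2 * p * v\<bar> \<le> \<kappa> * L * (y\<^sup>2 + p\<^sup>2)" .
      have "M * (y\<^sup>2 + p\<^sup>2) = (y\<^sup>2 + p\<^sup>2) * (1 / (x ^ n * (1 - s))) + \<kappa> * L * (y\<^sup>2 + p\<^sup>2)"
        unfolding M_def distrib_right[of "1 / (x ^ n * (1 - s))"] by (simp only: mult.commute)
      then have "0 \<le> 2 * y * (p * u) + 2 * p * v + M * (y\<^sup>2 + p\<^sup>2)"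
        using a1 a2 by linarith
      then show "\<exists>y. (E has_real_derivative y) (at r) \<and> 0 \<le> y" using D by fastforce
    qed (use x in auto)
    also have "E s = 0" using assms by (simp add: E_def)
    finally have "(sol a x - e)\<^sup>2 + (flux a x)\<^sup>2 \<le> 0"
      by (simp add: E_def mult_le_0_iff)
    then show ?thesis by (simp add: sum_power2_le_zero_iff)
  qed
  have "(sol a \<longlongrightarrow> sol a 0) (at 0 within {0..<1})"
    using sol_continuous[of a] by (simp add: continuous_on_def)
  moreover have "at 0 within {0..<1} = at_right (0::real)"
    by (rule at_within_nhd[of _ "{-1<..<1}"]) auto
  ultimately have l: "(sol a \<longlongrightarrow> a) (at_right 0)" by (simp add: sol_0)
  have "\<forall>\<^sub>F x in at_right 0. sol a x = e"
    using eventually_at_right_real[OF \<open>0 < s\<close>] by eventually_elim (auto intro: const)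
  then have "(sol a \<longlongrightarrow> e) (at_right 0)" by (rule tendsto_eventually)
  then show ?thesis using l tendsto_unique by force
qed

text \<open>p(1) = 0 cancels the factor 1 / (1 - s), so \<open>W\<close> is Lipschitz near 1 and
  extends there. The linear rate starts the bootstrap of
  \<open>equilibrium_unique_end\<close>.\<close>

lemma sol_limit_at_1:
  assumes "flux a 1 = 0"
  shows "\<exists>l. (sol a \<longlongrightarrow> l) (at_left 1) \<and> (\<forall>s. 1/2 \<le> s \<and> s < 1 \<longrightarrow> \<bar>sol a s - l\<bar> \<le> K * (1 - s))"
proof -
  have "K-lipschitz_on {1/2..<1} (sol a)"
  proof (rule lipschitz_onI)
    fix x y :: real assume xy: "x \<in> {1/2..<1}" "y \<in> {1/2..<1}"
    show "dist (sol a x) (sol a y) \<le> K * dist x y"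
      using sol_lipschitz_before_zero[OF assms, of x y] sol_lipschitz_before_zero[OF assms, of y x] xy
      by (cases "x \<le> y") (auto simp: dist_real_def algebra_simps abs_minus_commute)
  qed (rule K_nonneg)
  then obtain g where g: "K-lipschitz_on (closure {1/2..<1}) g" "\<And>x. x \<in> {1/2..<1} \<Longrightarrow> g x = sol a x"
    using lipschitz_extend_closure by blast
  then have gl: "K-lipschitz_on {1/2..1} g" by simp
  have 2: "\<bar>sol a s - g 1\<bar> \<le> K * (1 - s)" if "1/2 \<le> s" "s < 1" for s
    using lipschitz_onD[OF gl, of s 1] that g(2)[of s] by (simp add: dist_real_def)
  have ev: "\<forall>\<^sub>F s in at_left 1. s \<in> {1/2<..<(1::real)}" by (rule eventually_at_left_real) simp
  have "((\<lambda>s. sol a s - g 1) \<longlongrightarrow> 0) (at_left 1)"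
  proof (rule Lim_null_comparison)
    show "\<forall>\<^sub>F s in at_left 1. norm (sol a s - g 1) \<le> K * (1 - s)"
      using ev by eventually_elim (auto intro: 2)
    show "((\<lambda>s. K * (1 - s)) \<longlongrightarrow> 0) (at_left 1)"
      by (auto intro!: tendsto_eq_intros)
  qed
  then have "(sol a \<longlongrightarrow> g 1) (at_left 1)" by (simp add: LIM_zero_iff)
  then show ?thesis using 2 by blast
qed

text \<open>Instead of Gronwall, which fails at the singular end, a bootstrap: |W - l| \<le> S near
  1 gives |F(W)| \<le> L S, hence |p| \<le> \<kappa> L S (1 - r) because p(1) = 0, hence |W - l|
  \<le> S / 2 on a short interval. Iteration makes \<open>W\<close> constant there, and the interior
  case applies.\<close>

lemma equilibrium_unique_end:
  assumes "flux a 1 = 0" "(sol a \<longlongrightarrow> l) (at_left 1)" "F l = 0"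
  shows "a = l"
proof -
  have "0 \<le> 2 ^ n * (\<kappa> * L)" using kappa_pos L_pos by simp
  \<comment> \<open>On an interval of this length one pass of the bootstrap halves the
    bound.\<close>
  then obtain \<delta> where \<delta>: "0 < \<delta>" "\<delta> \<le> 1/2" "2 ^ n * (\<kappa> * L) * \<delta> \<le> 1/2"
    by (rule small_step_exists[where e = "1/2"]) auto
  obtain l' where l': "(sol a \<longlongrightarrow> l') (at_left 1)" "\<And>s. 1/2 \<le> s \<and> s < 1 \<Longrightarrow> \<bar>sol a s - l'\<bar> \<le> K * (1 - s)"
    using sol_limit_at_1[OF assms(1)] by blast
  have "l' = l" using tendsto_unique[OF _ l'(1) assms(2)] by simp
  have halve: "\<bar>sol a s - l\<bar> \<le> K / 2 ^ m" if "1 - \<delta> \<le> s" "s < 1" for s m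
    using that
  proof (induction m arbitrary: s)
    case 0
    have "\<bar>sol a s - l\<bar> \<le> K * (1 - s)" using l'(2)[of s] 0 \<delta> \<open>l' = l\<close> by auto
    also have "\<dots> \<le> K * 1" using 0 \<delta> K_nonneg by (intro mult_left_mono) auto
    finally show ?case by simp
  next
    case (Suc m)
    define S where "S = K / 2 ^ m"
    have S0: "S \<ge> 0" using K_nonneg by (simp add: S_def)
    have fl: "\<bar>flux a r\<bar> \<le> (\<kappa> * (L * S)) * (1 - r)" if r: "1 - \<delta> \<le> r" "r < 1" for r
    proof -
      have "\<bar>flux a 1 - flux a r\<bar> \<le> (\<kappa> * (L * S)) * 1 - (\<kappa> * (L * S)) * r"
      proof (rule abs_diff_le_of_deriv_bound[where f' = "\<lambda>s. - \<kappa> * s ^ (n - 1) * F (sol a s)" and h' = "\<lambda>_. \<kappa> * (L * S)"])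
        fix x assume x: "r < x" "x < 1"
        have "\<bar>F (sol a x) - F l\<bar> \<le> L * \<bar>sol a x - l\<bar>" by (rule F_lipschitz)
        also have "\<dots> \<le> L * S" using Suc.IH[of x] x r L_pos S_def by (intro mult_left_mono) auto
        finally have "x ^ (n - 1) * \<bar>F (sol a x)\<bar> \<le> 1 * (L * S)"
          using x r \<delta> assms by (intro mult_mono power_le_one) auto
        then show "\<bar>- \<kappa> * x ^ (n - 1) * F (sol a x)\<bar> \<le> \<kappa> * (L * S)"
          using x r \<delta> kappa_pos by (simp add: abs_mult mult.assoc)
        show "(flux a has_real_derivative - \<kappa> * x ^ (n - 1) * F (sol a x)) (at x)"
          using x r \<delta> by (intro flux_deriv) auto
      qed (use r \<delta> in \<open>auto intro!: derivative_eq_intros continuous_intros continuous_on_subset[OF flux_continuous]\<close>)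
      then show ?thesis using assms(1) by (simp add: algebra_simps)
    qed
    have inc: "\<bar>sol a t - sol a s\<bar> \<le> S / 2" if "s < t" "t < 1" for t
    proof -
      have "\<bar>sol a t - sol a s\<bar> \<le> 2 ^ n * (\<kappa> * (L * S)) * (t - s)"
        using Suc.prems \<delta> that kappa_pos L_pos S0 by (intro sol_increment_bound fl) auto
      also have "\<dots> \<le> 2 ^ n * (\<kappa> * (L * S)) * \<delta>"
        using Suc.prems that kappa_pos L_pos S0 by (intro mult_left_mono) auto
      also have "\<dots> = (2 ^ n * (\<kappa> * L) * \<delta>) * S" by simp
      also have "\<dots> \<le> (1/2) * S" using \<delta> S0 by (intro mult_right_mono) auto
      finally show ?thesis by simp
    qed
    have "\<bar>l - sol a s\<bar> \<le> S / 2"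
    proof (rule tendsto_upperbound)
      show "((\<lambda>t. \<bar>sol a t - sol a s\<bar>) \<longlongrightarrow> \<bar>l - sol a s\<bar>) (at_left 1)"
        by (intro tendsto_intros assms)
      show "\<forall>\<^sub>F t in at_left 1. \<bar>sol a t - sol a s\<bar> \<le> S / 2"
        using eventually_at_left_real[OF \<open>s < 1\<close>] by (rule eventually_mono) (use inc in \<open>force simp del: le_divide_eq_numeral1\<close>)
    qed simp
    then show ?case by (simp add: S_def abs_minus_commute)
  qed
  have const: "sol a s = l" if s: "1 - \<delta> \<le> s" "s < 1" for s
  proof -
    have "(\<lambda>m. K * (1/2) ^ m) \<longlonglongrightarrow> K * 0" by (intro tendsto_intros LIMSEQ_power_zero) auto
    then have "\<bar>sol a s - l\<bar> \<le> K * 0"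
      using halve[OF s] by (intro LIMSEQ_le_const) (auto simp: power_divide)
    then show ?thesis by simp
  qed
  define s where "s = 1 - \<delta> / 2"
  have s: "1 - \<delta> < s" "s < 1" "0 < s" using \<delta> by (auto simp: s_def)
  have "((\<lambda>_. l) has_real_derivative flux a s / (s ^ n * (1 - s))) (at s)"
    by (rule has_field_derivative_transform_within_open[OF sol_deriv_flux, where S = "{1 - \<delta><..<1}"])
      (use s const in auto)
  then have "flux a s / (s ^ n * (1 - s)) = 0" using DERIV_unique DERIV_const by blast
  then have "flux a s = 0" using s by simp
  then show ?thesis using equilibrium_unique_interior[OF assms(3), of s a] s const[of s] by simp
qed

section \<open>Continuous dependence of the flux on the initial value\<close>

lemma flux_dep:
  assumes "0 \<le> s" "s \<le> T" "T < 1"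
  shows "\<bar>flux a s - flux b s\<bar> \<le> \<kappa> * (L * (2 * \<bar>a - b\<bar> * (1 - T) powr (-\<beta>)))"
proof -
  define R where "R = \<kappa> * (L * (2 * \<bar>a - b\<bar> * (1 - T) powr (-\<beta>)))"
  have R0: "R \<ge> 0" using kappa_pos L_pos by (simp add: R_def)
  have "\<bar>(flux a s - flux b s) - (flux a 0 - flux b 0)\<bar> \<le> R * s - R * 0"
  proof (rule abs_diff_le_of_deriv_bound[where f = "\<lambda>s. flux a s - flux b s"
        and f' = "\<lambda>s. - \<kappa> * s ^ (n - 1) * F (sol a s) - - \<kappa> * s ^ (n - 1) * F (sol b s)" and h' = "\<lambda>_. R"])
    fix x assume x: "0 < x" "x < s"
    have "\<bar>F (sol a x) - F (sol b x)\<bar> \<le> L * \<bar>sol a x - sol b x\<bar>" by (rule F_lipschitz)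
    also have "\<dots> \<le> L * (2 * \<bar>a - b\<bar> * (1 - x) powr (-\<beta>))"
      using x assms L_pos by (intro mult_left_mono sol_dep) auto
    also have "\<dots> \<le> L * (2 * \<bar>a - b\<bar> * (1 - T) powr (-\<beta>))"
      using x assms L_pos beta_pos by (intro mult_left_mono powr_mono2') auto
    finally have "x ^ (n - 1) * \<bar>F (sol a x) - F (sol b x)\<bar> \<le> 1 * (L * (2 * \<bar>a - b\<bar> * (1 - T) powr (-\<beta>)))"
      using x assms by (intro mult_mono power_le_one) auto
    then have "\<kappa> * (x ^ (n - 1) * \<bar>F (sol a x) - F (sol b x)\<bar>) \<le> R"
      using kappa_pos by (simp add: R_def)
    moreover have "- \<kappa> * x ^ (n - 1) * F (sol a x) - - \<kappa> * x ^ (n - 1) * F (sol b x)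
      = - (\<kappa> * (x ^ (n - 1) * (F (sol a x) - F (sol b x))))" by (simp add: algebra_simps)
    ultimately show "\<bar>- \<kappa> * x ^ (n - 1) * F (sol a x) - - \<kappa> * x ^ (n - 1) * F (sol b x)\<bar> \<le> R"
      using x kappa_pos by (simp add: abs_mult)
    show "((\<lambda>s. flux a s - flux b s) has_real_derivative
        - \<kappa> * x ^ (n - 1) * F (sol a x) - - \<kappa> * x ^ (n - 1) * F (sol b x)) (at x)"
      using x assms by (intro DERIV_diff flux_deriv) auto
  qed (use assms in \<open>auto intro!: derivative_eq_intros continuous_intros continuous_on_subset[OF flux_continuous]\<close>)
  also have "\<dots> \<le> R" using R0 assms mult_left_le[of s R] by auto
  finally show ?thesis by (simp add: flux_0 R_def)
qed

text \<open>Away from 1 closeness comes from \<open>flux_dep\<close>; on [T, 1] the Lipschitz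
  constant \<kappa> C is the same for all initial values. The points \<open>s m\<close> may tend to
  1, which is where sign changes can get lost.\<close>

lemma flux_dep_uniform:
  assumes "b \<longlonglongrightarrow> a" "s \<longlonglongrightarrow> \<sigma>" and s: "\<And>m. 0 \<le> s m" "\<And>m. s m \<le> (1::real)"
  shows "(\<lambda>m. flux (b m) (s m)) \<longlonglongrightarrow> flux a \<sigma>"
proof -
  have \<sigma>: "0 \<le> \<sigma>" "\<sigma> \<le> 1"
    using LIMSEQ_le_const[OF assms(2), of 0] LIMSEQ_le_const2[OF assms(2), of 1] s by blast+
  have "(\<lambda>m. flux a (s m)) \<longlonglongrightarrow> flux a \<sigma>"
    using assms \<sigma> by (intro continuous_on_tendsto_compose[OF flux_continuous]) auto
  moreover have "(\<lambda>m. flux (b m) (s m) - flux a (s m)) \<longlonglongrightarrow> 0"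
  proof (rule LIMSEQ_I)
    fix e :: real assume e: "e > 0"
    have k: "\<kappa> * C \<ge> 0" using kappa_pos C_nonneg by simp
    \<comment> \<open>Moving from \<open>s m\<close> to T = 1 - \<delta> costs at most e / 4 for
      each of the two fluxes, comparing them at \<open>T\<close> less than e / 2.\<close>
    then obtain \<delta> where \<delta>: "0 < \<delta>" "\<delta> \<le> 1/2" "\<kappa> * C * \<delta> \<le> e / 4"
      by (rule small_step_exists[where e = "e / 4"]) (use e in auto)
    define T where "T = 1 - \<delta>"
    have T: "0 < T" "T < 1" "2 * (\<kappa> * C * (1 - T)) \<le> e / 2" using \<delta> by (auto simp: T_def)
    have "(\<lambda>m. \<kappa> * (L * (2 * \<bar>b m - a\<bar> * (1 - T) powr (-\<beta>)))) \<longlonglongrightarrow> \<kappa> * (L * (2 * \<bar>a - a\<bar> * (1 - T) powr (-\<beta>)))"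
      by (intro tendsto_intros assms)
    then have "\<forall>\<^sub>F m in sequentially. \<kappa> * (L * (2 * \<bar>b m - a\<bar> * (1 - T) powr (-\<beta>))) < e / 2"
      using e by (intro order_tendstoD) auto
    then obtain N where N: "\<And>m. m \<ge> N \<Longrightarrow> \<kappa> * (L * (2 * \<bar>b m - a\<bar> * (1 - T) powr (-\<beta>))) < e / 2"
      by (auto simp: eventually_sequentially)
    have "norm (flux (b m) (s m) - flux a (s m) - 0) < e" if "m \<ge> N" for m
    proof (cases "s m \<le> T")
      case True
      then show ?thesis using N[OF that] flux_dep[of "s m" T "b m" a] s(1)[of m] T e by simp
    next
      case False
      have "\<bar>flux (b m) (s m) - flux (b m) T\<bar> \<le> \<kappa> * C * (1 - T)" "\<bar>flux a (s m) - flux a T\<bar> \<le> \<kappa> * C * (1 - T)"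
      proof -
        have "\<bar>flux c (s m) - flux c T\<bar> \<le> \<kappa> * C * (1 - T)" for c
        proof -
          have "\<bar>flux c (s m) - flux c T\<bar> \<le> \<kappa> * C * \<bar>s m - T\<bar>"
            using s[of m] T by (intro flux_lipschitzD) auto
          also have "\<dots> \<le> \<kappa> * C * (1 - T)" using False s[of m] k by (intro mult_left_mono) auto
          finally show ?thesis .
        qed
        then show "\<bar>flux (b m) (s m) - flux (b m) T\<bar> \<le> \<kappa> * C * (1 - T)" "\<bar>flux a (s m) - flux a T\<bar> \<le> \<kappa> * C * (1 - T)"
          by auto
      qed
      moreover have "\<bar>flux (b m) T - flux a T\<bar> < e / 2"
        using N[OF that] flux_dep[of T T "b m" a] T by simp
      ultimately show ?thesis using T unfolding real_norm_def by linarith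
    qed
    then show "\<exists>N. \<forall>m\<ge>N. norm (flux (b m) (s m) - flux a (s m) - 0) < e" by blast
  qed
  ultimately have "(\<lambda>m. flux a (s m) + (flux (b m) (s m) - flux a (s m))) \<longlonglongrightarrow> flux a \<sigma> + 0"
    by (rule tendsto_add)
  then show ?thesis by simp
qed

lemma sol_dep_tendsto:
  assumes "b \<longlonglongrightarrow> a" "s \<longlonglongrightarrow> \<sigma>" "0 < \<sigma>" "\<sigma> < 1"
  shows "(\<lambda>m. sol (b m) (s m)) \<longlonglongrightarrow> sol a \<sigma>"
proof -
  have 1: "(\<lambda>m. sol a (s m)) \<longlonglongrightarrow> sol a \<sigma>"
    using assms by (intro isCont_tendsto_compose[OF sol_isCont])
  have "(\<lambda>m. sol (b m) (s m) - sol a (s m)) \<longlonglongrightarrow> 0"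
  proof (rule Lim_null_comparison)
    have "\<forall>\<^sub>F m in sequentially. s m > 0" "\<forall>\<^sub>F m in sequentially. s m < 1"
      using order_tendstoD[OF assms(2)] assms by auto
    then show "\<forall>\<^sub>F m in sequentially. norm (sol (b m) (s m) - sol a (s m)) \<le> 2 * \<bar>b m - a\<bar> * (1 - s m) powr (-\<beta>)"
      by eventually_elim (use sol_dep in auto)
    have "(\<lambda>m. 2 * \<bar>b m - a\<bar> * (1 - s m) powr (-\<beta>)) \<longlonglongrightarrow> 2 * \<bar>a - a\<bar> * (1 - \<sigma>) powr (-\<beta>)"
      using assms by (intro tendsto_intros) auto
    then show "(\<lambda>m. 2 * \<bar>b m - a\<bar> * (1 - s m) powr (-\<beta>)) \<longlonglongrightarrow> 0" by simp
  qed
  from tendsto_add[OF 1 this] show ?thesis by simp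
qed

lemma flux_at_tendsto:
  assumes "0 \<le> t" "t \<le> 1"
  shows "((\<lambda>b. flux b t) \<longlongrightarrow> flux a t) (nhds a)"
proof -
  have "isCont (\<lambda>b. flux b t) a"
    using flux_dep_uniform[of _ a "\<lambda>_. t" t] assms
    by (auto simp: continuous_at_sequentially o_def)
  then show ?thesis by (simp add: isCont_def tendsto_nhds_iff)
qed

end

section \<open>Sign changes of the flux\<close>

text \<open>\<open>alternates f j t\<close>: there are points \<open>s\<^sub>0 < \<dots> < s\<^sub>j = t\<close> in the unit interval at which
  \<open>f\<close> is alternately positive and negative, starting with a positive value.\<close>

fun alternates :: "(real \<Rightarrow> real) \<Rightarrow> nat \<Rightarrow> real \<Rightarrow> bool" where
  "alternates f 0 t \<longleftrightarrow> 0 < t \<and> t < 1 \<and> 0 < f t"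
| "alternates f (Suc j) t \<longleftrightarrow> 0 < t \<and> t < 1 \<and> 0 < (-1) ^ Suc j * f t \<and> (\<exists>s<t. alternates f j s)"

lemma alternatesD:
  assumes "alternates f j t"
  shows "0 < t" "t < 1" "0 < (-1) ^ j * f t"
  using assms by (cases j; simp)+

lemma alternates_mono:
  assumes "alternates f j t" "i \<le> j"
  shows "\<exists>t. alternates f i t"
  using assms(2,1)
proof (induction arbitrary: t rule: dec_induct)
  case (step m) then show ?case by (metis alternates.simps(2))
qed auto

section \<open>Sign changes under limits of the initial value\<close>

locale shooting = lipschitz_reaction +
  assumes F_neg: "\<And>x. 0 < x \<Longrightarrow> x < 1 \<Longrightarrow> F x < 0"
    and F_pos: "\<And>x. 1 < x \<Longrightarrow> 0 < F x"
    and F_le_0: "\<And>x. x \<le> 0 \<Longrightarrow> F x = 0"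
    and F_1: "F 1 = 0"
begin

text \<open>Simplicity of the zeros of p: there p' = -\<kappa> s^(n-1) F(W) is nonzero, since
  otherwise \<open>W\<close> would start at an equilibrium, whereas F < 0 on (0, 1).\<close>

lemma flux_zero_not_equilibrium:
  assumes "0 < a" "a < 1" "0 < s" "s < 1" "flux a s = 0"
  shows "F (sol a s) \<noteq> 0"
  using equilibrium_unique_interior[of "sol a s" s a] F_neg[of a] assms by auto

text \<open>Finitely many strict inequalities at fixed points: the same points serve for all nearby
  initial values.\<close>

lemma alternates_open:
  assumes "alternates (flux a) j t"
  shows "\<forall>\<^sub>F b in nhds a. alternates (flux b) j t"
  using assms
proof (induction j arbitrary: t)
  case 0
  then have "\<forall>\<^sub>F b in nhds a. 0 < flux b t"
    using order_tendstoD(1)[OF flux_at_tendsto[of t a], of 0] by simp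
  then show ?case by eventually_elim (use 0 in auto)
next
  case (Suc j)
  then obtain s where s: "s < t" "alternates (flux a) j s" by auto
  have "((\<lambda>b. (-1) ^ Suc j * flux b t) \<longlongrightarrow> (-1) ^ Suc j * flux a t) (nhds a)"
    using Suc.prems by (intro tendsto_intros flux_at_tendsto) auto
  then have "\<forall>\<^sub>F b in nhds a. 0 < (-1) ^ Suc j * flux b t"
    by (rule order_tendstoD(1)) (use Suc.prems in \<open>simp only: alternates.simps\<close>)
  then show ?case using Suc.IH[OF s(2)]
    by eventually_elim (use Suc.prems s in auto)
qed

text \<open>Near s = 0 the solution stays in (0, 1), where F < 0, so p increases from p(0) = 0. The
  interval is uniform in b, so that no sign change can escape through s = 0 in a limit.\<close>

lemma flux_pos_initially:
  assumes "0 < a" "a < 1"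
  shows "\<exists>\<delta>>0. \<delta> < 1 \<and> (\<forall>\<^sub>F b in nhds a. \<forall>s. 0 < s \<and> s \<le> \<delta> \<longrightarrow> 0 < flux b s)"
proof -
  \<comment> \<open>\<open>e\<close> is spent twice, on the oscillation of \<open>sol a\<close> near
    0 and on the distance of \<open>sol b\<close> from \<open>sol a\<close>; the sum keeps
    \<open>sol b\<close> inside (0, 1).\<close>
  define e where "e = min a (1 - a) / 2"
  have e: "0 < e" "2 * e \<le> a" "2 * e \<le> 1 - a" using assms by (auto simp: e_def)
  obtain d where d: "d > 0" "\<And>x. x \<in> {0..<1} \<Longrightarrow> dist x 0 < d \<Longrightarrow> dist (sol a x) (sol a 0) < e"
    using sol_continuous[of a] e(1) unfolding continuous_on_iff by (metis atLeastLessThan_iff order_refl zero_less_one)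
  define \<delta> where "\<delta> = min (1/2) (d/2)"
  have \<delta>: "0 < \<delta>" "\<delta> < 1" "\<delta> < d" using d by (auto simp: \<delta>_def)
  have "((\<lambda>b. 2 * \<bar>b - a\<bar> * (1 - \<delta>) powr (-\<beta>)) \<longlongrightarrow> 2 * \<bar>a - a\<bar> * (1 - \<delta>) powr (-\<beta>)) (nhds a)"
    by (intro tendsto_intros filterlim_ident)
  then have "\<forall>\<^sub>F b in nhds a. 2 * \<bar>b - a\<bar> * (1 - \<delta>) powr (-\<beta>) < e"
    using e by (intro order_tendstoD) auto
  then have "\<forall>\<^sub>F b in nhds a. \<forall>s. 0 < s \<and> s \<le> \<delta> \<longrightarrow> 0 < flux b s"
  proof eventually_elim
    case (elim b)
    have rng: "0 < sol b r \<and> sol b r < 1" if r: "0 \<le> r" "r \<le> \<delta>" for r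
    proof -
      have "\<bar>sol b r - sol a r\<bar> \<le> 2 * \<bar>b - a\<bar> * (1 - r) powr (-\<beta>)"
        using r \<delta> by (intro sol_dep) auto
      also have "\<dots> \<le> 2 * \<bar>b - a\<bar> * (1 - \<delta>) powr (-\<beta>)"
        using r \<delta> beta_pos by (intro mult_left_mono powr_mono2') auto
      also have "\<dots> < e" by (rule elim)
      finally have 1: "\<bar>sol b r - sol a r\<bar> < e" .
      have "\<bar>sol a r - a\<bar> < e" using d(2)[of r] r \<delta> by (auto simp: dist_real_def sol_0)
      then show ?thesis using 1 e by linarith
    qed
    show ?case
    proof (intro allI impI)
      fix s assume s: "0 < s \<and> s \<le> \<delta>"
      have "flux b 0 < flux b s"
      proof (rule DERIV_pos_imp_increasing_open[where f = "flux b"])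
        fix x assume x: "0 < x" "x < s"
        then have "F (sol b x) < 0" using rng[of x] s by (intro F_neg) auto
        then have "0 < - \<kappa> * x ^ (n - 1) * F (sol b x)"
          using x kappa_pos by (simp add: mult_pos_neg)
        then show "\<exists>y. (flux b has_real_derivative y) (at x) \<and> 0 < y"
          using flux_deriv[of x b] x s \<delta> by force
      qed (use s \<delta> in \<open>auto intro: continuous_on_subset[OF flux_continuous]\<close>)
      then show "0 < flux b s" by (simp add: flux_0)
    qed
  qed
  then show ?thesis using \<delta> by blast
qed

lemma bounded_subsequence:
  fixes s :: "nat \<Rightarrow> real"
  assumes "\<And>m. 0 < s m \<and> s m < 1"
  obtains r \<sigma> where "strict_mono r" "(s \<circ> r) \<longlonglongrightarrow> \<sigma>" "0 \<le> \<sigma>" "\<sigma> \<le> 1"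
proof -
  have "seq_compact {0..1::real}" by (simp add: compact_imp_seq_compact)
  moreover have "\<forall>m. s m \<in> {0..1}" using assms by (simp add: less_imp_le)
  ultimately show ?thesis using that by (elim seq_compactE) auto
qed

text \<open>Limits of sign points carry only weak signs, and consecutive ones may merge at a zero of
  the limit flux; simplicity of the zeros restores strict signs nearby. The slack
  \<open>\<eta>\<close> allows the last point to move to the right of \<open>\<sigma>\<close>, and
  the bound on t lets the induction place the earlier points. The alternative on
  \<open>\<sigma>\<close> excludes a loss through s = 1.\<close>

lemma alternates_limit:
  assumes a: "0 < a" "a < 1"
    and "b \<longlonglongrightarrow> a" "\<And>m. alternates (flux (b m)) j (s m)" "s \<longlonglongrightarrow> \<sigma>"
    and "\<sigma> < 1 \<or> flux a 1 \<noteq> 0" "\<eta> > 0"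
  shows "\<exists>t<\<sigma> + \<eta>. alternates (flux a) j t"
  using assms(3-)
proof (induction j arbitrary: b s \<sigma> \<eta>)
  case 0
  obtain \<delta> where d: "0 < \<delta>" "\<delta> < 1" "\<forall>\<^sub>F b in nhds a. \<forall>s. 0 < s \<and> s \<le> \<delta> \<longrightarrow> 0 < flux b s"
    using flux_pos_initially[OF a] by blast
  have \<sigma>: "0 \<le> \<sigma>" using LIMSEQ_le_const[OF 0(3), of 0] 0(2) by (auto simp: less_imp_le)
  have "alternates (flux a) 0 (min \<delta> (\<eta>/2))"
    using d eventually_nhds_x_imp_x[OF d(3)] \<open>\<eta> > 0\<close> by auto
  moreover have "min \<delta> (\<eta>/2) < \<sigma> + \<eta>" using \<sigma> \<open>\<eta> > 0\<close> by auto
  ultimately show ?case by blast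
next
  case (Suc j)
  have "\<forall>m. \<exists>s'<s m. alternates (flux (b m)) j s'" using Suc.prems(2) by simp
  then obtain s' where s': "\<And>m. s' m < s m" "\<And>m. alternates (flux (b m)) j (s' m)" by metis
  obtain r \<sigma>' where r: "strict_mono r" "(s' \<circ> r) \<longlonglongrightarrow> \<sigma>'" "0 \<le> \<sigma>'" "\<sigma>' \<le> 1"
    using bounded_subsequence[of s'] s'(2) alternatesD by metis
  have br: "(b \<circ> r) \<longlonglongrightarrow> a" and sr: "(s \<circ> r) \<longlonglongrightarrow> \<sigma>"
    using LIMSEQ_subseq_LIMSEQ Suc.prems r by auto
  have s01: "0 < s m" "s m < 1" "0 < s' m" "s' m < 1" for m
    using Suc.prems(2) s'(2) alternatesD by blast+
  define x :: real where "x = (-1) ^ Suc j"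
  have xs: "0 < x * flux (b m) (s m)" for m
    using alternatesD(3)[OF Suc.prems(2)[of m]] by (simp add: x_def)
  have xs': "x * flux (b m) (s' m) < 0" for m
    using alternatesD(3)[OF s'(2)[of m]] by (simp add: x_def)
  have x2: "x * x = 1" "x \<noteq> 0" by (auto simp: x_def simp flip: power_add)
  have le: "\<sigma>' \<le> \<sigma>"
    using r(2) sr s'(1) by (intro LIMSEQ_le[of "s' \<circ> r" _ "s \<circ> r"]) (auto simp: less_imp_le)
  have \<sigma>1: "\<sigma> \<le> 1" using LIMSEQ_le_const2[OF sr, of 1] s01 by (auto simp: less_imp_le)
  have f1: "(\<lambda>m. x * flux ((b \<circ> r) m) ((s \<circ> r) m)) \<longlonglongrightarrow> x * flux a \<sigma>"
    using s01 by (intro tendsto_intros flux_dep_uniform br sr) (auto simp: less_imp_le)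
  have f2: "(\<lambda>m. x * flux ((b \<circ> r) m) ((s' \<circ> r) m)) \<longlonglongrightarrow> x * flux a \<sigma>'"
    using s01 by (intro tendsto_intros flux_dep_uniform br r) (auto simp: less_imp_le)
  have g1: "0 \<le> x * flux a \<sigma>" using LIMSEQ_le_const[OF f1, of 0] xs by (auto simp: less_imp_le)
  have g2: "x * flux a \<sigma>' \<le> 0" using LIMSEQ_le_const2[OF f2, of 0] xs' by (auto simp: less_imp_le)
  have IH: "\<exists>t<\<sigma>' + \<eta>'. alternates (flux a) j t" if "\<eta>' > 0" for \<eta>'
    using Suc.prems(4) le that by (intro Suc.IH[OF br _ r(2)]) (auto simp: s'(2))
  \<comment> \<open>A point of the right sign strictly after \<sigma>' suffices: the induction
    hypothesis with slack t - \<sigma>' puts the earlier points before it.\<close>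
  have fin: ?case if t: "\<sigma>' < t" "t < \<sigma> + \<eta>" "t < 1" "0 < x * flux a t" for t
  proof -
    obtain u where "u < t" "alternates (flux a) j u" using IH[of "t - \<sigma>'"] t by auto
    then have "alternates (flux a) (Suc j) t"
      using t r(3) by (auto simp: x_def)
    then show ?thesis using t by blast
  qed
  show ?case
  proof (cases "flux a \<sigma> = 0")
    case False
    then have pos: "0 < x * flux a \<sigma>" using g1 x2 by (auto simp: less_le)
    then have lt: "\<sigma>' < \<sigma>" using g2 le by (cases "\<sigma>' = \<sigma>") auto
    have "continuous_on {0..1} (\<lambda>s. x * flux a s)" by (intro continuous_intros flux_continuous)
    then obtain d where d: "d > 0" "\<And>t. t \<in> {0..1} \<Longrightarrow> dist t \<sigma> < d \<Longrightarrow> dist (x * flux a t) (x * flux a \<sigma>) < x * flux a \<sigma>"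
      using pos r(3) le \<sigma>1 unfolding continuous_on_iff by (metis atLeastAtMost_iff order_trans)
    define t where "t = max ((\<sigma> + \<sigma>')/2) (\<sigma> - d/2)"
    have "\<sigma>' < t" "t < \<sigma>" "dist t \<sigma> < d" using lt d(1) by (auto simp: t_def dist_real_def less_max_iff_disj abs_if)
    moreover have "0 < x * flux a t"
      using d(2)[of t] calculation r(3) \<sigma>1 by (auto simp: dist_real_def)
    ultimately show ?thesis using \<sigma>1 Suc.prems(5) by (intro fin[of t]) auto
  next
    case True
    then have s1: "\<sigma> < 1" using Suc.prems(4) \<sigma>1 by (cases "\<sigma> = 1") auto
    \<comment> \<open>If both limits were 0, the sign points would enter the zone where all nearby
      fluxes are positive, although their signs are opposite.\<close>
    have s0: "0 < \<sigma>"
    proof (rule ccontr)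
      assume "\<not> 0 < \<sigma>"
      then have z: "\<sigma> = 0" "\<sigma>' = 0" using le r(3) by auto
      obtain \<delta> where d: "0 < \<delta>" "\<delta> < 1" "\<forall>\<^sub>F b in nhds a. \<forall>s. 0 < s \<and> s \<le> \<delta> \<longrightarrow> 0 < flux b s"
        using flux_pos_initially[OF a] by blast
      have "\<forall>\<^sub>F m in sequentially. (s \<circ> r) m < \<delta>" using order_tendstoD(2)[OF sr] d z by auto
      moreover have "\<forall>\<^sub>F m in sequentially. \<forall>s. 0 < s \<and> s \<le> \<delta> \<longrightarrow> 0 < flux ((b \<circ> r) m) s"
        by (rule eventually_compose_filterlim[OF d(3) br])
      ultimately have "\<forall>\<^sub>F m in sequentially. False"
      proof eventually_elim
        case (elim m)
        then have "0 < flux (b (r m)) (s (r m))" "0 < flux (b (r m)) (s' (r m))"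
          using s01[of "r m"] s'(1)[of "r m"] by auto
        then show False using xs[of "r m"] xs'[of "r m"]
          by (auto simp: zero_less_mult_iff mult_less_0_iff)
      qed
      then show False by simp
    qed
    define D where "D = - \<kappa> * \<sigma> ^ (n - 1) * F (sol a \<sigma>)"
    have der: "((\<lambda>s. x * flux a s) has_real_derivative x * D) (at \<sigma>)"
      unfolding D_def using s0 s1 by (intro DERIV_cmult flux_deriv)
    have F0: "F (sol a \<sigma>) \<noteq> 0" using flux_zero_not_equilibrium[OF a s0 s1 True] .
    then have D0: "x * D \<noteq> 0" using s0 kappa_pos x2 by (simp add: D_def)
    show ?thesis
    proof (cases "\<sigma>' = \<sigma>")
      case False
      then have lt: "\<sigma>' < \<sigma>" using le by simp
      show ?thesis
      \<comment> \<open>\<open>\<sigma>\<close> is a simple zero with \<sigma>' strictly to its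
        left, so the side of \<open>\<sigma>\<close> that carries the right sign can be
        used.\<close>
      proof (cases "0 < x * D")
        case True
        obtain d where d: "d > 0" "\<And>h. 0 < h \<Longrightarrow> h < d \<Longrightarrow> x * flux a \<sigma> < x * flux a (\<sigma> + h)"
          using DERIV_pos_inc_right[OF der True] by blast
        define h where "h = min (d/2) (min (\<eta>/2) ((1 - \<sigma>)/2))"
        have "0 < h" "h < d" "h < \<eta>" "\<sigma> + h < 1" using d(1) Suc.prems(5) s1 by (auto simp: h_def min_def field_simps)
        then show ?thesis using d(2)[of h] \<open>flux a \<sigma> = 0\<close> lt by (intro fin[of "\<sigma> + h"]) auto
      next
        case False
        then have "x * D < 0" using D0 by linarith
        then obtain d where d: "d > 0" "\<And>h. 0 < h \<Longrightarrow> h < d \<Longrightarrow> x * flux a \<sigma> < x * flux a (\<sigma> - h)"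
          using DERIV_neg_dec_left[OF der] by blast
        define h where "h = min (d/2) ((\<sigma> - \<sigma>')/2)"
        have "0 < h" "h < d" "\<sigma>' < \<sigma> - h" using d(1) lt by (auto simp: h_def min_def field_simps)
        then show ?thesis using d(2)[of h] \<open>flux a \<sigma> = 0\<close> s1 Suc.prems(5) by (intro fin[of "\<sigma> - h"]) auto
      qed
    next
      case True
      \<comment> \<open>Merging points: between \<open>s' m\<close> and \<open>s m\<close> the
        signed flux rises from negative to positive, so its derivative is positive somewhere in
        between. In the limit this fixes the sign of the nonzero derivative at
        \<open>\<sigma>\<close>.\<close>
      have "\<exists>\<xi>. s' m < \<xi> \<and> \<xi> < s m \<and> 0 < x * - F (sol (b m) \<xi>)" for m
      proof -
        have "\<exists>l z. s' m < z \<and> z < s m \<and> (flux (b m) has_real_derivative l) (at z) \<and> flux (b m) (s m) - flux (b m) (s' m) = (s m - s' m) * l"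
        proof (rule MVT[OF s'(1)])
          show "continuous_on {s' m..s m} (flux (b m))"
            using s01[of m] by (intro continuous_on_subset[OF flux_continuous]) auto
          show "\<And>x. s' m < x \<Longrightarrow> x < s m \<Longrightarrow> flux (b m) differentiable at x"
            using flux_deriv[of _ "b m"] s01[of m] unfolding real_differentiable_def by (meson order.strict_trans)
        qed
        then obtain l z where z: "s' m < z" "z < s m" "(flux (b m) has_real_derivative l) (at z)"
            "flux (b m) (s m) - flux (b m) (s' m) = (s m - s' m) * l" by blast
        have l: "l = - \<kappa> * z ^ (n - 1) * F (sol (b m) z)"
          using z s01[of m] by (intro DERIV_unique[OF z(3)] flux_deriv) auto
        have "0 < x * (flux (b m) (s m) - flux (b m) (s' m))"
          using xs[of m] xs'[of m] by (simp add: right_diff_distrib)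
        also have "\<dots> = ((s m - s' m) * (\<kappa> * z ^ (n - 1))) * (x * - F (sol (b m) z))"
          using z(4) l by simp
        finally have "0 < ((s m - s' m) * (\<kappa> * z ^ (n - 1))) * (x * - F (sol (b m) z))" .
        moreover have "0 < (s m - s' m) * (\<kappa> * z ^ (n - 1))"
          using s'(1)[of m] z(1,2) s01[of m] kappa_pos by (intro mult_pos_pos zero_less_power) auto
        ultimately have "0 < x * - F (sol (b m) z)" by (rule zero_less_mult_pos)
        then show ?thesis using z by blast
      qed
      then obtain \<xi> where \<xi>: "\<And>m. s' m < \<xi> m" "\<And>m. \<xi> m < s m" "\<And>m. 0 < x * - F (sol (b m) (\<xi> m))"
        by metis
      have "(\<xi> \<circ> r) \<longlonglongrightarrow> \<sigma>"
        using r(2) sr True \<xi>(1,2)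
        by (intro tendsto_sandwich[of "s' \<circ> r" "\<xi> \<circ> r" sequentially "s \<circ> r"]) (auto simp: less_imp_le)
      from sol_dep_tendsto[OF br this s0 s1]
      have "(\<lambda>m. x * - F (sol ((b \<circ> r) m) ((\<xi> \<circ> r) m))) \<longlonglongrightarrow> x * - F (sol a \<sigma>)"
        by (intro tendsto_intros continuous_on_tendsto_compose[OF F_continuous[of UNIV]]) auto
      then have "0 \<le> x * - F (sol a \<sigma>)"
        using LIMSEQ_le_const[of _ "x * - F (sol a \<sigma>)" 0] \<xi>(3) by (auto simp: less_imp_le)
      then have "0 < x * - F (sol a \<sigma>)" using F0 x2 by (auto simp: less_le)
      then have "0 < x * D" using s0 kappa_pos
        mult_pos_pos[of "\<kappa> * \<sigma> ^ (n - 1)" "x * - F (sol a \<sigma>)"] by (simp add: D_def mult_ac)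
      then obtain d where d: "d > 0" "\<And>h. 0 < h \<Longrightarrow> h < d \<Longrightarrow> x * flux a \<sigma> < x * flux a (\<sigma> + h)"
        using DERIV_pos_inc_right[OF der] by blast
      define h where "h = min d (min \<eta> (1 - \<sigma>))"
      have h: "0 < h" "h \<le> d" "h \<le> \<eta>" "\<sigma> + h \<le> 1" using d(1) Suc.prems(5) s1 by (auto simp: h_def)
      \<comment> \<open>The induction hypothesis might place \<open>u\<close> to the right of
        \<open>\<sigma>\<close>, but there the signed flux is positive, which forces u \<le>
        \<sigma>.\<close>
      obtain u where u: "u < \<sigma> + h" "alternates (flux a) j u" using IH[OF h(1)] True by auto
      have "x * flux a u < 0" using alternatesD(3)[OF u(2)] by (simp add: x_def)
      then have "u \<le> \<sigma>" using d(2)[of "u - \<sigma>"] u h \<open>flux a \<sigma> = 0\<close> by (cases "u \<le> \<sigma>") auto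
      then have "alternates (flux a) (Suc j) (\<sigma> + h / 2)"
        using u d(2)[of "h/2"] h s0 \<open>flux a \<sigma> = 0\<close> by (auto simp: x_def intro!: exI[of _ u])
      then show ?thesis using h by (intro exI[of _ "\<sigma> + h / 2"]) auto
    qed
  qed
qed

text \<open>If p(1) = 0, the limit l of \<open>W\<close> has F(l) \<noteq> 0 by
  \<open>equilibrium_unique_end\<close>, so 1 is a simple zero too. For b near a, a zero z of
  \<open>flux b\<close> keeps \<open>sol b\<close> Lipschitz up to z, hence close to l on
  [1 - \<delta>, z], and \<open>flux b\<close> is strictly monotone there. So it has at most one
  zero in [1 - \<delta>, 1), and before it the sign of y.\<close>

lemma flux_sign_at_end:
  assumes a: "0 < a" "a < 1" and "flux a 1 = 0"
  shows "\<exists>y \<delta>. 0 < \<delta> \<and> \<delta> \<le> 1/2 \<and> (\<forall>s. 1 - \<delta> \<le> s \<and> s < 1 \<longrightarrow> 0 < y * flux a s) \<and>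
    (\<forall>\<^sub>F b in nhds a. \<forall>s z. 1 - \<delta> \<le> s \<and> s < z \<and> z < 1 \<and> flux b z = 0 \<longrightarrow> 0 < y * flux b s)"
proof -
  obtain l where l: "(sol a \<longlongrightarrow> l) (at_left 1)" "\<And>s. 1/2 \<le> s \<and> s < 1 \<Longrightarrow> \<bar>sol a s - l\<bar> \<le> K * (1 - s)"
    using sol_limit_at_1[OF assms(3)] by blast
  \<comment> \<open>Only the sign matters: p' has the sign of -F(W), so y p decreases to 0 and is
    positive before the zero.\<close>
  define y where "y = F l"
  have y0: "y \<noteq> 0" using equilibrium_unique_end[OF assms(3) l(1)] F_neg[OF a] by (auto simp: y_def)
  have "isCont (\<lambda>x. y * F x) l"
    using F_continuous[of UNIV] by (intro continuous_intros) (auto simp: continuous_on_eq_continuous_at)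
  moreover have "0 < y * F l" using y0 by (auto simp: y_def zero_less_mult_iff)
  ultimately have "\<forall>\<^sub>F x in at l. 0 < y * F x" by (auto simp: isCont_def intro: order_tendstoD)
  then obtain \<eta> where \<eta>: "\<eta> > 0" "\<And>x. \<bar>x - l\<bar> < \<eta> \<Longrightarrow> 0 < y * F x"
    using \<open>0 < y * F l\<close> unfolding eventually_at dist_real_def by (metis UNIV_I)
  obtain \<delta> where \<delta>: "0 < \<delta>" "\<delta> \<le> 1/2" "K * \<delta> \<le> \<eta> / 4"
    by (rule small_step_exists[OF K_nonneg, of "\<eta> / 4"]) (use \<eta>(1) in auto)
  have mono: "0 < y * flux b s" if s: "1 - \<delta> \<le> s" "s < z" "z \<le> 1" and z: "flux b z = 0"
      and close: "\<bar>sol b (1 - \<delta>) - l\<bar> < \<eta> / 2" for b s z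
  proof -
    have "y * flux b z < y * flux b s"
    proof (rule DERIV_neg_imp_decreasing_open[where f = "\<lambda>s. y * flux b s"])
      show "continuous_on {s..z} (\<lambda>s. y * flux b s)"
        using s \<delta> by (intro continuous_intros continuous_on_subset[OF flux_continuous]) auto
      fix x assume x: "s < x" "x < z"
      have "\<bar>sol b x - sol b (1 - \<delta>)\<bar> \<le> K * (x - (1 - \<delta>))"
        using x s \<delta> by (intro sol_lipschitz_before_zero[OF z]) auto
      also have "\<dots> \<le> K * \<delta>" using x s K_nonneg by (intro mult_left_mono) auto
      finally have "\<bar>sol b x - l\<bar> < \<eta>" using \<delta>(3) close \<eta>(1) by linarith
      then have "0 < y * F (sol b x)" by (rule \<eta>)
      moreover have "0 < \<kappa> * x ^ (n - 1)" using kappa_pos x s \<delta> by auto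
      ultimately have "0 < (\<kappa> * x ^ (n - 1)) * (y * F (sol b x))" by (rule mult_pos_pos[rotated])
      then have "y * (- \<kappa> * x ^ (n - 1) * F (sol b x)) < 0" by (simp add: mult_ac)
      moreover have "((\<lambda>s. y * flux b s) has_real_derivative y * (- \<kappa> * x ^ (n - 1) * F (sol b x))) (at x)"
        using x s \<delta> by (intro DERIV_cmult flux_deriv) auto
      ultimately show "\<exists>d. ((\<lambda>s. y * flux b s) has_real_derivative d) (at x) \<and> d < 0" by blast
    qed (use s in auto)
    then show ?thesis using z by simp
  qed
  have ca: "\<bar>sol a (1 - \<delta>) - l\<bar> < \<eta> / 2"
    using l(2)[of "1 - \<delta>"] \<delta> \<eta> by auto
  have "(\<lambda>b. sol b (1 - \<delta>)) \<midarrow>a\<rightarrow> sol a (1 - \<delta>)"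
    using sol_dep_tendsto[of _ a "\<lambda>_. 1 - \<delta>" "1 - \<delta>"] \<delta> by (auto simp: LIMSEQ_SEQ_conv[symmetric])
  then have "((\<lambda>b. \<bar>sol b (1 - \<delta>) - l\<bar>) \<longlongrightarrow> \<bar>sol a (1 - \<delta>) - l\<bar>) (nhds a)"
    unfolding tendsto_nhds_iff by (intro conjI tendsto_intros refl)
  then have "\<forall>\<^sub>F b in nhds a. \<bar>sol b (1 - \<delta>) - l\<bar> < \<eta> / 2" using ca by (intro order_tendstoD) auto
  then have "\<forall>\<^sub>F b in nhds a. \<forall>s z. 1 - \<delta> \<le> s \<and> s < z \<and> z < 1 \<and> flux b z = 0 \<longrightarrow> 0 < y * flux b s"
    by eventually_elim (auto intro: mono)
  moreover have "\<forall>s. 1 - \<delta> \<le> s \<and> s < 1 \<longrightarrow> 0 < y * flux a s"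
    using mono[OF _ _ _ assms(3) ca] by auto
  ultimately show ?thesis using \<delta> by blast
qed

text \<open>At most one sign change is lost at s = 1. Let u < v < w be the last three sign points of
  an approximating flux. If v stays away from 1, \<open>alternates_limit\<close> applies up to v. If
  v tends to 1, a zero between v and w makes that flux keep the sign of y from 1 - \<delta> up to
  the zero; so v carries the sign of y, u lies to the left of 1 - \<delta>, and the limit flux
  provides a substitute for v.\<close>

lemma alternates_limit_end:
  assumes a: "0 < a" "a < 1" and f1: "flux a 1 = 0" and ba: "b \<longlonglongrightarrow> a"
    and alt: "\<And>m. alternates (flux (b m)) (Suc (Suc i)) (s m)"
  shows "\<exists>t. alternates (flux a) (Suc i) t"
proof -
  have "\<forall>m. \<exists>s'<s m. alternates (flux (b m)) (Suc i) s'" using alt by (metis alternates.simps(2))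
  then obtain s' where s': "\<And>m. s' m < s m" "\<And>m. alternates (flux (b m)) (Suc i) (s' m)" by metis
  have "\<forall>m. \<exists>s''<s' m. alternates (flux (b m)) i s''" using s'(2) by (metis alternates.simps(2))
  then obtain s'' where s'': "\<And>m. s'' m < s' m" "\<And>m. alternates (flux (b m)) i (s'' m)" by metis
  obtain r \<sigma> where r: "strict_mono r" "(s' \<circ> r) \<longlonglongrightarrow> \<sigma>" "0 \<le> \<sigma>" "\<sigma> \<le> 1"
    using bounded_subsequence[of s'] s'(2) alternatesD by metis
  have br: "(b \<circ> r) \<longlonglongrightarrow> a" using LIMSEQ_subseq_LIMSEQ ba r by auto
  show ?thesis
  proof (cases "\<sigma> < 1")
    case True
    then show ?thesis using alternates_limit[OF a br _ r(2), of "Suc i" 1] s'(2) by auto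
  next
    case False
    then have "\<sigma> = 1" using r by simp
    obtain y \<delta> where y: "0 < \<delta>" "\<delta> \<le> 1/2" "\<And>s. 1 - \<delta> \<le> s \<and> s < 1 \<Longrightarrow> 0 < y * flux a s"
      "\<forall>\<^sub>F b in nhds a. \<forall>s z. 1 - \<delta> \<le> s \<and> s < z \<and> z < 1 \<and> flux b z = 0 \<longrightarrow> 0 < y * flux b s"
      using flux_sign_at_end[OF a f1] by blast
    have "\<forall>\<^sub>F m in sequentially. 1 - \<delta> < (s' \<circ> r) m" using order_tendstoD(1)[OF r(2)] y \<open>\<sigma> = 1\<close> by auto
    moreover have "\<forall>\<^sub>F m in sequentially. \<forall>s z. 1 - \<delta> \<le> s \<and> s < z \<and> z < 1 \<and> flux ((b \<circ> r) m) z = 0 \<longrightarrow> 0 < y * flux ((b \<circ> r) m) s"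
      by (rule eventually_compose_filterlim[OF y(4) br])
    ultimately have "\<forall>\<^sub>F m in sequentially. 0 < (-1) ^ Suc i * y \<and> (s'' \<circ> r) m \<le> 1 - \<delta>"
    proof eventually_elim
      case (elim m)
      define B where "B = b (r m)"
      define u v w where "u = s'' (r m)" and "v = s' (r m)" and "w = s (r m)"
      have o: "0 < u" "u < v" "v < w" "w < 1" "1 - \<delta> < v"
        using s'(1)[of "r m"] s''(1)[of "r m"] alternatesD(1)[OF s''(2)[of "r m"]] alternatesD(2)[OF alt[of "r m"]] elim(1)
        by (auto simp: u_def v_def w_def)
      have e: "0 < y * flux B q" if "1 - \<delta> \<le> q" "q < z" "z < 1" "flux B z = 0" for q z
        using elim(2) that by (auto simp: B_def)
      have su: "0 < (-1) ^ i * flux B u" using alternatesD(3)[OF s''(2)[of "r m"]] by (simp add: B_def u_def)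
      have sv: "0 < (-1) ^ Suc i * flux B v" using alternatesD(3)[OF s'(2)[of "r m"]] by (simp add: B_def v_def)
      have sw: "(-1) ^ Suc i * flux B w < 0" using alternatesD(3)[OF alt[of "r m"]] by (simp add: B_def w_def)
      have "\<exists>z. v \<le> z \<and> z \<le> w \<and> (-1) ^ Suc i * flux B z = 0"
        using sv sw o by (intro IVT2') (auto intro!: continuous_intros continuous_on_subset[OF flux_continuous])
      then obtain z where z: "v \<le> z" "z \<le> w" "flux B z = 0" by auto
      have "v \<noteq> z" using sv z by auto
      then have vz: "v < z" "z < 1" using z o by auto
      have yv: "0 < y * flux B v" using e[of v z] vz z o by auto
      have A: "0 < (-1) ^ Suc i * y" using yv sv
        by (cases "even i") (auto simp: zero_less_mult_iff mult_less_0_iff)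
      moreover have "u \<le> 1 - \<delta>"
      proof (rule ccontr)
        assume "\<not> u \<le> 1 - \<delta>"
        then have "0 < y * flux B u" using e[of u z] vz z o by auto
        then show False using su A
          by (cases "even i") (auto simp: zero_less_mult_iff mult_less_0_iff)
      qed
      ultimately show ?case by (simp add: u_def)
    qed
    then obtain N where N: "\<And>m. m \<ge> N \<Longrightarrow> 0 < (-1) ^ Suc i * y \<and> (s'' \<circ> r) m \<le> 1 - \<delta>"
      by (auto simp: eventually_sequentially)
    define p where "p m = s'' (r (m + N))" for m
    have p01: "0 < p m \<and> p m < 1" for m using alternatesD[OF s''(2)] by (simp add: p_def)
    obtain r2 \<sigma>2 where r2: "strict_mono r2" "(p \<circ> r2) \<longlonglongrightarrow> \<sigma>2" "0 \<le> \<sigma>2" "\<sigma>2 \<le> 1"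
      by (rule bounded_subsequence[OF p01])
    have "(p \<circ> r2) m \<le> 1 - \<delta>" for m using N[of "r2 m + N"] by (simp add: p_def)
    then have "\<sigma>2 \<le> 1 - \<delta>" using LIMSEQ_le_const2[OF r2(2)] by blast
    have "(\<lambda>m. (b \<circ> r) (m + N)) \<longlonglongrightarrow> a" using LIMSEQ_ignore_initial_segment[OF br] .
    then have b2: "((\<lambda>m. (b \<circ> r) (m + N)) \<circ> r2) \<longlonglongrightarrow> a" using LIMSEQ_subseq_LIMSEQ r2 by blast
    have "\<exists>t<\<sigma>2 + 1. alternates (flux a) i t"
      using \<open>\<sigma>2 \<le> 1 - \<delta>\<close> y(1) s''(2) by (intro alternates_limit[OF a b2 _ r2(2)]) (auto simp: p_def)
    then obtain t where t: "alternates (flux a) i t" by blast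
    \<comment> \<open>Substitute for v: any point after \<open>t\<close> in [1 - \<delta>, 1) works,
      since \<open>flux a\<close> has the sign of y there.\<close>
    define t' where "t' = (max t (1 - \<delta>) + 1) / 2"
    have t': "t < t'" "1 - \<delta> \<le> t'" "t' < 1" "0 < t'"
      using alternatesD(1,2)[OF t] y(1,2) by (auto simp: t'_def max_def)
    have A: "0 < (-1) ^ Suc i * y" using N by blast
    have "0 < y * flux a t'" using y(3)[of t'] t' by auto
    then have "0 < (-1) ^ Suc i * flux a t'" using A
      by (cases "even i") (auto simp: zero_less_mult_iff mult_less_0_iff)
    then have "alternates (flux a) (Suc i) t'" using t t' by auto
    then show ?thesis by blast
  qed
qed

section \<open>Constant solutions, small initial values, positivity\<close>

lemma sol_equilibrium:
  assumes "F e = 0" "0 \<le> s" "s < 1"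
  shows "sol e s = e"
proof -
  have "picard e (\<lambda>_. e) r = e" for r using assms by (simp add: picard_def avg_def)
  then have p: "picard e (\<lambda>_. e) = (\<lambda>_. e)" by auto
  \<comment> \<open>The constant function is a fixed point of the same Picard operator, so every
    weighted bound on the difference can be halved.\<close>
  have bd: "\<bar>sol e r - e\<bar> \<le> D * (1 - r) powr (-\<beta>)" if "0 \<le> r" "r < 1" and
    D: "D \<ge> 0" "\<And>r. 0 \<le> r \<Longrightarrow> r < 1 \<Longrightarrow> \<bar>sol e r - e\<bar> \<le> 2 * D * (1 - r) powr (-\<beta>)" for r D
    using picard_diff[OF sol_continuous[of e], of "\<lambda>_. e" r "2 * D" e e] sol_fixed[of r e] p that by simp
  define D where "D = 2 * \<bar>e\<bar> + \<kappa> * C / \<beta>"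
  have D0: "D \<ge> 0" using kappa_pos C_nonneg beta_pos by (simp add: D_def)
  have D: "\<bar>sol e r - e\<bar> \<le> D * (1 - r) powr (-\<beta>)" if r: "0 \<le> r" "r < 1" for r
  proof -
    have "1 \<le> (1 - r) powr (-\<beta>)" using r beta_pos powr_mono2'[of "- \<beta>" "1 - r" 1] by simp
    then have "2 * \<bar>e\<bar> * 1 \<le> 2 * \<bar>e\<bar> * (1 - r) powr (-\<beta>)" by (intro mult_left_mono) auto
    moreover have "\<bar>sol e r\<bar> \<le> \<bar>e\<bar> + \<kappa> * C / \<beta> * (1 - r) powr (-\<beta>)"
      using picard_bound[OF sol_continuous[of e] r, of e] sol_fixed[OF r, of e] by simp
    ultimately show ?thesis unfolding D_def distrib_right by linarith
  qed
  have "\<bar>sol e r - e\<bar> \<le> D / 2 ^ m * (1 - r) powr (-\<beta>)" if "0 \<le> r" "r < 1" for r m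
    using that
  proof (induction m arbitrary: r)
    case 0 then show ?case using D by simp
  next
    case (Suc m)
    show ?case
    proof (rule bd[OF Suc.prems])
      show "0 \<le> D / 2 ^ Suc m" using D0 by simp
      show "\<bar>sol e r - e\<bar> \<le> 2 * (D / 2 ^ Suc m) * (1 - r) powr (-\<beta>)" if "0 \<le> r" "r < 1" for r
        using Suc.IH[OF that] by simp
    qed
  qed
  then have "\<bar>sol e s - e\<bar> \<le> (D * (1 - s) powr (-\<beta>)) * (1/2) ^ m" for m
    using assms by (simp add: power_divide)
  moreover have "(\<lambda>m. (D * (1 - s) powr (-\<beta>)) * (1/2) ^ m) \<longlonglongrightarrow> (D * (1 - s) powr (-\<beta>)) * 0"
    by (intro tendsto_intros LIMSEQ_power_zero) auto
  ultimately have "\<bar>sol e s - e\<bar> \<le> (D * (1 - s) powr (-\<beta>)) * 0"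
    by (intro LIMSEQ_le_const[of _ "(D * (1 - s) powr (-\<beta>)) * 0"]) blast+
  then show ?thesis by simp
qed

text \<open>A sign change gives a zero z of p, and then \<open>W\<close> is controlled up to z: on
  [0, 1 - \<delta>] by closeness to the solution 0, on [1 - \<delta>, z] by the Lipschitz constant
  \<open>K\<close>. Hence W < 1 on [0, z], p is nondecreasing there and cannot return to 0 from a
  positive value.\<close>

lemma small_initial_value_no_alternation:
  "\<exists>\<epsilon>>0. \<forall>b t. 0 < b \<and> b < \<epsilon> \<longrightarrow> \<not> alternates (flux b) (Suc 0) t"
proof -
  obtain \<delta> where \<delta>: "0 < \<delta>" "\<delta> \<le> 1/2" "K * \<delta> \<le> 1 / 4"
    by (rule small_step_exists[OF K_nonneg, of "1 / 4"]) auto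
  \<comment> \<open>Makes W \<le> 1/2 on [0, 1 - \<delta>]; the drift K \<delta> \<le> 1/4 then
    keeps \<open>W\<close> below 1.\<close>
  define \<epsilon> where "\<epsilon> = min 1 (1 / (4 * \<delta> powr (-\<beta>)))"
  have \<epsilon>: "0 < \<epsilon>" "\<epsilon> \<le> 1" "2 * \<epsilon> * \<delta> powr (-\<beta>) \<le> 1/2"
    proof -
    have d: "0 < \<delta> powr (-\<beta>)" using \<delta> by simp
    then show "0 < \<epsilon>" "\<epsilon> \<le> 1" by (auto simp: \<epsilon>_def)
    have "2 * \<epsilon> * \<delta> powr (-\<beta>) \<le> 2 * (1 / (4 * \<delta> powr (-\<beta>))) * \<delta> powr (-\<beta>)"
      using d by (intro mult_right_mono mult_left_mono) (auto simp: \<epsilon>_def)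
    also have "\<dots> = 1/2" using d by simp
    finally show "2 * \<epsilon> * \<delta> powr (-\<beta>) \<le> 1/2" .
  qed
  have "\<not> alternates (flux b) (Suc 0) t" if b: "0 < b" "b < \<epsilon>" for b t
  proof
    assume "alternates (flux b) (Suc 0) t"
    then obtain s where s: "0 < s" "s < t" "t < 1" "0 < flux b s" "flux b t < 0" by auto
    have "\<exists>z. s \<le> z \<and> z \<le> t \<and> flux b z = 0"
      using s by (intro IVT2') (auto intro!: continuous_on_subset[OF flux_continuous])
    then obtain z where z: "s \<le> z" "z \<le> t" "flux b z = 0" by blast
    have early: "sol b r \<le> 1/2" if r: "0 \<le> r" "r \<le> 1 - \<delta>" for r
    proof -
      have "\<bar>sol b r\<bar> \<le> 2 * \<bar>b - 0\<bar> * (1 - r) powr (-\<beta>)"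
        using sol_dep[of r b 0] sol_equilibrium[of 0 r] F_le_0[of 0] r \<delta> by simp
      also have "\<dots> \<le> 2 * \<epsilon> * \<delta> powr (-\<beta>)"
        using b r \<delta> beta_pos by (intro mult_mono powr_mono2') auto
      finally show ?thesis using \<epsilon> by linarith
    qed
    have lt1: "sol b r < 1" if r: "0 \<le> r" "r \<le> z" for r
    proof (cases "r \<le> 1 - \<delta>")
      case True then show ?thesis using early[OF r(1)] by auto
    next
      case False
      have "\<bar>sol b r - sol b (1 - \<delta>)\<bar> \<le> K * (r - (1 - \<delta>))"
        using r z s False \<delta> by (intro sol_lipschitz_before_zero[OF z(3)]) auto
      also have "\<dots> \<le> K * \<delta>" using r z s K_nonneg by (intro mult_left_mono) auto
      finally show ?thesis using early[of "1 - \<delta>"] \<delta> by auto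
    qed
    have "flux b s \<le> flux b z"
    proof (rule DERIV_nonneg_imp_increasing_open[where f = "flux b"])
      fix x assume x: "s < x" "x < z"
      have "F (sol b x) \<le> 0"
        using lt1[of x] x s F_neg[of "sol b x"] F_le_0[of "sol b x"] by (cases "sol b x \<le> 0") auto
      then have "0 \<le> - \<kappa> * x ^ (n - 1) * F (sol b x)"
        using kappa_pos x s by (simp add: mult_nonneg_nonpos)
      then show "\<exists>y. (flux b has_real_derivative y) (at x) \<and> 0 \<le> y"
        using flux_deriv[of x b] x s z by force
    qed (use s z in \<open>auto intro!: continuous_on_subset[OF flux_continuous]\<close>)
    then show False using s z by auto
  qed
  then show ?thesis using \<epsilon>(1) by blast
qed

text \<open>At a first zero of \<open>W\<close> the flux is \<le> 0, and nonzero because 0 is an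
  equilibrium. From there on W \<le> 0, where F vanishes, so p keeps its negative value up to s = 1,
  against p(1) = 0.\<close>

lemma sol_pos:
  assumes a: "0 < a" "a < 1" and "flux a 1 = 0" "0 \<le> s" "s < 1"
  shows "0 < sol a s"
proof (rule ccontr)
  assume "\<not> 0 < sol a s"
  then have neg: "sol a s \<le> 0" by simp
  define Z where "Z = {0..s} \<inter> sol a -` {..0}"
  have c0: "continuous_on {0..s} (sol a)" using assms by (intro continuous_on_subset[OF sol_continuous]) auto
  have "closed Z" unfolding Z_def by (rule continuous_closed_preimage[OF c0]) auto
  have Zne: "s \<in> Z" using neg assms by (auto simp: Z_def)
  have Zb: "bdd_below Z" by (auto simp: Z_def intro: bdd_belowI[of _ 0])
  define x where "x = Inf Z"
  have xZ: "x \<in> Z" unfolding x_def using closed_contains_Inf[OF _ Zb \<open>closed Z\<close>] Zne by auto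
  then have x: "0 \<le> x" "x \<le> s" "sol a x \<le> 0" by (auto simp: Z_def)
  have before: "0 < sol a r" if "0 \<le> r" "r < x" for r
    using cInf_lower[OF _ Zb, of r] that x by (force simp: Z_def x_def)
  have x0: "0 < x" using x a sol_0[of a] by (cases "x = 0") auto
  have x1: "x < 1" using x assms by simp
  have le: "flux a x \<le> 0"
  proof (rule ccontr)
    assume "\<not> flux a x \<le> 0"
    then have "0 < flux a x / (x ^ n * (1 - x))" using x0 x1 by simp
    then obtain d where d: "d > 0" "\<And>h. 0 < h \<Longrightarrow> h < d \<Longrightarrow> sol a (x - h) < sol a x"
      using DERIV_pos_inc_left[OF sol_deriv_flux[OF x0 x1]] by blast
    define h where "h = min (d/2) (x/2)"
    have "0 < h" "h < d" "0 \<le> x - h" using d x0 by (auto simp: h_def min_def)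
    then show False using d(2)[of h] before[of "x - h"] x by auto
  qed
  have ne: "flux a x \<noteq> 0" using flux_zero_not_equilibrium[OF a x0 x1] F_le_0[OF x(3)] by blast
  \<comment> \<open>\<open>x2\<close> is a point with W < 0 and \<open>w\<close> the first return to
    W \<ge> 0 after it; until \<open>w\<close> the flux is the negative constant
    \<open>flux a x\<close>, so \<open>W\<close> decreases.\<close>
  have after: "sol a r \<le> 0" if r: "x \<le> r" "r < 1" for r
  proof (rule ccontr)
    assume nr: "\<not> sol a r \<le> 0"
    have "flux a x / (x ^ n * (1 - x)) < 0" using x0 x1 le ne by (simp add: divide_less_0_iff)
    then obtain d where d: "d > 0" "\<And>h. 0 < h \<Longrightarrow> h < d \<Longrightarrow> sol a x > sol a (x + h)"
      using DERIV_neg_dec_right[OF sol_deriv_flux[OF x0 x1]] by blast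
    have xr: "x < r" using r nr x by (cases "x = r") auto
    define x2 where "x2 = x + min (d/2) ((r - x)/2)"
    have x2: "x < x2" "x2 < r" "x2 < x + d" using d xr by (auto simp: x2_def min_def field_simps)
    have s2: "sol a x2 < 0" using d(2)[of "x2 - x"] x2 x by auto
    define Y where "Y = {x2..r} \<inter> sol a -` {0..}"
    have c1: "continuous_on {x2..r} (sol a)" using x2 x0 r by (intro continuous_on_subset[OF sol_continuous]) auto
    have "closed Y" unfolding Y_def by (rule continuous_closed_preimage[OF c1]) auto
    have Yne: "r \<in> Y" using nr x2 by (auto simp: Y_def)
    have Yb: "bdd_below Y" by (auto simp: Y_def intro: bdd_belowI[of _ x2])
    define w where "w = Inf Y"
    have wY: "w \<in> Y" unfolding w_def using closed_contains_Inf[OF _ Yb \<open>closed Y\<close>] Yne by auto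
    then have w: "x2 \<le> w" "w \<le> r" "0 \<le> sol a w" by (auto simp: Y_def)
    have neg': "sol a q \<le> 0" if "x \<le> q" "q < w" for q
    proof (cases "q < x2")
      case True then show ?thesis using d(2)[of "q - x"] x2 x that by (cases "q = x") auto
    next
      case False then show ?thesis using cInf_lower[OF _ Yb, of q] that w by (force simp: Y_def w_def)
    qed
    have fl: "flux a q = flux a x" if q: "x < q" "q \<le> w" for q
    proof (rule DERIV_isconst_end[OF q(1)])
      show "continuous_on {x..q} (flux a)" using q w r x0 by (intro continuous_on_subset[OF flux_continuous]) auto
      fix y assume y: "x < y" "y < q"
      then show "(flux a has_real_derivative 0) (at y)"
        using flux_deriv[of y a] F_le_0[OF neg'[of y]] q w r x0 by auto
    qed
    have "sol a w < sol a x2 \<or> w = x2"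
    proof (cases "w = x2")
      case False
      then have "x2 < w" using w by simp
      then have "sol a w < sol a x2"
      proof (rule DERIV_neg_imp_decreasing_open)
        show "continuous_on {x2..w} (sol a)" using w c1 by (auto intro: continuous_on_subset)
        fix y assume y: "x2 < y" "y < w"
        then have "flux a y / (y ^ n * (1 - y)) < 0" using fl[of y] le ne x2 x0 w r by (simp add: divide_less_0_iff)
        then show "\<exists>d. (sol a has_real_derivative d) (at y) \<and> d < 0"
          using sol_deriv_flux[of y a] y x2 x0 w r by force
      qed
      then show ?thesis by simp
    qed simp
    then show False using w s2 by auto
  qed
  have "flux a 1 = flux a x"
  proof (rule DERIV_isconst_end[OF x1])
    show "continuous_on {x..1} (flux a)" using x0 by (intro continuous_on_subset[OF flux_continuous]) auto
    fix y assume y: "x < y" "y < 1"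
    then show "(flux a has_real_derivative 0) (at y)"
      using flux_deriv[of y a] F_le_0[OF after[of y]] x0 by auto
  qed
  then show False using ne assms by simp
qed

section \<open>Infima of the sets of initial values with many sign changes\<close>

theorem shooting_values_exist:
  assumes a0: "0 < a0" "a0 < 1" "alternates (flux a0) N t0"
  shows "\<exists>\<alpha>. \<forall>j. 1 \<le> j \<and> j \<le> N \<longrightarrow> 0 < \<alpha> j \<and> \<alpha> j < 1 \<and> flux (\<alpha> j) 1 = 0 \<and>
    (\<forall>i. 1 \<le> i \<and> i < j \<longrightarrow> \<alpha> i < \<alpha> j)"
proof -
  define A where "A j = {a. 0 < a \<and> a < 1 \<and> (\<exists>t. alternates (flux a) j t)}" for j
  define \<alpha> where "\<alpha> j = Inf (A j)" for j
  obtain \<epsilon> where \<epsilon>: "0 < \<epsilon>" "\<And>b t. 0 < b \<and> b < \<epsilon> \<Longrightarrow> \<not> alternates (flux b) (Suc 0) t"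
    using small_initial_value_no_alternation by blast
  have anti: "A j \<subseteq> A i" if "i \<le> j" for i j
    using alternates_mono that unfolding A_def by blast
  have ne: "a0 \<in> A j" if "j \<le> N" for j using alternates_mono[OF a0(3) that] a0 by (auto simp: A_def)
  have bdd: "bdd_below (A j)" for j by (auto simp: A_def intro: bdd_belowI[of _ 0])
  have \<alpha>01: "0 < \<alpha> j" "\<alpha> j < 1" if "1 \<le> j" "j \<le> N" for j
  proof -
    \<comment> \<open>Initial values below \<open>\<epsilon>\<close> admit no sign change; this
      keeps the infimum off the equilibrium 0.\<close>
    have "\<epsilon> \<le> \<alpha> j" unfolding \<alpha>_def
    proof (rule cInf_greatest)
      show "A j \<noteq> {}" using ne[OF that(2)] by blast
      fix x assume "x \<in> A j"
      then have "x \<in> A (Suc 0)" using anti[of "Suc 0" j] that by auto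
      then show "\<epsilon> \<le> x" using \<epsilon>(2)[of x] by (force simp: A_def)
    qed
    then show "0 < \<alpha> j" using \<epsilon> by simp
    show "\<alpha> j < 1" unfolding \<alpha>_def using cInf_lower[OF ne[OF that(2)] bdd] a0 by auto
  qed
  have notin: "\<alpha> j \<notin> A j" if "1 \<le> j" "j \<le> N" for j
  proof
    assume "\<alpha> j \<in> A j"
    then obtain t where "alternates (flux (\<alpha> j)) j t" by (auto simp: A_def)
    from alternates_open[OF this] obtain d where d: "d > 0" "\<And>b. dist b (\<alpha> j) < d \<Longrightarrow> alternates (flux b) j t"
      by (auto simp: eventually_nhds_metric)
    define b where "b = \<alpha> j - min (d/2) (\<alpha> j/2)"
    have b: "0 < b" "b < \<alpha> j" "dist b (\<alpha> j) < d"
      using d(1) \<alpha>01[OF that] by (auto simp: b_def dist_real_def min_def)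
    then have "b \<in> A j" using d(2)[OF b(3)] \<alpha>01[OF that] by (auto simp: A_def)
    then show False using cInf_lower[OF _ bdd] b(2) unfolding \<alpha>_def by fastforce
  qed
  have seq: "\<exists>b s. b \<longlonglongrightarrow> \<alpha> j \<and> (\<forall>m. alternates (flux (b m)) j (s m))" if "j \<le> N" for j
  proof -
    have "\<alpha> j \<in> closure (A j)" unfolding \<alpha>_def using ne[OF that] bdd by (intro closure_contains_Inf) auto
    then obtain b where "\<And>m. b m \<in> A j" "b \<longlonglongrightarrow> \<alpha> j" by (auto simp: closure_sequential)
    moreover from this(1) have "\<forall>m. \<exists>s. alternates (flux (b m)) j s" by (auto simp: A_def)
    ultimately show ?thesis by metis
  qed
  \<comment> \<open>A nonzero end value would let \<open>alternates_limit\<close> place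
    \<open>\<alpha> j\<close> in \<open>A j\<close>, against openness.\<close>
  have zero: "flux (\<alpha> j) 1 = 0" if j: "1 \<le> j" "j \<le> N" for j
  proof (rule ccontr)
    assume nz: "flux (\<alpha> j) 1 \<noteq> 0"
    obtain b s where bs: "b \<longlonglongrightarrow> \<alpha> j" "\<And>m. alternates (flux (b m)) j (s m)" using seq[OF j(2)] by blast
    obtain r \<sigma> where r: "strict_mono r" "(s \<circ> r) \<longlonglongrightarrow> \<sigma>" "0 \<le> \<sigma>" "\<sigma> \<le> 1"
      using bounded_subsequence[of s] bs(2) alternatesD by metis
    have "(b \<circ> r) \<longlonglongrightarrow> \<alpha> j" using LIMSEQ_subseq_LIMSEQ bs r by blast
    then have "\<exists>t<\<sigma> + 1. alternates (flux (\<alpha> j)) j t"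
      using bs(2) nz by (intro alternates_limit[OF \<alpha>01[OF j] _ _ r(2)]) auto
    then show False using notin[OF j] \<alpha>01[OF j] by (auto simp: A_def)
  qed
  have step: "\<alpha> j < \<alpha> (Suc j)" if j: "1 \<le> j" "Suc j \<le> N" for j
  proof (rule ccontr)
    assume "\<not> \<alpha> j < \<alpha> (Suc j)"
    moreover have "\<alpha> j \<le> \<alpha> (Suc j)" unfolding \<alpha>_def
      using ne[OF j(2)] bdd anti[of j "Suc j"] by (intro cInf_superset_mono) auto
    ultimately have eq: "\<alpha> (Suc j) = \<alpha> j" by simp
    \<comment> \<open>The approximating fluxes have Suc (Suc i) sign changes; losing one leaves Suc
      i = j, which would place \<open>\<alpha> j\<close> in \<open>A j\<close>.\<close>
    obtain i where i: "j = Suc i" using j by (cases j) auto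
    obtain b s where bs: "b \<longlonglongrightarrow> \<alpha> j" "\<And>m. alternates (flux (b m)) (Suc j) (s m)"
      using seq[OF j(2)] eq by auto
    have j': "1 \<le> j" "j \<le> N" using j by auto
    have "\<exists>t. alternates (flux (\<alpha> j)) (Suc i) t"
      by (rule alternates_limit_end[OF \<alpha>01[OF j'] zero[OF j'] bs(1)]) (use bs(2) i in simp)
    then show False using notin[OF j'] \<alpha>01[OF j'] i by (auto simp: A_def)
  qed
  have mono: "\<alpha> i < \<alpha> j" if "1 \<le> i" "i < j" "j \<le> N" for i j
    using that(2,3)
  proof (induction j)
    case (Suc j) then show ?case using step[of i] step[of j] that(1) by (cases "i = j") auto
  qed simp
  show ?thesis using \<alpha>01 zero mono by (intro exI[of _ \<alpha>]) blast
qed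

end

section \<open>Jacobi polynomials and Sturm comparison\<close>

text \<open>With \<open>Q\<close> the polynomial of degree \<open>k\<close> for \<open>(c + 1, d + 1)\<close>, the recursion reads
  \<open>(s\<^sup>c (1 - s)\<^sup>d Q)' = s\<^sup>c\<^sup>-\<^sup>1 (1 - s)\<^sup>d\<^sup>-\<^sup>1 P\<close>, so Rolle's theorem adds a zero at every step.\<close>

fun jacobi :: "nat \<Rightarrow> nat \<Rightarrow> nat \<Rightarrow> real poly" where
  "jacobi 0 c d = 1"
| "jacobi (Suc k) c d = [:real c, - (real c + real d):] * jacobi k (Suc c) (Suc d)
    + [:0, 1, -1:] * pderiv (jacobi k (Suc c) (Suc d))"

text \<open>Equation and derivative formula feed each other: the formula reduces the equation of
  degree k + 1 to the recursion, and the equation of degree k + 1 with shifted parameters gives the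
  formula of degree k + 2.\<close>

lemma jacobi_ode_and_pderiv:
  "[:0, 1, -1:] * pderiv (pderiv (jacobi k c d)) + [:real c, - (real c + real d):] * pderiv (jacobi k c d)
     + smult (real k * (real k - 1 + real c + real d)) (jacobi k c d) = 0
   \<and> pderiv (jacobi (Suc k) c d) = smult (- (real (Suc k) * (real k + real c + real d))) (jacobi k (Suc c) (Suc d))"
proof (induction k arbitrary: c d)
  case 0
  show ?case by (simp add: pderiv_pCons)
next
  case (Suc k)
  have ode: "[:0, 1, -1:] * pderiv (pderiv (jacobi (Suc k) c d)) + [:real c, - (real c + real d):] * pderiv (jacobi (Suc k) c d)
     + smult (real (Suc k) * (real (Suc k) - 1 + real c + real d)) (jacobi (Suc k) c d) = 0" for c d
  proof -
    define Q where "Q = jacobi k (Suc c) (Suc d)"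
    define m where "m = real (Suc k) * (real k + real c + real d)"
    have dP: "pderiv (jacobi (Suc k) c d) = smult (- m) Q"
      using Suc.IH[of c d] by (simp add: Q_def m_def)
    have P: "jacobi (Suc k) c d = [:real c, - (real c + real d):] * Q + [:0, 1, -1:] * pderiv Q"
      by (simp add: Q_def)
    have m: "real (Suc k) * (real (Suc k) - 1 + real c + real d) = m" by (simp add: m_def)
    \<comment> \<open>With P' = -m Q the equation for P is -m times the recursion, plus m P.\<close>
    have X: "[:0, 1, -1:] * pderiv (smult (- m) Q) + [:real c, - (real c + real d):] * smult (- m) Q
       + smult m ([:real c, - (real c + real d):] * Q + [:0, 1, -1:] * pderiv Q) = 0"
      by (simp add: pderiv_smult smult_add_right pderiv_minus)
    show ?thesis unfolding dP m unfolding P by (rule X)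
  qed
  define R where "R = jacobi (Suc k) (Suc c) (Suc d)"
  have R: "[:0, 1, -1:] * pderiv (pderiv R) + [:real c + 1, - (real c + real d + 2):] * pderiv R
     + smult (real (Suc k) * (real k + real c + real d + 2)) R = 0"
    using ode[of "Suc c" "Suc d"] by (simp add: R_def algebra_simps)
  have "pderiv (jacobi (Suc (Suc k)) c d) = smult (- (real (Suc (Suc k)) * (real (Suc k) + real c + real d))) R"
  proof (rule poly_ext)
    fix x
    have "poly ([:0, 1, -1:] * pderiv (pderiv R) + [:real c + 1, - (real c + real d + 2):] * pderiv R
     + smult (real (Suc k) * (real k + real c + real d + 2)) R) x = 0" unfolding R by simp
    then have e: "x * (1 - x) * poly (pderiv (pderiv R)) x + (real c + 1 - (real c + real d + 2) * x) * poly (pderiv R) x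
      + (real k + 1) * (real k + real c + real d + 2) * poly R x = 0"
      by (simp add: algebra_simps)
    have "poly (pderiv (jacobi (Suc (Suc k)) c d)) x
      = - (real c + real d) * poly R x + (real c - (real c + real d) * x) * poly (pderiv R) x
        + (1 - 2 * x) * poly (pderiv R) x + x * (1 - x) * poly (pderiv (pderiv R)) x"
      by (simp add: R_def[symmetric] pderiv_add pderiv_mult pderiv_pCons pderiv_smult pderiv_minus algebra_simps del: jacobi.simps(2)
          add: jacobi.simps(2)[of "Suc k"])
    \<comment> \<open>\<open>e\<close> eliminates the second derivative, and (k + 1) (k + c + d + 2)
      + (c + d) = (k + 2) (k + 1 + c + d).\<close>
    also have "\<dots> = - ((real k + 2) * (real k + 1 + real c + real d)) * poly R x"
      using e by algebra
    finally show "poly (pderiv (jacobi (Suc (Suc k)) c d)) x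
        = poly (smult (- (real (Suc (Suc k)) * (real (Suc k) + real c + real d))) R) x"
      by (simp add: algebra_simps)
  qed
  then show ?case using ode[of c d] by (simp add: R_def del: jacobi.simps)
qed

lemma jacobi_ode:
  "x * (1 - x) * poly (pderiv (pderiv (jacobi k c d))) x + (real c - (real c + real d) * x) * poly (pderiv (jacobi k c d)) x
     + real k * (real k - 1 + real c + real d) * poly (jacobi k c d) x = 0"
proof -
  have "poly ([:0, 1, -1:] * pderiv (pderiv (jacobi k c d)) + [:real c, - (real c + real d):] * pderiv (jacobi k c d)
     + smult (real k * (real k - 1 + real c + real d)) (jacobi k c d)) x = 0"
    using jacobi_ode_and_pderiv[of k c d] by (metis poly_0)
  then show ?thesis by (simp add: algebra_simps)
qed

lemma jacobi_0_pos: "c \<ge> 1 \<Longrightarrow> 0 < poly (jacobi k c d) 0"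
  by (induction k arbitrary: c d) auto

lemma jacobi_zeros:
  assumes "c \<ge> 1" "d \<ge> 1"
  shows "\<exists>z::nat \<Rightarrow> real. (\<forall>i<k. 0 < z i \<and> z i < 1 \<and> poly (jacobi k c d) (z i) = 0) \<and> (\<forall>i. Suc i < k \<longrightarrow> z i < z (Suc i))"
  using assms
proof (induction k arbitrary: c d)
  case (Suc k)
  define Q where "Q = jacobi k (Suc c) (Suc d)"
  obtain z :: "nat \<Rightarrow> real" where z: "\<And>i. i < k \<Longrightarrow> 0 < z i \<and> z i < 1 \<and> poly Q (z i) = 0" "\<And>i. Suc i < k \<Longrightarrow> z i < z (Suc i)"
    using Suc.IH[of "Suc c" "Suc d"] by (auto simp: Q_def)
  \<comment> \<open>The zeros of \<open>Q\<close> framed by 0 and 1, where the weight s^c (1 - s)^d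
    vanishes: k + 2 zeros of \<open>h\<close>, hence k + 1 critical points.\<close>
  define y where "y i = (if i = 0 then 0 else if i \<le> k then z (i - 1) else 1)" for i
  define h where "h s = s ^ c * (1 - s) ^ d * poly Q s" for s
  have y01: "0 \<le> y i" "y i \<le> 1" if "i \<le> Suc k" for i
    using z(1)[of "i - 1"] that by (auto simp: y_def less_imp_le)
  have yinc: "y i < y (Suc i)" if ik: "i \<le> k" for i
  proof -
    consider "i = 0" "k = 0" | "i = 0" "k > 0" | "i > 0" "i < k" | "i > 0" "i = k" using ik by force
    then show ?thesis
    proof cases
      case 3
      then have "z (i - 1) < z (Suc (i - 1))" by (intro z(2)) auto
      with 3 show ?thesis by (simp add: y_def)
    qed (use z(1)[of 0] z(1)[of "k - 1"] in \<open>auto simp: y_def\<close>)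
  qed
  have hy: "h (y i) = 0" if "i \<le> Suc k" for i
    using z(1)[of "i - 1"] that Suc.prems by (auto simp: y_def h_def)
  have dh: "(h has_real_derivative x ^ (c - 1) * (1 - x) ^ (d - 1) * poly (jacobi (Suc k) c d) x) (at x)" for x
  proof -
    have e: "x ^ c = x * x ^ (c - 1)" "(1 - x) ^ d = (1 - x) * (1 - x) ^ (d - 1)"
      using Suc.prems by (auto simp: power_eq_if)
    have D: "(h has_real_derivative
        (real c * x ^ (c - 1) * (1 - x) ^ d + real d * (1 - x) ^ (d - 1) * (- 1) * x ^ c) * poly Q x
        + poly (pderiv Q) x * (x ^ c * (1 - x) ^ d)) (at x)"
      unfolding h_def by (intro DERIV_mult poly_DERIV) (auto intro!: derivative_eq_intros)
    have J: "poly (jacobi (Suc k) c d) x = (real c - (real c + real d) * x) * poly Q x + x * (1 - x) * poly (pderiv Q) x"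
      by (simp add: Q_def algebra_simps)
    show ?thesis using D unfolding J e by (rule DERIV_cong) (simp add: algebra_simps)
  qed
  have "\<exists>x. y i < x \<and> x < y (Suc i) \<and> poly (jacobi (Suc k) c d) x = 0" if i: "i \<le> k" for i
  proof -
    have "\<exists>x. y i < x \<and> x < y (Suc i) \<and> (h has_real_derivative 0) (at x)"
      using hy[of i] hy[of "Suc i"] i
      by (intro Rolle yinc) (auto intro!: DERIV_continuous_on dh simp: real_differentiable_def intro: dh has_field_derivative_at_within)
    then obtain x where x: "y i < x" "x < y (Suc i)" "(h has_real_derivative 0) (at x)" by blast
    have "x ^ (c - 1) * (1 - x) ^ (d - 1) * poly (jacobi (Suc k) c d) x = 0"
      using DERIV_unique[OF dh x(3)] .
    moreover have "0 < x" "x < 1" using x y01[of i] y01[of "Suc i"] i by auto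
    ultimately show ?thesis using x by auto
  qed
  then obtain z' where z': "\<And>i. i \<le> k \<Longrightarrow> y i < z' i \<and> z' i < y (Suc i) \<and> poly (jacobi (Suc k) c d) (z' i) = 0"
    by metis
  have "0 < z' i \<and> z' i < 1 \<and> poly (jacobi (Suc k) c d) (z' i) = 0" if "i < Suc k" for i
    using z'[of i] y01[of i] y01[of "Suc i"] that by (auto intro: le_less_trans less_le_trans)
  moreover have "z' i < z' (Suc i)" if "Suc i < Suc k" for i
    using z'[of i] z'[of "Suc i"] that by (auto intro: less_trans)
  ultimately show ?case by blast
qed simp

section \<open>Sturm comparison near the constant solution\<close>

lemma nodal_interval:
  fixes f :: "real \<Rightarrow> real"
  assumes cont: "continuous_on {x..y} f" and u: "x < u" "u < y" "0 < f u" and "f y = 0"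
  obtains \<alpha> \<beta> where "x \<le> \<alpha>" "\<alpha> < \<beta>" "\<beta> \<le> y" "\<alpha> = x \<or> f \<alpha> = 0" "f \<beta> = 0" "\<And>s. \<alpha> < s \<Longrightarrow> s < \<beta> \<Longrightarrow> 0 < f s"
proof -
  define Z1 where "Z1 = {u..y} \<inter> f -` {0}"
  define Z2 where "Z2 = {x..u} \<inter> f -` {0}"
  have c1: "continuous_on {u..y} f" and c2: "continuous_on {x..u} f"
    using u by (auto intro: continuous_on_subset[OF cont])
  have "closed Z1" unfolding Z1_def by (rule continuous_closed_preimage[OF c1]) auto
  have "closed Z2" unfolding Z2_def by (rule continuous_closed_preimage[OF c2]) auto
  define \<beta> where "\<beta> = Inf Z1"
  have b1: "bdd_below Z1" by (auto simp: Z1_def intro: bdd_belowI[of _ u])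
  have "y \<in> Z1" using u assms by (auto simp: Z1_def)
  then have "\<beta> \<in> Z1" unfolding \<beta>_def using closed_contains_Inf[OF _ b1 \<open>closed Z1\<close>] by auto
  then have \<beta>: "u \<le> \<beta>" "\<beta> \<le> y" "f \<beta> = 0" by (auto simp: Z1_def)
  have right: "0 < f s" if us: "u \<le> s" "s < \<beta>" for s
  proof (rule ccontr)
    assume "\<not> 0 < f s"
    then have "\<exists>z. u \<le> z \<and> z \<le> s \<and> f z = 0"
      using u us \<beta> by (intro IVT2') (auto intro: continuous_on_subset[OF c1])
    then obtain z where "z \<in> Z1" "z \<le> s" using us \<beta>(2) by (force simp: Z1_def)
    then show False using cInf_lower[OF _ b1, of z] us by (simp add: \<beta>_def)
  qed
  have below: "\<exists>z. s \<le> z \<and> z \<le> u \<and> f z = 0" if "\<not> 0 < f s" "x \<le> s" "s \<le> u" for s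
    using u that by (intro IVT') (auto intro: continuous_on_subset[OF c2])
  have "u < \<beta>" using \<beta> u by (cases "u = \<beta>") auto
  show ?thesis
  \<comment> \<open>Without a zero in [x, u] the nodal interval starts at \<open>x\<close> itself,
    where \<open>f\<close> may be nonzero; this is the situation at s = 0.\<close>
  proof (cases "Z2 = {}")
    case True
    have "0 < f s" if xs: "x < s" "s < \<beta>" for s
    proof (cases "u \<le> s")
      case True then show ?thesis using right xs by simp
    next
      case False
      have "f z \<noteq> 0" if "x \<le> z" "z \<le> u" for z using that \<open>Z2 = {}\<close> by (auto simp: Z2_def)
      then show ?thesis using below[of s] xs False by (metis less_imp_le linorder_not_le order_trans)
    qed
    then show ?thesis using that[of x \<beta>] \<beta> u by auto
  next
    case False
    define \<alpha> where "\<alpha> = Sup Z2"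
    have b2: "bdd_above Z2" by (auto simp: Z2_def intro: bdd_aboveI[of _ u])
    have "\<alpha> \<in> Z2" unfolding \<alpha>_def using closed_contains_Sup[OF False b2 \<open>closed Z2\<close>] by auto
    then have \<alpha>: "x \<le> \<alpha>" "\<alpha> \<le> u" "f \<alpha> = 0" by (auto simp: Z2_def)
    have "0 < f s" if as: "\<alpha> < s" "s < \<beta>" for s
    proof (cases "u \<le> s")
      case True then show ?thesis using right as by simp
    next
      case False
      show ?thesis
      proof (rule ccontr)
        assume "\<not> 0 < f s"
        then obtain z where "s \<le> z" "z \<in> Z2" using below[of s] False as \<alpha> by (force simp: Z2_def)
        then show False using cSup_upper[OF _ b2, of z] as by (simp add: \<alpha>_def)
      qed
    qed
    then show ?thesis using that[of \<alpha> \<beta>] \<alpha> \<beta> \<open>u < \<beta>\<close> by auto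
  qed
qed

context shooting
begin

text \<open>Suppose y v \<le> 0 for v = W - 1 on a nodal interval of \<open>P\<close>. The
  Wronskian-type quantity P p - v s^n (1 - s) P' has derivative s^(n-1) P (\<mu> v - \<kappa> F), so
  by \<open>F1\<close> its signed version \<open>G\<close> is nondecreasing; the signs of P' and v
  at the ends give G(\<alpha>) \<ge> 0 \<ge> G(\<beta>'). Hence v = 0 throughout, which uniqueness
  excludes. Both choices of y are covered, so v takes both signs.\<close>

lemma sturm_sign_change:
  fixes P :: "real poly" and x y \<mu> \<eta> :: real
  assumes a: "0 < a" "a < 1" and ab: "0 \<le> \<alpha>" "\<alpha> < \<beta>'" "\<beta>' < 1"
    and ode: "\<And>s. s * (1 - s) * poly (pderiv (pderiv P)) s + (real n - (real n + 1) * s) * poly (pderiv P) s + \<mu> * poly P s = 0"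
    and pos: "\<And>s. \<alpha> < s \<Longrightarrow> s < \<beta>' \<Longrightarrow> 0 < x * poly P s"
    and left: "\<alpha> = 0 \<or> poly P \<alpha> = 0" and right: "poly P \<beta>' = 0"
    and close: "\<And>s. 0 \<le> s \<Longrightarrow> s \<le> \<beta>' \<Longrightarrow> \<bar>sol a s - 1\<bar> < \<eta>"
    and F1: "\<And>u. 0 < \<bar>u - 1\<bar> \<Longrightarrow> \<bar>u - 1\<bar> < \<eta> \<Longrightarrow> 0 < (u - 1) * (\<kappa> * F u - \<mu> * (u - 1))"
    and y: "y = 1 \<or> y = -1"
  shows "\<exists>s. \<alpha> < s \<and> s < \<beta>' \<and> 0 < y * (sol a s - 1)"
proof (rule ccontr)
  assume "\<not> ?thesis"
  then have neg: "\<And>s. \<alpha> < s \<Longrightarrow> s < \<beta>' \<Longrightarrow> y * (sol a s - 1) \<le> 0" by force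
  define v where "v s = sol a s - 1" for s
  define W where "W s = poly P s * flux a s - v s * (s ^ n * (1 - s) * poly (pderiv P) s)" for s
  define G where "G s = x * y * W s" for s
  have contv: "continuous_on {\<alpha>..\<beta>'} v" unfolding v_def
    using ab by (intro continuous_intros continuous_on_subset[OF sol_continuous]) auto
  have contG: "continuous_on {\<alpha>..\<beta>'} G" unfolding G_def W_def
    using ab by (intro continuous_intros contv continuous_on_subset[OF flux_continuous]) auto
  have negc: "y * v s \<le> 0" if "\<alpha> \<le> s" "s \<le> \<beta>'" for s
  proof -
    have "closure {\<alpha><..<\<beta>'} = {\<alpha>..\<beta>'}" using ab by simp
    then show ?thesis using that neg
      by (intro continuous_le_on_closure[of "{\<alpha><..<\<beta>'}" "\<lambda>s. y * v s" s 0]) (auto intro!: continuous_intros contv simp: v_def[symmetric])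
  qed
  have dG: "(G has_real_derivative s ^ (n - 1) * (x * poly P s) * (- y * (\<kappa> * F (sol a s) - \<mu> * v s))) (at s)"
    if s: "\<alpha> < s" "s < \<beta>'" for s
  proof -
    have s01: "0 < s" "s < 1" using s ab by auto
    obtain m where m: "n = Suc m" using n_pos by (cases n) auto
    have w: "(v has_real_derivative flux a s / (s ^ n * (1 - s))) (at s)"
      unfolding v_def using s01 by (auto intro!: derivative_eq_intros sol_deriv_flux)
    have f: "(flux a has_real_derivative - \<kappa> * s ^ (n - 1) * F (sol a s)) (at s)" by (rule flux_deriv[OF s01])
    have q: "((\<lambda>s. s ^ n * (1 - s) * poly (pderiv P) s) has_real_derivative - \<mu> * s ^ (n - 1) * poly P s) (at s)"
    proof -
      have "((\<lambda>s. s ^ n * (1 - s) * poly (pderiv P) s) has_real_derivative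
          s ^ (n - 1) * (s * (1 - s) * poly (pderiv (pderiv P)) s + (real n - (real n + 1) * s) * poly (pderiv P) s)) (at s)"
      proof -
        have sn: "s ^ n = s * s ^ (n - 1)" using m by simp
        have "((\<lambda>s. s ^ n * (1 - s) * poly (pderiv P) s) has_real_derivative
          (real n * s ^ (n - 1) * (1 - s) + s ^ n * (- 1)) * poly (pderiv P) s + poly (pderiv (pderiv P)) s * (s ^ n * (1 - s))) (at s)"
          by (intro DERIV_mult poly_DERIV) (auto intro!: derivative_eq_intros)
        then show ?thesis unfolding sn by (rule DERIV_cong) (simp add: algebra_simps)
      qed
      moreover have "s * (1 - s) * poly (pderiv (pderiv P)) s + (real n - (real n + 1) * s) * poly (pderiv P) s = - \<mu> * poly P s"
        using ode[of s] by linarith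
      ultimately show ?thesis by (simp add: mult_ac)
    qed
    have "(W has_real_derivative
        (poly (pderiv P) s * flux a s + (- \<kappa> * s ^ (n - 1) * F (sol a s)) * poly P s)
        - (flux a s / (s ^ n * (1 - s)) * (s ^ n * (1 - s) * poly (pderiv P) s) + (- \<mu> * s ^ (n - 1) * poly P s) * v s)) (at s)"
      unfolding W_def by (intro DERIV_diff DERIV_mult poly_DERIV w f q)
    moreover have "flux a s / (s ^ n * (1 - s)) * (s ^ n * (1 - s) * poly (pderiv P) s) = poly (pderiv P) s * flux a s"
      using s01 by simp
    ultimately have "(G has_real_derivative x * y * ((poly (pderiv P) s * flux a s + (- \<kappa> * s ^ (n - 1) * F (sol a s)) * poly P s)
        - (poly (pderiv P) s * flux a s + (- \<mu> * s ^ (n - 1) * poly P s) * v s))) (at s)"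
      unfolding G_def by (intro DERIV_cmult) simp
    then show ?thesis by (simp add: algebra_simps)
  qed
  have sgn: "0 < - y * (\<kappa> * F (sol a s) - \<mu> * v s)" if s: "\<alpha> < s" "s < \<beta>'" and nz: "v s \<noteq> 0" for s
  proof -
    have yv: "y * v s < 0" using negc[of s] s nz y by auto
    have "0 < v s * (\<kappa> * F (sol a s) - \<mu> * v s)"
      using F1[of "sol a s"] close[of s] s ab nz by (simp add: v_def)
    then show ?thesis using yv y
      by (auto simp: zero_less_mult_iff mult_less_0_iff)
  qed
  have dG0: "0 \<le> s ^ (n - 1) * (x * poly P s) * (- y * (\<kappa> * F (sol a s) - \<mu> * v s))" if s: "\<alpha> < s" "s < \<beta>'" for s
  proof (cases "v s = 0")
    case True then have "sol a s = 1" by (simp add: v_def)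
    then show ?thesis using True F_1 by simp
  next
    case False
    have "0 \<le> s ^ (n - 1)" using s ab by simp
    from mult_nonneg_nonneg[OF mult_nonneg_nonneg[OF this less_imp_le[OF pos[OF s]]] less_imp_le[OF sgn[OF s False]]]
    show ?thesis .
  qed
  have mono: "G p \<le> G q" if "\<alpha> \<le> p" "p \<le> q" "q \<le> \<beta>'" for p q
  proof (rule DERIV_nonneg_imp_increasing_open[where f = G])
    show "continuous_on {p..q} G" using that by (intro continuous_on_subset[OF contG]) auto
    fix r assume "p < r" "r < q"
    then show "\<exists>d. (G has_real_derivative d) (at r) \<and> 0 \<le> d" using dG[of r] dG0[of r] that by auto
  qed (use that in auto)
  have Gb: "G \<beta>' \<le> 0"
  proof -
    have "x * poly (pderiv P) \<beta>' \<le> 0"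
    proof (rule ccontr)
      assume "\<not> ?thesis"
      then obtain d where d: "d > 0" "\<And>h. 0 < h \<Longrightarrow> h < d \<Longrightarrow> x * poly P (\<beta>' - h) < x * poly P \<beta>'"
        using DERIV_pos_inc_left[OF DERIV_cmult[OF poly_DERIV[of P \<beta>']], of x] by force
      define h where "h = min (d/2) ((\<beta>' - \<alpha>)/2)"
      have "0 < h" "h < d" "\<alpha> < \<beta>' - h" using d(1) ab by (auto simp: h_def min_def field_simps)
      then show False using d(2)[of h] pos[of "\<beta>' - h"] right by auto
    qed
    moreover have "y * v \<beta>' \<le> 0" "0 \<le> \<beta>' ^ n * (1 - \<beta>')" using negc[of \<beta>'] ab by auto
    ultimately have "0 \<le> (x * poly (pderiv P) \<beta>') * (y * v \<beta>') * (\<beta>' ^ n * (1 - \<beta>'))"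
      by (metis mult_nonpos_nonpos mult_nonneg_nonneg)
    then show ?thesis using right by (simp add: G_def W_def mult_ac)
  qed
  have Ga: "0 \<le> G \<alpha>"
  \<comment> \<open>At the end 0 it is p(0) = 0 and the factor s^n, rather than a zero of
    \<open>P\<close>, that make \<open>G\<close> vanish.\<close>
  proof (cases "\<alpha> = 0")
    case True then show ?thesis using n_pos by (simp add: G_def W_def flux_0 power_0_left)
  next
    case False
    then have l0: "poly P \<alpha> = 0" using left by simp
    have "0 \<le> x * poly (pderiv P) \<alpha>"
    proof (rule ccontr)
      assume "\<not> ?thesis"
      then obtain d where d: "d > 0" "\<And>h. 0 < h \<Longrightarrow> h < d \<Longrightarrow> x * poly P \<alpha> > x * poly P (\<alpha> + h)"
        using DERIV_neg_dec_right[OF DERIV_cmult[OF poly_DERIV[of P \<alpha>]], of x] by force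
      define h where "h = min (d/2) ((\<beta>' - \<alpha>)/2)"
      have "0 < h" "h < d" "\<alpha> + h < \<beta>'" using d(1) ab by (auto simp: h_def min_def field_simps)
      then show False using d(2)[of h] pos[of "\<alpha> + h"] l0 by auto
    qed
    moreover have "y * v \<alpha> \<le> 0" "0 \<le> \<alpha> ^ n * (1 - \<alpha>)" using negc[of \<alpha>] ab by auto
    ultimately have "(x * poly (pderiv P) \<alpha>) * (y * v \<alpha>) * (\<alpha> ^ n * (1 - \<alpha>)) \<le> 0"
      by (metis mult_nonneg_nonpos mult_nonpos_nonneg)
    then show ?thesis using l0 by (simp add: G_def W_def mult_ac)
  qed
  have v0: "v s = 0" if s: "\<alpha> < s" "s < \<beta>'" for s
  proof (rule ccontr)
    assume nz: "v s \<noteq> 0"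
    have "0 < s ^ (n - 1)" using s ab by simp
    from mult_pos_pos[OF mult_pos_pos[OF this pos[OF s]] sgn[OF s nz]]
    obtain d where d: "d > 0" "\<And>h. 0 < h \<Longrightarrow> h < d \<Longrightarrow> G s < G (s + h)"
      using DERIV_pos_inc_right[OF dG[OF s]] by blast
    define h where "h = min (d/2) ((\<beta>' - s)/2)"
    have "0 < h" "h < d" "s + h < \<beta>'" using d(1) s by (auto simp: h_def min_def field_simps)
    then show False using d(2)[of h] mono[of \<alpha> s] mono[of "s + h" \<beta>'] s Ga Gb by auto
  qed
  define s where "s = (\<alpha> + \<beta>') / 2"
  have s: "\<alpha> < s" "s < \<beta>'" "0 < s" "s < 1" using ab by (auto simp: s_def)
  have "((\<lambda>_. 1) has_real_derivative flux a s / (s ^ n * (1 - s))) (at s)"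
    by (rule has_field_derivative_transform_within_open[OF sol_deriv_flux, where S = "{\<alpha><..<\<beta>'}"])
      (use s v0 in \<open>auto simp: v_def\<close>)
  then have "flux a s / (s ^ n * (1 - s)) = 0" using DERIV_unique DERIV_const by blast
  then have "flux a s = 0" using s by simp
  then show False using equilibrium_unique_interior[OF F_1, of s a] s v0[of s] a by (simp add: v_def)
qed

text \<open>Before each of k + 1 successive zeros of the polynomial, W - 1 takes both signs.
  Choosing + - + ... and starting from a < 1, the mean value theorem yields k + 1 alternating signs
  of p, hence k sign changes. All this happens on [0, T] with \<open>T\<close> the last of these
  zeros, where \<open>W\<close> is uniformly close to 1.\<close>

theorem near_one_flux_alternates:
  assumes "0 < \<eta>" and F1: "\<And>u. 0 < \<bar>u - 1\<bar> \<Longrightarrow> \<bar>u - 1\<bar> < \<eta> \<Longrightarrow>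
      0 < (u - 1) * (\<kappa> * F u - real (Suc k) * (real (Suc k) + real n) * (u - 1))"
  shows "\<exists>a t. 0 < a \<and> a < 1 \<and> alternates (flux a) k t"
proof -
  define P where "P = jacobi (Suc k) n 1"
  define \<mu> where "\<mu> = real (Suc k) * (real (Suc k) + real n)"
  obtain z where z: "\<And>i. i < Suc k \<Longrightarrow> 0 < z i \<and> z i < 1 \<and> poly P (z i) = 0" "\<And>i. Suc i < Suc k \<Longrightarrow> z i < z (Suc i)"
    using jacobi_zeros[OF n_pos, of 1 "Suc k"] by (auto simp: P_def)
  have P0: "P \<noteq> 0" using jacobi_0_pos[OF n_pos, of "Suc k" 1] by (metis P_def poly_0 less_irrefl)
  have ode: "s * (1 - s) * poly (pderiv (pderiv P)) s + (real n - (real n + 1) * s) * poly (pderiv P) s + \<mu> * poly P s = 0" for s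
    using jacobi_ode[of s "Suc k" n 1] by (simp add: P_def \<mu>_def add_ac)
  define T where "T = z k"
  have T: "0 < T" "T < 1" using z(1)[of k] by (auto simp: T_def)
  have zT: "z i \<le> T" if "i \<le> k" for i
    using that unfolding T_def
  proof (induction rule: inc_induct)
    case (step i) then show ?case using z(2)[of i] by auto
  qed simp
  \<comment> \<open>Dependence on the initial value amplifies the deviation \<open>e\<close> from 1
    by at most 2 (1 - T) powr (-\<beta>); the product is at most \<eta> / 2.\<close>
  define e where "e = min (1/2) (\<eta> / (4 * (1 - T) powr (-\<beta>)))"
  have R: "0 < (1 - T) powr (-\<beta>)" using T by simp
  have e: "0 < e" "e < 1" "2 * e * (1 - T) powr (-\<beta>) < \<eta>"
  proof -
    show "0 < e" "e < 1" using R assms(1) by (auto simp: e_def)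
    have "2 * e * (1 - T) powr (-\<beta>) \<le> 2 * (\<eta> / (4 * (1 - T) powr (-\<beta>))) * (1 - T) powr (-\<beta>)"
      using R by (intro mult_right_mono mult_left_mono) (auto simp: e_def)
    also have "\<dots> = \<eta> / 2" using R by simp
    finally show "2 * e * (1 - T) powr (-\<beta>) < \<eta>" using assms(1) by simp
  qed
  define a where "a = 1 - e"
  have a: "0 < a" "a < 1" using e by (auto simp: a_def)
  have close: "\<bar>sol a s - 1\<bar> < \<eta>" if "0 \<le> s" "s \<le> T" for s
  proof -
    have "\<bar>sol a s - sol 1 s\<bar> \<le> 2 * \<bar>a - 1\<bar> * (1 - s) powr (-\<beta>)" using that T by (intro sol_dep) auto
    also have "\<dots> \<le> 2 * e * (1 - T) powr (-\<beta>)"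
      using that T beta_pos e by (intro mult_mono powr_mono2') (auto simp: a_def)
    also have "\<dots> < \<eta>" by (rule e)
    finally show ?thesis using sol_equilibrium[OF F_1, of s] that T by simp
  qed
  define l where "l i = (if i = 0 then 0 else z (i - 1))" for i
  have l: "0 \<le> l i" "l i < z i" if "i \<le> k" for i
    using z(1)[of i] z(1)[of "i - 1"] z(2)[of "i - 1"] that by (auto simp: l_def less_imp_le)
  have signs: "\<exists>s. l i < s \<and> s < z i \<and> 0 < y * (sol a s - 1)" if i: "i \<le> k" and y: "y = 1 \<or> y = -1" for i and y :: real
  proof -
    \<comment> \<open>A non-root \<open>u\<close> singles out a nodal interval inside (l i, z i),
      whether or not \<open>P\<close> has further zeros there.\<close>
    have "infinite ({l i<..<z i} - {x. poly P x = 0})"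
      using l[OF i] poly_roots_finite[OF P0] by (intro Diff_infinite_finite) (auto simp: infinite_Ioo)
    then have "{l i<..<z i} - {x. poly P x = 0} \<noteq> {}" by (metis finite.emptyI)
    then obtain u where "u \<in> {l i<..<z i} - {x. poly P x = 0}" by blast
    then have u: "l i < u" "u < z i" "poly P u \<noteq> 0" by auto
    define x where "x = sgn (poly P u)"
    have 1: "0 < x * poly P u" using u(3) by (simp add: x_def sgn_mult_abs abs_sgn_eq sgn_if)
    have 2: "x * poly P (z i) = 0" using z(1)[of i] i by simp
    have 3: "continuous_on {l i..z i} (\<lambda>s. x * poly P s)" by (intro continuous_intros)
    obtain \<alpha> b where ab: "l i \<le> \<alpha>" "\<alpha> < b" "b \<le> z i" "\<alpha> = l i \<or> x * poly P \<alpha> = 0" "x * poly P b = 0"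
      "\<And>s. \<alpha> < s \<Longrightarrow> s < b \<Longrightarrow> 0 < x * poly P s"
      using nodal_interval[OF 3 u(1,2) 1 2] by blast
    have x0: "x \<noteq> 0" using u by (simp add: x_def sgn_0_0)
    have "poly P (l i) = 0 \<or> l i = 0" using z(1)[of "i - 1"] i by (auto simp: l_def)
    then have "\<exists>s. \<alpha> < s \<and> s < b \<and> 0 < y * (sol a s - 1)"
      using ab x0 l[OF i] zT[OF i] T
      by (intro sturm_sign_change[OF a _ _ _ ode ab(6) _ _ close F1[folded \<mu>_def] y]) auto
    then show ?thesis using ab by (meson less_le_trans le_less_trans)
  qed
  have "\<forall>i. \<exists>s. i \<le> k \<longrightarrow> l i < s \<and> s < z i \<and> 0 < (-1) ^ i * (sol a s - 1)"
    using signs minus_one_power_iff by metis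
  then obtain s where s: "\<And>i. i \<le> k \<Longrightarrow> l i < s i \<and> s i < z i \<and> 0 < (-1) ^ i * (sol a (s i) - 1)" by metis
  have mvt: "\<exists>t. p < t \<and> t < q \<and> 0 < y * flux a t" if pq: "0 \<le> p" "p < q" "q < 1" "0 < y * (sol a q - sol a p)" for p q y
  proof -
    have "\<exists>d t. p < t \<and> t < q \<and> (sol a has_real_derivative d) (at t) \<and> sol a q - sol a p = (q - p) * d"
    proof (rule MVT[OF pq(2)])
      show "continuous_on {p..q} (sol a)" using pq by (intro continuous_on_subset[OF sol_continuous]) auto
      show "\<And>x. p < x \<Longrightarrow> x < q \<Longrightarrow> sol a differentiable at x"
        using sol_deriv_flux[of _ a] pq unfolding real_differentiable_def by (meson le_less_trans less_trans)
    qed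
    then obtain d t where t: "p < t" "t < q" "(sol a has_real_derivative d) (at t)" "sol a q - sol a p = (q - p) * d" by blast
    have d: "d = flux a t / (t ^ n * (1 - t))"
      using t pq by (intro DERIV_unique[OF t(3)] sol_deriv_flux) auto
    define w where "w = (q - p) / (t ^ n * (1 - t))"
    have "0 < w" unfolding w_def using t pq by (intro divide_pos_pos mult_pos_pos zero_less_power) auto
    moreover have "y * (sol a q - sol a p) = w * (y * flux a t)" using t(4) d by (simp add: w_def)
    ultimately have "0 < y * flux a t" using pq(4) zero_less_mult_pos by metis
    then show ?thesis using t by blast
  qed
  have s01: "0 < s i" "s i < 1" if "i \<le> k" for i using s[OF that] l[OF that] z(1)[of i] that by auto
  have "\<exists>t<s i. alternates (flux a) i t" if "i \<le> k" for i
    using that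
  proof (induction i)
    case 0
    have "0 < 1 * (sol a (s 0) - sol a 0)" using s[of 0] a by (simp add: sol_0)
    from mvt[OF _ _ _ this] obtain t where "0 < t" "t < s 0" "0 < 1 * flux a t" using s01[of 0] by auto
    then show ?case using s01[of 0] by (intro exI[of _ t]) auto
  next
    case (Suc i)
    then obtain t where t: "t < s i" "alternates (flux a) i t" by auto
    have lt: "s i < s (Suc i)" using s[of i] s[of "Suc i"] Suc.prems by (auto simp: l_def)
    have "0 < (-1) ^ Suc i * (sol a (s (Suc i)) - sol a (s i))"
      using s[of i] s[of "Suc i"] Suc.prems by (auto simp: algebra_simps)
    from mvt[OF _ lt _ this] obtain t' where t': "s i < t'" "t' < s (Suc i)" "0 < (-1) ^ Suc i * flux a t'"
      using s01[of i] s01[of "Suc i"] Suc.prems by auto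
    have "alternates (flux a) (Suc i) t'"
      unfolding alternates.simps using t t' s01[of i] s01[of "Suc i"] Suc.prems by (auto intro!: exI[of _ t])
    then show ?case using t' by blast
  qed
  then show ?thesis using a by blast
qed

end

section \<open>Regularity at the end points\<close>

text \<open>De l'Hospital twice: h' = s^(m-1) g gives the leading order of h, and (s^m g - m h)' =
  s^m g' the next one. It is applied to the flux, with m = n at s = 0 and m = 1 at s = 1; the second
  limit controls W''.\<close>

lemma quotient_limit_at_right_0:
  fixes h g g' :: "real \<Rightarrow> real"
  assumes "m \<ge> 1" and \<delta>: "0 < \<delta>"
    and dh: "\<And>s. 0 < s \<Longrightarrow> s < \<delta> \<Longrightarrow> (h has_real_derivative s ^ (m - 1) * g s) (at s)"
    and dg: "\<And>s. 0 < s \<Longrightarrow> s < \<delta> \<Longrightarrow> (g has_real_derivative g' s) (at s)"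
    and h0: "(h \<longlongrightarrow> 0) (at_right 0)" and g0: "(g \<longlongrightarrow> g0) (at_right 0)"
  shows "((\<lambda>s. h s / s ^ m) \<longlongrightarrow> g0 / real m) (at_right 0)"
    and "(g' \<longlongrightarrow> g1) (at_right 0) \<Longrightarrow>
      ((\<lambda>s. (g s - real m * (h s / s ^ m)) / s) \<longlongrightarrow> g1 / real (Suc m)) (at_right 0)"
proof -
  have ev: "\<forall>\<^sub>F s in at_right 0. s \<in> {0<..<\<delta>}" by (rule eventually_at_right_real[OF \<delta>])
  have pw: "((\<lambda>s::real. s ^ j) \<longlongrightarrow> 0) (at_right 0)" if "j \<ge> 1" for j
    using that by (auto intro!: tendsto_eq_intros)
  show 1: "((\<lambda>s. h s / s ^ m) \<longlongrightarrow> g0 / real m) (at_right 0)"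
  proof (rule lhopital_right_0[where f' = "\<lambda>s. s ^ (m - 1) * g s" and g' = "\<lambda>s. real m * s ^ (m - 1)"])
    show "((\<lambda>s. s ^ (m - 1) * g s / (real m * s ^ (m - 1))) \<longlongrightarrow> g0 / real m) (at_right 0)"
    proof (rule Lim_transform_eventually)
      show "((\<lambda>s. g s / real m) \<longlongrightarrow> g0 / real m) (at_right 0)" using assms(1) by (intro tendsto_intros g0) auto
      show "\<forall>\<^sub>F s in at_right 0. g s / real m = s ^ (m - 1) * g s / (real m * s ^ (m - 1))"
        using ev by eventually_elim (auto simp: field_simps)
    qed
    show "\<forall>\<^sub>F x in at_right 0. x ^ m \<noteq> (0::real)" using ev by eventually_elim auto
    show "\<forall>\<^sub>F x in at_right 0. real m * x ^ (m - 1) \<noteq> 0" using ev by eventually_elim (use assms(1) in auto)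
    show "\<forall>\<^sub>F x in at_right 0. (h has_real_derivative x ^ (m - 1) * g x) (at x)"
      using ev by eventually_elim (simp add: dh[simplified])
    show "\<forall>\<^sub>F x in at_right 0. ((\<lambda>s. s ^ m) has_real_derivative real m * x ^ (m - 1)) (at x)"
      by (intro always_eventually allI) (auto intro!: derivative_eq_intros)
  qed (use h0 pw assms(1) in auto)
  assume g1: "(g' \<longlongrightarrow> g1) (at_right 0)"
  have 2: "((\<lambda>s. (s ^ m * g s - real m * h s) / s ^ Suc m) \<longlongrightarrow> g1 / real (Suc m)) (at_right 0)"
  proof (rule lhopital_right_0[where f' = "\<lambda>s. s ^ m * g' s" and g' = "\<lambda>s. real (Suc m) * s ^ m"])
    have "((\<lambda>s. s ^ m * g s - real m * h s) \<longlongrightarrow> 0 * g0 - real m * 0) (at_right 0)"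
      by (intro tendsto_intros g0 h0 pw assms(1))
    then show "((\<lambda>s. s ^ m * g s - real m * h s) \<longlongrightarrow> 0) (at_right 0)" by simp
    show "((\<lambda>s. s ^ m * g' s / (real (Suc m) * s ^ m)) \<longlongrightarrow> g1 / real (Suc m)) (at_right 0)"
    proof (rule Lim_transform_eventually)
      show "((\<lambda>s. g' s / real (Suc m)) \<longlongrightarrow> g1 / real (Suc m)) (at_right 0)" by (intro tendsto_intros g1) auto
      show "\<forall>\<^sub>F s in at_right 0. g' s / real (Suc m) = s ^ m * g' s / (real (Suc m) * s ^ m)"
        using ev by eventually_elim auto
    qed
    show "\<forall>\<^sub>F x in at_right 0. x ^ Suc m \<noteq> (0::real)" using ev by eventually_elim auto
    show "\<forall>\<^sub>F x in at_right 0. real (Suc m) * x ^ m \<noteq> 0" using ev by eventually_elim auto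
    show "\<forall>\<^sub>F x in at_right 0. ((\<lambda>s. s ^ Suc m) has_real_derivative real (Suc m) * x ^ m) (at x)"
      by (intro always_eventually allI DERIV_cong[OF DERIV_pow]) simp
    show "\<forall>\<^sub>F x in at_right 0. ((\<lambda>s. s ^ m * g s - real m * h s) has_real_derivative x ^ m * g' x) (at x)"
      using ev
    proof eventually_elim
      case (elim x)
      then have x: "0 < x" "x < \<delta>" by auto
      show ?case
        by (rule DERIV_cong[OF DERIV_diff[OF DERIV_mult[OF DERIV_pow dg[OF x]] DERIV_cmult[OF dh[OF x]]]])
          (use assms(1) in simp)
    qed
    show "((\<lambda>s::real. s ^ Suc m) \<longlongrightarrow> 0) (at_right 0)" by (rule pw) simp
  qed
  show "((\<lambda>s. (g s - real m * (h s / s ^ m)) / s) \<longlongrightarrow> g1 / real (Suc m)) (at_right 0)"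
  proof (rule Lim_transform_eventually[OF 2])
    show "\<forall>\<^sub>F s in at_right 0. (s ^ m * g s - real m * h s) / s ^ Suc m = (g s - real m * (h s / s ^ m)) / s"
      using ev by eventually_elim (auto simp: field_simps)
  qed
qed

text \<open>The second derivative is continued by constants and integrated twice. An extension to
  the whole line spares one-sided derivatives at s = 0 and s = 1 when the profile is composed with a
  function on the sphere.\<close>

lemma C2_extension_from_unit_interval:
  fixes w w1 w2 :: "real \<Rightarrow> real"
  assumes dw: "\<And>s. 0 < s \<Longrightarrow> s < 1 \<Longrightarrow> (w has_real_derivative w1 s) (at s)"
    and dw1: "\<And>s. 0 < s \<Longrightarrow> s < 1 \<Longrightarrow> (w1 has_real_derivative w2 s) (at s)"
    and cont: "\<And>s. 0 < s \<Longrightarrow> s < 1 \<Longrightarrow> isCont w2 s"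
    and l0: "(w2 \<longlongrightarrow> \<omega>0) (at_right 0)" and l1: "(w2 \<longlongrightarrow> \<omega>1) (at_left 1)"
  shows "\<exists>W W1 W2. (\<forall>s. (W has_real_derivative W1 s) (at s)) \<and> (\<forall>s. (W1 has_real_derivative W2 s) (at s)) \<and>
    continuous_on UNIV W2 \<and> (\<forall>s. 0 < s \<and> s < 1 \<longrightarrow> W s = w s \<and> W1 s = w1 s \<and> W2 s = w2 s)"
proof -
  define g where "g s = (if s \<le> 0 then \<omega>0 else if 1 \<le> s then \<omega>1 else w2 s)" for s
  have anti: "\<exists>A. \<forall>x. (A has_real_derivative f x) (at x)" if "continuous_on UNIV f" for f :: "real \<Rightarrow> real"
    using einterval_antiderivative[of "-\<infinity>" "\<infinity>" f] that
    by (auto simp: continuous_on_eq_continuous_at has_real_derivative_iff_has_vector_derivative)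
  have g01: "continuous_on {0..1} g"
  proof (rule continuous_on_IccI)
    show "(g \<longlongrightarrow> g 0) (at_right 0)"
      by (rule Lim_transform_eventually[OF l0[THEN tendsto_eq_rhs]])
        (auto simp: g_def intro: eventually_mono[OF eventually_at_right_real[of 0 1]])
    show "(g \<longlongrightarrow> g 1) (at_left 1)"
      by (rule Lim_transform_eventually[OF l1[THEN tendsto_eq_rhs]])
        (auto simp: g_def intro: eventually_mono[OF eventually_at_left_real[of 0 1]])
    show "g \<midarrow>x\<rightarrow> g x" if x: "0 < x" "x < 1" for x
    proof -
      have "w2 \<midarrow>x\<rightarrow> w2 x" using cont[OF x] by (simp add: isCont_def)
      then have "w2 \<midarrow>x\<rightarrow> g x" using x by (simp add: g_def)
      then show ?thesis
        by (rule Lim_transform_within_open[where s = "{0<..<1}"]) (use x in \<open>auto simp: g_def\<close>)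
    qed
  qed simp
  define W2 where "W2 s = g (max 0 (min 1 s))" for s
  have cW2: "continuous_on UNIV W2" unfolding W2_def
    by (intro continuous_on_compose2[OF g01] continuous_intros) auto
  have W2: "W2 s = w2 s" if "0 < s" "s < 1" for s using that by (simp add: W2_def g_def)
  obtain A where A: "\<And>x. (A has_real_derivative W2 x) (at x)" using anti[OF cW2] by blast
  define W1 where "W1 s = A s - (A (1/2) - w1 (1/2))" for s
  have dW1: "(W1 has_real_derivative W2 s) (at s)" for s
    unfolding W1_def using A[of s] by (auto intro!: derivative_eq_intros)
  have W1: "W1 s = w1 s" if s: "0 < s" "s < 1" for s
  proof -
    have "(\<lambda>s. W1 s - w1 s) s = (\<lambda>s. W1 s - w1 s) (1/2)"
    proof (rule DERIV_isconst3[of 0 1 _ _ "\<lambda>s. W1 s - w1 s"])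
      fix x :: real assume "x \<in> {0<..<1}"
      then show "((\<lambda>s. W1 s - w1 s) has_real_derivative 0) (at x)"
        using DERIV_diff[OF dW1[of x] dw1[of x]] W2[of x] by simp
    qed (use s in auto)
    then show ?thesis by (simp add: W1_def)
  qed
  have "continuous_on UNIV W1" using dW1 DERIV_isCont by (auto simp: continuous_on_eq_continuous_at)
  then obtain B where B: "\<And>x. (B has_real_derivative W1 x) (at x)" using anti by blast
  define W where "W s = B s - (B (1/2) - w (1/2))" for s
  have dW: "(W has_real_derivative W1 s) (at s)" for s
    unfolding W_def using B[of s] by (auto intro!: derivative_eq_intros)
  have W: "W s = w s" if s: "0 < s" "s < 1" for s
  proof -
    have "(\<lambda>s. W s - w s) s = (\<lambda>s. W s - w s) (1/2)"
    proof (rule DERIV_isconst3[of 0 1 _ _ "\<lambda>s. W s - w s"])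
      fix x :: real assume "x \<in> {0<..<1}"
      then show "((\<lambda>s. W s - w s) has_real_derivative 0) (at x)"
        using DERIV_diff[OF dW[of x] dw[of x]] W1[of x] by simp
    qed (use s in auto)
    then show ?thesis by (simp add: W_def)
  qed
  show ?thesis using dW dW1 cW2 W W1 W2 by blast
qed

text \<open>The equation expresses W'' through \<open>W\<close> and W' with a factor 1 / (s (1 -
  s)), so only its limits at the two ends are in question. At 0 the numerator is rearranged into the
  quotients of \<open>quotient_limit_at_right_0\<close>; at 1 the reflection t = 1 - s and p(1) = 0
  lead to the same lemma.\<close>

lemma radial_solution_C2:
  fixes w p f f' :: "real \<Rightarrow> real"
  assumes n: "n \<ge> 1"
    and dw: "\<And>s. 0 < s \<Longrightarrow> s < 1 \<Longrightarrow> (w has_real_derivative p s / (s ^ n * (1 - s))) (at s)"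
    and dp: "\<And>s. 0 < s \<Longrightarrow> s < 1 \<Longrightarrow> (p has_real_derivative - \<kappa> * s ^ (n - 1) * f (w s)) (at s)"
    and p0: "(p \<longlongrightarrow> 0) (at_right 0)" and p1: "(p \<longlongrightarrow> 0) (at_left 1)"
    and w0: "(w \<longlongrightarrow> w0) (at_right 0)" and w1: "(w \<longlongrightarrow> w1) (at_left 1)"
    and pos: "0 < w0" "0 < w1" "\<And>s. 0 < s \<Longrightarrow> s < 1 \<Longrightarrow> 0 < w s"
    and df: "\<And>x. 0 < x \<Longrightarrow> (f has_real_derivative f' x) (at x)"
    and cf': "\<And>x. 0 < x \<Longrightarrow> isCont f' x"
  shows "\<exists>W W1 W2. (\<forall>s. (W has_real_derivative W1 s) (at s)) \<and> (\<forall>s. (W1 has_real_derivative W2 s) (at s)) \<and>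
    continuous_on UNIV W2 \<and> W 0 = w0 \<and>
    (\<forall>s. 0 \<le> s \<and> s \<le> 1 \<longrightarrow> 0 < W s \<and> s * (1 - s) * W2 s + (real n - (real n + 1) * s) * W1 s + \<kappa> * f (W s) = 0)"
proof -
  define v where "v s = p s / (s ^ n * (1 - s))" for s
  define \<omega> where "\<omega> s = (- (real n - (real n + 1) * s) * v s - \<kappa> * f (w s)) / (s * (1 - s))" for s
  have cont_f: "isCont f x" if "0 < x" for x using DERIV_isCont[OF df[OF that]] .
  have dfw: "((\<lambda>s. f (w s)) has_real_derivative f' (w s) * v s) (at s)" if s: "0 < s" "s < 1" for s
    using DERIV_chain2[OF df[OF pos(3)[OF s]] dw[OF s]] by (simp add: v_def)
  have dv: "(v has_real_derivative \<omega> s) (at s)" if s: "0 < s" "s < 1" for s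
  proof -
    have sn: "s ^ n = s * s ^ (n - 1)" using n by (simp add: power_eq_if)
    have d: "((\<lambda>s. s ^ n * (1 - s)) has_real_derivative real n * s ^ (n - 1) * (1 - s) + s ^ n * (- 1)) (at s)"
      by (auto intro!: derivative_eq_intros)
    have "(v has_real_derivative ((- \<kappa> * s ^ (n - 1) * f (w s)) * (s ^ n * (1 - s)) - p s * (real n * s ^ (n - 1) * (1 - s) + s ^ n * (- 1)))
        / ((s ^ n * (1 - s)) * (s ^ n * (1 - s)))) (at s)"
      unfolding v_def using s by (intro DERIV_divide dp d) auto
    moreover have "((- \<kappa> * s ^ (n - 1) * f (w s)) * (s ^ n * (1 - s)) - p s * (real n * s ^ (n - 1) * (1 - s) + s ^ n * (- 1)))
        / ((s ^ n * (1 - s)) * (s ^ n * (1 - s))) = \<omega> s"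
      unfolding \<omega>_def v_def sn using s by (simp add: divide_simps) (simp add: algebra_simps)
    ultimately show ?thesis by simp
  qed
  have cw: "isCont \<omega> s" if s: "0 < s" "s < 1" for s
    unfolding \<omega>_def using DERIV_isCont[OF dv[OF s]] DERIV_isCont[OF dfw[OF s]] s
    by (intro continuous_intros) auto
  have ev0: "\<forall>\<^sub>F s in at_right 0. s \<in> {0<..<(1::real)}" by (rule eventually_at_right_real) simp
  have fw0: "((\<lambda>s. f (w s)) \<longlongrightarrow> f w0) (at_right 0)" by (rule isCont_tendsto_compose[OF cont_f[OF pos(1)] w0])
  have fw0': "((\<lambda>s. f' (w s)) \<longlongrightarrow> f' w0) (at_right 0)" by (rule isCont_tendsto_compose[OF cf'[OF pos(1)] w0])
  have "\<exists>\<omega>0. (\<omega> \<longlongrightarrow> \<omega>0) (at_right 0)"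
  proof -
    define g where "g s = - \<kappa> * f (w s)" for s
    have dh: "(p has_real_derivative s ^ (n - 1) * g s) (at s)" if "0 < s" "s < 1" for s
      using dp[OF that] by (simp add: g_def mult_ac)
    have dg: "(g has_real_derivative - \<kappa> * (f' (w s) * v s)) (at s)" if "0 < s" "s < 1" for s
      unfolding g_def by (intro DERIV_cmult dfw that)
    have g0: "(g \<longlongrightarrow> - \<kappa> * f w0) (at_right 0)" unfolding g_def by (intro tendsto_intros fw0)
    have q: "((\<lambda>s. p s / s ^ n) \<longlongrightarrow> - \<kappa> * f w0 / real n) (at_right 0)"
      by (rule quotient_limit_at_right_0(1)[OF n zero_less_one _ _ p0 g0]) (erule (1) dh, erule (1) dg)
    define c where "c = - \<kappa> * f w0 / real n"
    have q1: "((\<lambda>s. p s / s ^ n) \<longlongrightarrow> c) (at_right 0)" using q by (simp add: c_def)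
    have "((\<lambda>s. (p s / s ^ n) / (1 - s)) \<longlongrightarrow> c / (1 - 0)) (at_right 0)"
      by (intro tendsto_intros q1) auto
    then have v0: "(v \<longlongrightarrow> c) (at_right 0)" by (simp add: v_def[abs_def])
    have g1: "((\<lambda>s. - \<kappa> * (f' (w s) * v s)) \<longlongrightarrow> - \<kappa> * (f' w0 * c)) (at_right 0)"
      by (intro tendsto_intros fw0' v0)
    have q2: "((\<lambda>s. (g s - real n * (p s / s ^ n)) / s) \<longlongrightarrow> - \<kappa> * (f' w0 * c) / real (Suc n)) (at_right 0)"
      by (rule quotient_limit_at_right_0(2)[OF n zero_less_one _ _ p0 g0 g1]) (erule (1) dh, erule (1) dg)
    have A: "((\<lambda>s. ((g s - real n * (p s / s ^ n)) / s + (p s / s ^ n) / (1 - s)) / (1 - s))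
      \<longlongrightarrow> (- \<kappa> * (f' w0 * c) / real (Suc n) + c / (1 - 0)) / (1 - 0)) (at_right 0)"
      by (intro tendsto_intros q1 q2) auto
    \<comment> \<open>Uses (n - (n + 1) s) / (1 - s) = n - s / (1 - s).\<close>
    have B: "\<forall>\<^sub>F s in at_right 0. ((g s - real n * (p s / s ^ n)) / s + (p s / s ^ n) / (1 - s)) / (1 - s) = \<omega> s"
      using ev0
    proof eventually_elim
      case (elim s)
      define r where "r = p s / s ^ n"
      have v: "v s = r / (1 - s)" by (simp add: v_def r_def)
      show ?case using elim unfolding \<omega>_def g_def r_def[symmetric] v by (simp add: divide_simps) (simp add: algebra_simps)
    qed
    from Lim_transform_eventually[OF A B] show ?thesis by (rule exI)
  qed
  then obtain \<omega>0 where \<omega>0: "(\<omega> \<longlongrightarrow> \<omega>0) (at_right 0)" by blast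
  have flip: "((\<lambda>t. r (1 - t)) \<longlongrightarrow> l) (at_right 0)" if "(r \<longlongrightarrow> l) (at_left 1)" for r :: "real \<Rightarrow> real" and l
  proof -
    have "filterlim (\<lambda>t. 1 - t) (at_left 1) (at_right (0::real))"
      unfolding filterlim_at by (auto intro!: tendsto_eq_intros simp: eventually_at_filter)
    from filterlim_compose[OF that this] show ?thesis .
  qed
  have unflip: "(r \<longlongrightarrow> l) (at_left 1)" if "((\<lambda>t. r (1 - t)) \<longlongrightarrow> l) (at_right 0)" for r :: "real \<Rightarrow> real" and l
  proof -
    have "filterlim (\<lambda>t. 1 - t) (at_right 0) (at_left (1::real))"
      unfolding filterlim_at by (auto intro!: tendsto_eq_intros simp: eventually_at_filter)
    from filterlim_compose[OF that this] show ?thesis by simp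
  qed
  have "\<exists>\<omega>1. (\<omega> \<longlongrightarrow> \<omega>1) (at_left 1)"
  proof -
    \<comment> \<open>Reflected flux; its derivative contains no vanishing power of t, so m =
      1.\<close>
    define h where "h t = p (1 - t)" for t
    define g where "g t = \<kappa> * (1 - t) ^ (n - 1) * f (w (1 - t))" for t
    define g' where "g' t = - (\<kappa> * (real (n - 1) * (1 - t) ^ (n - 1 - 1)) * f (w (1 - t)) + \<kappa> * (1 - t) ^ (n - 1) * (f' (w (1 - t)) * v (1 - t)))" for t
    have sub: "((\<lambda>t. 1 - t) has_real_derivative - 1) (at t)" for t :: real by (auto intro!: derivative_eq_intros)
    have dh: "(h has_real_derivative t ^ (1 - 1) * g t) (at t)" if t: "0 < t" "t < 1" for t
      unfolding h_def using DERIV_chain2[OF dp sub, of t] t by (simp add: g_def)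
    have dg: "(g has_real_derivative g' t) (at t)" if t: "0 < t" "t < 1" for t
    proof -
      have 1: "((\<lambda>t. \<kappa> * (1 - t) ^ (n - 1)) has_real_derivative \<kappa> * (real (n - 1) * (1 - t) ^ (n - 1 - 1) * - 1)) (at t)"
        by (auto intro!: derivative_eq_intros)
      have 2: "((\<lambda>t. f (w (1 - t))) has_real_derivative f' (w (1 - t)) * v (1 - t) * - 1) (at t)"
        using DERIV_chain2[OF dfw sub, of t] t by simp
      show ?thesis unfolding g_def by (rule DERIV_cong[OF DERIV_mult[OF 1 2]]) (simp add: g'_def algebra_simps)
    qed
    have h0: "(h \<longlongrightarrow> 0) (at_right 0)" unfolding h_def by (rule flip[OF p1])
    have wt: "((\<lambda>t. w (1 - t)) \<longlongrightarrow> w1) (at_right 0)" by (rule flip[OF w1])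
    have fw1: "((\<lambda>t. f (w (1 - t))) \<longlongrightarrow> f w1) (at_right 0)" by (rule isCont_tendsto_compose[OF cont_f[OF pos(2)] wt])
    have fw1': "((\<lambda>t. f' (w (1 - t))) \<longlongrightarrow> f' w1) (at_right 0)" by (rule isCont_tendsto_compose[OF cf'[OF pos(2)] wt])
    have "(g \<longlongrightarrow> \<kappa> * (1 - 0) ^ (n - 1) * f w1) (at_right 0)" unfolding g_def by (intro tendsto_intros fw1)
    then have g0: "(g \<longlongrightarrow> \<kappa> * f w1) (at_right 0)" by simp
    have q: "((\<lambda>t. h t / t ^ 1) \<longlongrightarrow> \<kappa> * f w1 / real 1) (at_right 0)"
      by (rule quotient_limit_at_right_0(1)[OF order_refl zero_less_one _ _ h0 g0]) (erule (1) dh, erule (1) dg)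
    have q1: "((\<lambda>t. h t / t) \<longlongrightarrow> \<kappa> * f w1) (at_right 0)" using q by simp
    have "((\<lambda>t. (h t / t) / (1 - t) ^ n) \<longlongrightarrow> \<kappa> * f w1 / (1 - 0) ^ n) (at_right 0)"
      by (intro tendsto_intros q1) auto
    then have v1: "((\<lambda>t. v (1 - t)) \<longlongrightarrow> \<kappa> * f w1) (at_right 0)" by (simp add: v_def[abs_def] h_def mult.commute)
    have g1: "(g' \<longlongrightarrow> - (\<kappa> * (real (n - 1) * (1 - 0) ^ (n - 1 - 1)) * f w1 + \<kappa> * (1 - 0) ^ (n - 1) * (f' w1 * (\<kappa> * f w1)))) (at_right 0)"
      unfolding g'_def by (intro tendsto_intros fw1 fw1' v1)
    obtain c where "((\<lambda>t. (g t - real 1 * (h t / t ^ 1)) / t) \<longlongrightarrow> c) (at_right 0)"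
      using quotient_limit_at_right_0(2)[OF order_refl zero_less_one dh dg h0 g0 g1] by blast
    then have c: "((\<lambda>t. (g t - h t / t) / t) \<longlongrightarrow> c) (at_right 0)" by simp
    have A: "((\<lambda>t. (- ((g t - h t / t) / t) + g t - (real n + 1) * (h t / t)) / (1 - t) ^ Suc n)
       \<longlongrightarrow> (- c + \<kappa> * f w1 - (real n + 1) * (\<kappa> * f w1)) / (1 - 0) ^ Suc n) (at_right 0)"
      by (intro tendsto_intros c g0 q1) auto
    have B: "\<forall>\<^sub>F t in at_right 0. (- ((g t - h t / t) / t) + g t - (real n + 1) * (h t / t)) / (1 - t) ^ Suc n = \<omega> (1 - t)"
      using ev0
    proof eventually_elim
      case (elim t)
      define r where "r = h t / t"
      define s where "s = 1 - t"
      define y where "y = s ^ (n - 1)"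
      have s: "0 < s" "t = 1 - s" "s < 1" using elim by (auto simp: s_def)
      have y: "s ^ n = s * y" "0 < y" unfolding y_def using n s(1) by (cases n; simp)+
      have "v s = r / s ^ n" using s by (simp add: v_def r_def h_def mult.commute)
      then have "\<omega> s = (- (real n - (real n + 1) * s) * (r / (s * y)) - \<kappa> * f (w s)) / (s * (1 - s))"
        by (simp add: \<omega>_def y)
      also have "\<dots> = (- ((\<kappa> * y * f (w s) - r) / (1 - s)) + \<kappa> * y * f (w s) - (real n + 1) * r) / (s * (s * y))"
        using s y by (simp add: divide_simps) (simp add: algebra_simps)
      also have "\<dots> = (- ((g t - h t / t) / t) + g t - (real n + 1) * (h t / t)) / (1 - t) ^ Suc n"
        unfolding g_def r_def s_def[symmetric] y_def[symmetric] s(2)[symmetric] using y by simp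
      finally show ?case by (simp add: s_def)
    qed
    from unflip[OF Lim_transform_eventually[OF A B]] show ?thesis by (rule exI)
  qed
  then obtain \<omega>1 where \<omega>1: "(\<omega> \<longlongrightarrow> \<omega>1) (at_left 1)" by blast
  have dw': "(w has_real_derivative v s) (at s)" if "0 < s" "s < 1" for s using dw[OF that] by (simp add: v_def)
  obtain W W1 W2 where W: "\<And>s. (W has_real_derivative W1 s) (at s)" "\<And>s. (W1 has_real_derivative W2 s) (at s)"
    "continuous_on UNIV W2" "\<And>s. 0 < s \<Longrightarrow> s < 1 \<Longrightarrow> W s = w s \<and> W1 s = v s \<and> W2 s = \<omega> s"
    using C2_extension_from_unit_interval[OF dw' dv cw \<omega>0 \<omega>1] by blast
  have cW: "continuous_on S W" "continuous_on S W1" "continuous_on S W2" for S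
    using DERIV_isCont[OF W(1)] DERIV_isCont[OF W(2)] continuous_on_subset[OF W(3)] by (auto intro!: continuous_at_imp_continuous_on)
  have W0: "W 0 = w0"
  proof (rule tendsto_unique)
    show "(W \<longlongrightarrow> W 0) (at_right 0)" using DERIV_isCont[OF W(1)[of 0]] by (auto simp: isCont_def intro: tendsto_within_subset)
    show "(W \<longlongrightarrow> w0) (at_right 0)"
      by (rule Lim_transform_eventually[OF w0]) (use ev0 W(4) in \<open>auto elim: eventually_mono\<close>)
  qed simp
  have W1: "W 1 = w1"
  proof (rule tendsto_unique)
    show "(W \<longlongrightarrow> W 1) (at_left 1)" using DERIV_isCont[OF W(1)[of 1]] by (auto simp: isCont_def intro: tendsto_within_subset)
    show "(W \<longlongrightarrow> w1) (at_left 1)"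
      by (rule Lim_transform_eventually[OF w1]) (use eventually_at_left_real[of 0 "1::real"] W(4) in \<open>auto elim: eventually_mono\<close>)
  qed simp
  have Wpos: "0 < W s" if "0 \<le> s" "s \<le> 1" for s
    using W(4)[of s] pos W0 W1 that by (cases "s = 0"; cases "s = 1") auto
  have cfW: "continuous_on {0..1} (\<lambda>s. f (W s))"
  proof (rule continuous_on_compose2[OF _ cW(1)])
    show "continuous_on {0<..} f" using cont_f by (intro continuous_at_imp_continuous_on) auto
  qed (use Wpos in auto)
  have "s * (1 - s) * W2 s + (real n - (real n + 1) * s) * W1 s + \<kappa> * f (W s) = 0" if "0 \<le> s" "s \<le> 1" for s
  proof (rule continuous_constant_on_closure[of "{0<..<1}" "\<lambda>s. s * (1 - s) * W2 s + (real n - (real n + 1) * s) * W1 s + \<kappa> * f (W s)"])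
    show "continuous_on (closure {0<..<1}) (\<lambda>s. s * (1 - s) * W2 s + (real n - (real n + 1) * s) * W1 s + \<kappa> * f (W s))"
      by (simp, intro continuous_intros cW cfW)
    show "x * (1 - x) * W2 x + (real n - (real n + 1) * x) * W1 x + \<kappa> * f (W x) = 0" if "x \<in> {0<..<1}" for x
    proof -
      have "x * (1 - x) * \<omega> x = - (real n - (real n + 1) * x) * v x - \<kappa> * f (w x)" using that by (simp add: \<omega>_def)
      then show ?thesis using W(4)[of x] that by (simp add: algebra_simps)
    qed
  qed (use that in auto)
  then show ?thesis using W(1,2,3) W0 Wpos by blast
qed

text \<open>Bootstrap with constants free of the clipping level. F \<ge> -1 gives p \<le> \<kappa>
  s^n, so \<open>W\<close> grows at most logarithmically, and F(W) is below a multiple of (1 -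
  s)^(-1/2). Integrating back from p(1) = 0 bounds p by a multiple of sqrt (1 - s), so W' has an
  integrable upper bound.\<close>

lemma (in shooting) sol_upper_bound:
  assumes FL: "\<And>x. -1 \<le> F x" and FU: "\<And>x. 0 < x \<Longrightarrow> F x \<le> x powr \<gamma>" and \<gamma>: "1 < \<gamma>"
    and a: "0 < a" "a < 1" and fl1: "flux a 1 = 0" and s: "0 \<le> s" "s < 1"
  shows "sol a s \<le> 1 + \<kappa> + 2 ^ (n + 2) * (\<kappa> * (1 + 2 * \<kappa> * \<gamma>) powr \<gamma>)"
proof -
  define K1 where "K1 = (1 + 2 * \<kappa> * \<gamma>) powr \<gamma>"
  have K1: "0 \<le> K1" by (simp add: K1_def)
  have pos: "0 < sol a r" if "0 \<le> r" "r < 1" for r using sol_pos[OF a fl1 that] .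
  have fl: "flux a r \<le> \<kappa> * r ^ n" if r: "0 \<le> r" "r < 1" for r
  proof -
    have "flux a r - flux a 0 \<le> \<kappa> * r ^ n - \<kappa> * 0 ^ n"
    proof (rule diff_le_of_deriv_le[where f' = "\<lambda>r. - \<kappa> * r ^ (n - 1) * F (sol a r)" and h' = "\<lambda>r. \<kappa> * (real n * r ^ (n - 1))"])
      fix x assume x: "0 < x" "x < r"
      \<comment> \<open>The loss from 1 to n makes the bound the exact derivative of \<kappa>
        r^n.\<close>
      have "- F (sol a x) \<le> real n" using FL[of "sol a x"] n_pos by linarith
      then have "(\<kappa> * x ^ (n - 1)) * - F (sol a x) \<le> (\<kappa> * x ^ (n - 1)) * real n"
        using x kappa_pos by (intro mult_left_mono) auto
      then show "- \<kappa> * x ^ (n - 1) * F (sol a x) \<le> \<kappa> * (real n * x ^ (n - 1))" by (simp add: mult_ac)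
      show "(flux a has_real_derivative - \<kappa> * x ^ (n - 1) * F (sol a x)) (at x)"
        using x r by (intro flux_deriv) auto
      show "((\<lambda>r. \<kappa> * r ^ n) has_real_derivative \<kappa> * (real n * x ^ (n - 1))) (at x)"
        by (intro DERIV_cmult DERIV_cong[OF DERIV_pow]) simp
    qed (use r in \<open>auto intro!: continuous_intros continuous_on_subset[OF flux_continuous]\<close>)
    then show ?thesis using n_pos by (simp add: flux_0 power_0_left)
  qed
  have w1: "sol a r \<le> 1 - \<kappa> * ln (1 - r)" if r: "0 \<le> r" "r < 1" for r
  proof -
    have "sol a r - sol a 0 \<le> - \<kappa> * ln (1 - r) - - \<kappa> * ln (1 - 0)"
    proof (rule diff_le_of_deriv_le[where f' = "\<lambda>r. flux a r / (r ^ n * (1 - r))" and h' = "\<lambda>r. \<kappa> / (1 - r)"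
          and h = "\<lambda>r. - \<kappa> * ln (1 - r)"])
      fix x assume x: "0 < x" "x < r"
      have "flux a x / (x ^ n * (1 - x)) \<le> \<kappa> * x ^ n / (x ^ n * (1 - x))"
        using fl[of x] x r by (intro divide_right_mono) auto
      then show "flux a x / (x ^ n * (1 - x)) \<le> \<kappa> / (1 - x)" using x by simp
      show "(sol a has_real_derivative flux a x / (x ^ n * (1 - x))) (at x)"
        using x r by (intro sol_deriv_flux) auto
      show "((\<lambda>r. - \<kappa> * ln (1 - r)) has_real_derivative \<kappa> / (1 - x)) (at x)"
        using x r by (auto intro!: derivative_eq_intros simp: field_simps)
    qed (use r in \<open>auto intro!: continuous_intros continuous_on_subset[OF sol_continuous]\<close>)
    then show ?thesis using a by (simp add: sol_0)
  qed
  have Fb: "F (sol a r) \<le> K1 * (1 - r) powr (- 1/2)" if r: "0 \<le> r" "r < 1" for r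
  proof -
    \<comment> \<open>The exponent gives t powr \<gamma> = (1 - r) powr (-1/2), which is integrable,
      while -ln (1 - r) = 2 \<gamma> ln t \<le> 2 \<gamma> t.\<close>
    define t where "t = (1 - r) powr (- 1 / (2 * \<gamma>))"
    have t1: "1 \<le> t" unfolding t_def using r \<gamma> powr_mono2'[of "- 1 / (2 * \<gamma>)" "1 - r" 1] by simp
    have "ln t = - 1 / (2 * \<gamma>) * ln (1 - r)" using r by (simp add: t_def ln_powr)
    then have "- ln (1 - r) = 2 * \<gamma> * ln t" using \<gamma> by simp
    also have "\<dots> \<le> 2 * \<gamma> * t" using \<gamma> t1 ln_le_minus_one[of t] by (intro mult_left_mono) auto
    finally have "\<kappa> * - ln (1 - r) \<le> \<kappa> * (2 * \<gamma> * t)" using kappa_pos by (intro mult_left_mono) auto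
    then have "sol a r \<le> (1 + 2 * \<kappa> * \<gamma>) * t" using w1[OF r] t1 by (simp add: algebra_simps)
    then have "sol a r powr \<gamma> \<le> ((1 + 2 * \<kappa> * \<gamma>) * t) powr \<gamma>"
      using pos[OF r] \<gamma> by (intro powr_mono2) auto
    also have "\<dots> = K1 * t powr \<gamma>" using t1 kappa_pos \<gamma> by (simp add: powr_mult K1_def)
    also have "t powr \<gamma> = (1 - r) powr (- 1/2)" using \<gamma> by (simp add: t_def powr_powr)
    finally show ?thesis using FU[OF pos[OF r]] by simp
  qed
  have fl2: "flux a r \<le> 2 * \<kappa> * K1 * sqrt (1 - r)" if r: "0 \<le> r" "r < 1" for r
  proof -
    have "- flux a 1 - - flux a r \<le> - (2 * \<kappa> * K1) * sqrt (1 - 1) - - (2 * \<kappa> * K1) * sqrt (1 - r)"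
    proof (rule diff_le_of_deriv_le[where f = "\<lambda>r. - flux a r" and f' = "\<lambda>r. - (- \<kappa> * r ^ (n - 1) * F (sol a r))"
          and h = "\<lambda>r. - (2 * \<kappa> * K1) * sqrt (1 - r)" and h' = "\<lambda>r. \<kappa> * (K1 * (1 - r) powr (- 1/2))"])
      fix x assume x: "r < x" "x < 1"
      have R: "0 \<le> K1 * (1 - x) powr (- 1/2)" using K1 by simp
      have "x ^ (n - 1) * F (sol a x) \<le> 1 * (K1 * (1 - x) powr (- 1/2))"
      proof (cases "0 \<le> F (sol a x)")
        case True
        then show ?thesis using x r Fb[of x] by (intro mult_mono power_le_one) auto
      next
        case False
        then have "x ^ (n - 1) * F (sol a x) \<le> 0" using x r by (intro mult_nonneg_nonpos) auto
        then show ?thesis using R by linarith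
      qed
      then have "\<kappa> * (x ^ (n - 1) * F (sol a x)) \<le> \<kappa> * (K1 * (1 - x) powr (- 1/2))"
        using kappa_pos by (intro mult_left_mono) auto
      then show "- (- \<kappa> * x ^ (n - 1) * F (sol a x)) \<le> \<kappa> * (K1 * (1 - x) powr (- 1/2))" by (simp add: mult_ac)
      show "((\<lambda>r. - flux a r) has_real_derivative - (- \<kappa> * x ^ (n - 1) * F (sol a x))) (at x)"
        using x r by (intro DERIV_minus flux_deriv) auto
      have "(1 - x) powr (- 1/2) = 1 / sqrt (1 - x)" using x by (simp add: powr_minus_divide powr_half_sqrt)
      then show "((\<lambda>r. - (2 * \<kappa> * K1) * sqrt (1 - r)) has_real_derivative \<kappa> * (K1 * (1 - x) powr (- 1/2))) (at x)"
        using x by (auto intro!: derivative_eq_intros simp: field_simps)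
    qed (use r in \<open>auto intro!: continuous_intros continuous_on_subset[OF flux_continuous]\<close>)
    then show ?thesis using fl1 by simp
  qed
  have half: "sol a r \<le> 1 + \<kappa>" if r: "0 \<le> r" "r \<le> 1/2" for r
  proof -
    have "ln (1 - r) \<ge> ln (1/2)" using r by (intro ln_mono) auto
    moreover have "ln (1/2::real) \<ge> -1" using ln_2_less_1 by (simp add: ln_div)
    ultimately have "\<kappa> * ln (1 - r) \<ge> \<kappa> * (-1)" using kappa_pos by (intro mult_left_mono) auto
    then show ?thesis using w1[of r] r by simp
  qed
  show ?thesis
  proof (cases "s \<le> 1/2")
    case True
    have "0 \<le> 2 ^ (n + 2) * (\<kappa> * K1)" using kappa_pos K1 by simp
    then show ?thesis using half[OF s(1) True] unfolding K1_def by linarith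
  next
    case False
    \<comment> \<open>2^n comes from x \<ge> 1/2, one factor 2 from \<open>fl2\<close>, the other
      from differentiating the square root.\<close>
    define R where "R = 2 ^ (n + 2) * (\<kappa> * K1)"
    have R0: "0 \<le> R" using kappa_pos K1 by (simp add: R_def)
    have "sol a s - sol a (1/2) \<le> - R * sqrt (1 - s) - - R * sqrt (1 - 1/2)"
    proof (rule diff_le_of_deriv_le[where f' = "\<lambda>r. flux a r / (r ^ n * (1 - r))" and h' = "\<lambda>r. R / (2 * sqrt (1 - r))"
          and h = "\<lambda>r. - R * sqrt (1 - r)"])
      fix x assume x: "1/2 < x" "x < s"
      have x1: "0 < 1 - x" using x s by simp
      have "(1/2) ^ n \<le> x ^ n" using x by (intro power_mono) auto
      then have "1 / x ^ n \<le> 2 ^ n" using x by (simp add: power_divide field_simps)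
      have "flux a x / (x ^ n * (1 - x)) \<le> 2 * \<kappa> * K1 * sqrt (1 - x) / (x ^ n * (1 - x))"
        using fl2[of x] x s by (intro divide_right_mono) auto
      also have "\<dots> = (2 * \<kappa> * K1 / sqrt (1 - x)) * (1 / x ^ n)"
      proof -
        define y where "y = sqrt (1 - x)"
        have "0 < y" "1 - x = y * y" using x1 by (auto simp: y_def)
        then show ?thesis unfolding y_def[symmetric] by (simp add: mult_ac)
      qed
      also have "\<dots> \<le> (2 * \<kappa> * K1 / sqrt (1 - x)) * 2 ^ n"
        using \<open>1 / x ^ n \<le> 2 ^ n\<close> kappa_pos K1 x1 by (intro mult_left_mono) auto
      also have "\<dots> = R / (2 * sqrt (1 - x))" by (simp add: R_def field_simps)
      finally show "flux a x / (x ^ n * (1 - x)) \<le> R / (2 * sqrt (1 - x))" .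
      show "(sol a has_real_derivative flux a x / (x ^ n * (1 - x))) (at x)"
        using x s by (intro sol_deriv_flux) auto
      show "((\<lambda>r. - R * sqrt (1 - r)) has_real_derivative R / (2 * sqrt (1 - x))) (at x)"
        using x1 by (auto intro!: derivative_eq_intros simp: field_simps)
    qed (use s False in \<open>auto intro!: continuous_intros continuous_on_subset[OF sol_continuous]\<close>)
    also have "\<dots> \<le> R"
    proof -
      have "0 \<le> R * sqrt (1 - s)" using R0 s by simp
      moreover have "R * sqrt (1 - 1/2) \<le> R * 1" using R0 by (intro mult_left_mono) auto
      ultimately show ?thesis by simp
    qed
    finally show ?thesis using half[of "1/2"] unfolding R_def K1_def by linarith
  qed
qed

section \<open>Profiles for the power nonlinearity\<close>

lemma clipped_power_reaction_shooting:
  fixes \<gamma> M \<kappa> :: real and n :: nat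
  assumes \<gamma>: "1 < \<gamma>" and M: "1 < M" and n: "n \<ge> 1" and \<kappa>: "0 < \<kappa>"
  defines "F \<equiv> \<lambda>x. (min M (max 0 x)) powr \<gamma> - min M (max 0 x)"
  shows "shooting n \<kappa> (M powr \<gamma> + M) (\<gamma> * M powr (\<gamma> - 1) + 1) F"
proof
  define f where "f x = x powr \<gamma> - x" for x
  have F: "F x = f (min M (max 0 x))" for x by (simp add: F_def f_def)
  have c0: "0 \<le> min M (max 0 x)" "min M (max 0 x) \<le> M" for x using M by auto
  have lip: "\<bar>f y - f x\<bar> \<le> (\<gamma> * M powr (\<gamma> - 1) + 1) * y - (\<gamma> * M powr (\<gamma> - 1) + 1) * x"
    if xy: "0 \<le> x" "x \<le> y" "y \<le> M" for x y
  proof (rule abs_diff_le_of_deriv_bound[where f' = "\<lambda>x. \<gamma> * x powr (\<gamma> - 1) - 1" and h' = "\<lambda>_. \<gamma> * M powr (\<gamma> - 1) + 1"])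
    show "continuous_on {x..y} f" unfolding f_def using xy \<gamma> by (intro continuous_intros continuous_on_powr') auto
    fix r assume r: "x < r" "r < y"
    show "(f has_real_derivative \<gamma> * r powr (\<gamma> - 1) - 1) (at r)"
      unfolding f_def using r xy by (auto intro!: derivative_eq_intros)
    have "r powr (\<gamma> - 1) \<le> M powr (\<gamma> - 1)" using r xy \<gamma> by (intro powr_mono2) auto
    then have "\<gamma> * r powr (\<gamma> - 1) \<le> \<gamma> * M powr (\<gamma> - 1)" using \<gamma> by (intro mult_left_mono) auto
    moreover have "0 \<le> \<gamma> * r powr (\<gamma> - 1)" using \<gamma> by simp
    ultimately show "\<bar>\<gamma> * r powr (\<gamma> - 1) - 1\<bar> \<le> \<gamma> * M powr (\<gamma> - 1) + 1" by linarith
  qed (use xy in \<open>auto intro!: derivative_eq_intros continuous_intros\<close>)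
  have L0: "0 < \<gamma> * M powr (\<gamma> - 1) + 1" using \<gamma> M by (simp add: add_nonneg_pos)
  show "0 < \<gamma> * M powr (\<gamma> - 1) + 1" by (rule L0)
  show "\<bar>F x - F y\<bar> \<le> (\<gamma> * M powr (\<gamma> - 1) + 1) * \<bar>x - y\<bar>" for x y
  proof -
    define u v where "u = min M (max 0 x)" and "v = min M (max 0 y)"
    have "\<bar>f u - f v\<bar> \<le> (\<gamma> * M powr (\<gamma> - 1) + 1) * \<bar>u - v\<bar>"
      using lip[of u v] lip[of v u] c0[of x] c0[of y]
      by (cases "u \<le> v") (auto simp: u_def[symmetric] v_def[symmetric] right_diff_distrib abs_minus_commute)
    also have "\<dots> \<le> (\<gamma> * M powr (\<gamma> - 1) + 1) * \<bar>x - y\<bar>"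
      using L0 by (intro mult_left_mono) (auto simp: u_def v_def)
    finally show ?thesis by (simp add: F u_def v_def)
  qed
  show "\<bar>F x\<bar> \<le> M powr \<gamma> + M" for x
  proof -
    have "(min M (max 0 x)) powr \<gamma> \<le> M powr \<gamma>" using c0[of x] \<gamma> by (intro powr_mono2) auto
    moreover have "0 \<le> (min M (max 0 x)) powr \<gamma>" by simp
    ultimately show ?thesis using c0[of x] unfolding F_def abs_le_iff by linarith
  qed
  show "F x < 0" if "0 < x" "x < 1" for x
    using powr_less_mono'[of x 1 \<gamma>] that \<gamma> M by (simp add: F_def)
  show "0 < F x" if "1 < x" for x
    using powr_less_mono[of 1 \<gamma> "min M x"] that \<gamma> M by (simp add: F_def)
  show "F x = 0" if "x \<le> 0" for x using that M by (simp add: F_def)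
  show "F 1 = 0" using M by (simp add: F_def)
qed (use n \<kappa> in auto)

definition radial_profile :: "nat \<Rightarrow> real \<Rightarrow> real \<Rightarrow> (real \<Rightarrow> real) \<Rightarrow> (real \<Rightarrow> real) \<Rightarrow> (real \<Rightarrow> real) \<Rightarrow> bool" where
  "radial_profile n \<kappa> q W W1 W2 \<longleftrightarrow>
    (\<forall>s. (W has_real_derivative W1 s) (at s)) \<and> (\<forall>s. (W1 has_real_derivative W2 s) (at s)) \<and>
    continuous_on UNIV W2 \<and>
    (\<forall>s. 0 \<le> s \<and> s \<le> 1 \<longrightarrow> 0 < W s \<and>
      s * (1 - s) * W2 s + (real n - (real n + 1) * s) * W1 s + \<kappa> * (W s powr (q - 1) - W s) = 0)"

theorem radial_profiles_exist:
  fixes n k :: nat and q \<kappa> :: real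
  assumes n: "n \<ge> 1" and q: "2 < q" and \<kappa>: "0 < \<kappa>" and k: "k \<ge> 1"
    and gap: "real k * (real k + real n) < \<kappa> * (q - 2)"
  shows "\<exists>W W1 W2 :: nat \<Rightarrow> real \<Rightarrow> real.
    (\<forall>j<k. radial_profile n \<kappa> q (W j) (W1 j) (W2 j)) \<and>
    (\<forall>i<k. \<forall>j<k. i \<noteq> j \<longrightarrow> W i 0 \<noteq> W j 0)"
proof -
  define \<gamma> where "\<gamma> = q - 1"
  have \<gamma>: "1 < \<gamma>" using q by (simp add: \<gamma>_def)
  define M0 where "M0 = 1 + \<kappa> + 2 ^ (n + 2) * (\<kappa> * (1 + 2 * \<kappa> * \<gamma>) powr \<gamma>)"
  \<comment> \<open>No circularity: \<open>M0\<close> depends only on n, \<kappa> and \<gamma>, and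
    bounds the solutions with p(1) = 0 for every clipping level.\<close>
  define M where "M = M0 + 1"
  have M: "1 < M" using \<kappa> by (simp add: M_def M0_def add_pos_nonneg)
  define f where "f x = x powr \<gamma> - x" for x
  define f' where "f' x = \<gamma> * x powr (\<gamma> - 1) - 1" for x
  define F where "F x = (min M (max 0 x)) powr \<gamma> - min M (max 0 x)" for x
  have Ff: "F x = f x" if "0 \<le> x" "x \<le> M" for x using that by (simp add: F_def f_def)
  interpret shooting n \<kappa> "M powr \<gamma> + M" "\<gamma> * M powr (\<gamma> - 1) + 1" F
    unfolding F_def[abs_def] by (rule clipped_power_reaction_shooting[OF \<gamma> M n \<kappa>])
  have df: "(f has_real_derivative f' x) (at x)" if "0 < x" for x
    unfolding f_def f'_def using that by (auto intro!: derivative_eq_intros)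
  have cf': "isCont f' x" if "0 < x" for x
    unfolding f'_def using that by (intro continuous_intros) auto
  have FL: "-1 \<le> F x" for x
  proof (cases "x \<le> 1")
    case True
    have "0 \<le> (min M (max 0 x)) powr \<gamma>" by simp
    then show ?thesis using True M unfolding F_def by linarith
  next
    case False then show ?thesis using F_pos[of x] by simp
  qed
  have FU: "F x \<le> x powr \<gamma>" if "0 < x" for x
  proof -
    have "(min M (max 0 x)) powr \<gamma> \<le> x powr \<gamma>" using that M \<gamma> by (intro powr_mono2) auto
    then show ?thesis using that M unfolding F_def by linarith
  qed
  obtain k' where k': "k = Suc k'" using k by (cases k) auto
  define \<mu> where "\<mu> = real k * (real k + real n)"
  \<comment> \<open>The lower bound on \<open>lam\<close> enters here: the slope of \<open>f\<close>
    at 1 is q - 2, and \<open>gap\<close> says \<mu> < \<kappa> (q - 2).\<close>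
  have lin: "\<exists>\<eta>>0. \<forall>u. 0 < \<bar>u - 1\<bar> \<and> \<bar>u - 1\<bar> < \<eta> \<longrightarrow> 0 < (u - 1) * (\<kappa> * F u - \<mu> * (u - 1))"
  proof -
    have "((\<lambda>u. (f u - f 1) / (u - 1)) \<longlongrightarrow> f' 1) (at 1)"
      using df[of 1] by (simp add: has_field_derivative_iff)
    moreover have "f' 1 = q - 2" by (simp add: f'_def \<gamma>_def)
    moreover have "\<mu> / \<kappa> < q - 2" using gap \<kappa> by (simp add: \<mu>_def field_simps)
    ultimately have "\<forall>\<^sub>F u in at 1. \<mu> / \<kappa> < (f u - f 1) / (u - 1)" by (intro order_tendstoD(1)) auto
    then obtain d where d: "d > 0" "\<And>u. u \<noteq> 1 \<Longrightarrow> dist u 1 < d \<Longrightarrow> \<mu> / \<kappa> < (f u - f 1) / (u - 1)"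
      by (auto simp: eventually_at)
    define \<eta> where "\<eta> = min d (min 1 (M - 1))"
    have "0 < (u - 1) * (\<kappa> * F u - \<mu> * (u - 1))" if u: "0 < \<bar>u - 1\<bar>" "\<bar>u - 1\<bar> < \<eta>" for u
    proof -
      have "F u = f u" using u by (intro Ff) (auto simp: \<eta>_def)
      have "\<mu> / \<kappa> < f u / (u - 1)" using d(2)[of u] u by (auto simp: \<eta>_def dist_real_def f_def)
      then have "0 < \<kappa> * (f u / (u - 1) - \<mu> / \<kappa>)" using \<kappa> by simp
      then have "0 < (u - 1)\<^sup>2 * (\<kappa> * (f u / (u - 1) - \<mu> / \<kappa>))" using u by (intro mult_pos_pos[OF _ \<open>0 < \<kappa> * (f u / (u - 1) - \<mu> / \<kappa>)\<close>]) auto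
      also have "\<dots> = (u - 1) * (\<kappa> * f u - \<mu> * (u - 1))"
      proof -
        define d where "d = u - 1"
        have "d \<noteq> 0" using u by (auto simp: d_def)
        then show ?thesis unfolding d_def[symmetric] using \<kappa> by (simp add: power2_eq_square field_simps)
      qed
      finally show ?thesis by (simp add: \<open>F u = f u\<close>)
    qed
    moreover have "\<eta> > 0" using d M by (auto simp: \<eta>_def)
    ultimately show ?thesis by blast
  qed
  then obtain \<eta> where \<eta>: "\<eta> > 0" "\<And>u. 0 < \<bar>u - 1\<bar> \<Longrightarrow> \<bar>u - 1\<bar> < \<eta> \<Longrightarrow> 0 < (u - 1) * (\<kappa> * F u - \<mu> * (u - 1))"
    by blast
  \<comment> \<open>k' = k - 1: the polynomial of degree k gives k alternating signs of p, that is,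
    k' sign changes.\<close>
  obtain a0 t0 where a0: "0 < a0" "a0 < 1" "alternates (flux a0) k' t0"
    using near_one_flux_alternates[OF \<eta>(1), of k'] \<eta>(2) by (auto simp: \<mu>_def k')
  obtain \<alpha> where \<alpha>: "\<And>j. 1 \<le> j \<and> j \<le> k' \<Longrightarrow> 0 < \<alpha> j \<and> \<alpha> j < 1 \<and> flux (\<alpha> j) 1 = 0 \<and> (\<forall>i. 1 \<le> i \<and> i < j \<longrightarrow> \<alpha> i < \<alpha> j)"
    using shooting_values_exist[OF a0] by blast
  define good where "good a W W1 W2 \<longleftrightarrow> (\<forall>s. (W has_real_derivative W1 s) (at s)) \<and> (\<forall>s. (W1 has_real_derivative W2 s) (at s)) \<and>
    continuous_on UNIV W2 \<and> W 0 = a \<and>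
    (\<forall>s. 0 \<le> s \<and> s \<le> 1 \<longrightarrow> 0 < W s \<and> s * (1 - s) * W2 s + (real n - (real n + 1) * s) * W1 s + \<kappa> * f (W s) = 0)"
    for a :: real and W W1 W2 :: "real \<Rightarrow> real"
  have ex: "\<exists>W W1 W2. good a W W1 W2" if a: "0 < a" "a < 1" and z: "flux a 1 = 0" for a
  proof -
    have pos: "0 < sol a s" if "0 \<le> s" "s < 1" for s using sol_pos[OF a z that] .
    have ub: "sol a s \<le> M0" if "0 \<le> s" "s < 1" for s
      unfolding M0_def using sol_upper_bound[OF FL FU \<gamma> a z that] .
    obtain l where l: "(sol a \<longlongrightarrow> l) (at_left 1)" using sol_limit_at_1[OF z] by blast
    \<comment> \<open>A limit of positive values could vanish; equilibria are excluded as end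
      values, which leaves l > 0.\<close>
    have "F l \<noteq> 0" using equilibrium_unique_end[OF z l] F_neg[OF a] by auto
    then have l0: "0 < l" using F_le_0[of l] by (cases "l \<le> 0") auto
    have at0: "at (0::real) within {0..<1} = at_right 0" by (rule at_within_nhd[of _ "{-1<..<1}"]) auto
    have "(sol a \<longlongrightarrow> sol a 0) (at 0 within {0..<1})"
      using sol_continuous[of a] by (simp add: continuous_on_def)
    then have w0: "(sol a \<longlongrightarrow> a) (at_right 0)" by (simp add: at0 sol_0)
    have p0: "(flux a \<longlongrightarrow> 0) (at_right 0)"
      using flux_continuous[of a] flux_0[of a] at_within_Icc_at_right[of 0 "1::real"]
      unfolding continuous_on_def by (metis atLeastAtMost_iff order_refl zero_less_one less_imp_le)
    have p1: "(flux a \<longlongrightarrow> 0) (at_left 1)"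
      using flux_continuous[of a] z at_within_Icc_at_left[of 0 "1::real"]
      unfolding continuous_on_def by (metis atLeastAtMost_iff order_refl zero_less_one less_imp_le)
    \<comment> \<open>Since 0 < W \<le> M0 < M, the clipped reaction agrees with the true one along
      the solution.\<close>
    have dp: "(flux a has_real_derivative - \<kappa> * s ^ (n - 1) * f (sol a s)) (at s)" if s: "0 < s" "s < 1" for s
      using flux_deriv[OF s, of a] Ff[of "sol a s"] pos[of s] ub[of s] s by (simp add: M_def)
    show ?thesis unfolding good_def
      using radial_solution_C2[OF n sol_deriv_flux dp p0 p1 w0 l a(1) l0 pos[OF less_imp_le] df cf'] by blast
  qed
  have "\<exists>T. \<forall>j. 1 \<le> j \<and> j \<le> k' \<longrightarrow> (case T j of (W, W1, W2) \<Rightarrow> good (\<alpha> j) W W1 W2)"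
  proof (rule choice, rule allI)
    fix j show "\<exists>T. 1 \<le> j \<and> j \<le> k' \<longrightarrow> (case T of (W, W1, W2) \<Rightarrow> good (\<alpha> j) W W1 W2)"
      using ex[of "\<alpha> j"] \<alpha>[of j] by fastforce
  qed
  then obtain T where T: "\<And>j. 1 \<le> j \<and> j \<le> k' \<Longrightarrow> good (\<alpha> j) (fst (T j)) (fst (snd (T j))) (snd (snd (T j)))"
    by (auto simp: case_prod_unfold)
  \<comment> \<open>Index 0 is the constant solution; the values 1 and \<alpha> j < 1 at s = 0 tell
    the profiles apart.\<close>
  define W W1 W2 where "W j = (if j = 0 then (\<lambda>_. 1) else fst (T j))"
    and "W1 j = (if j = 0 then (\<lambda>_. 0) else fst (snd (T j)))"
    and "W2 j = (if j = 0 then (\<lambda>_. 0) else snd (snd (T j)))" for j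
  have g: "good (if j = 0 then 1 else \<alpha> j) (W j) (W1 j) (W2 j)" if "j < k" for j
  proof (cases "j = 0")
    case True then show ?thesis by (simp add: good_def W_def W1_def W2_def f_def)
  next
    case False then show ?thesis using T[of j] that k' by (simp add: W_def W1_def W2_def)
  qed
  have ne: "W i 0 \<noteq> W j 0" if "i < j" "j < k" for i j
  proof -
    have "W i 0 = (if i = 0 then 1 else \<alpha> i)" "W j 0 = \<alpha> j"
      using g[of i] g[of j] that by (auto simp: good_def)
    moreover have "\<alpha> j < 1" "i \<noteq> 0 \<Longrightarrow> \<alpha> i < \<alpha> j" using \<alpha>[of j] that k' by auto
    ultimately show ?thesis by (cases "i = 0") auto
  qed
  have "W i 0 \<noteq> W j 0" if "i < k" "j < k" "i \<noteq> j" for i j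
    using ne[of i j] ne[of j i] that by (cases "i < j") auto
  moreover have "radial_profile n \<kappa> q (W j) (W1 j) (W2 j)" if "j < k" for j
    using g[OF that] by (simp add: good_def radial_profile_def f_def \<gamma>_def)
  ultimately show ?thesis by blast
qed

section \<open>From profiles to functions on the sphere\<close>

text \<open>The inner product turns the gradient into the operator-valued derivatives of
  \<open>C2_on\<close>; in finite dimension, continuity of the Hessian may be tested on fixed
  vectors.\<close>

lemma C2_on_of_gradient:
  fixes F :: "'a::euclidean_space \<Rightarrow> real" and G :: "'a \<Rightarrow> 'a"
  assumes dF: "\<And>x. x \<in> S \<Longrightarrow> (F has_derivative (\<lambda>v. G x \<bullet> v)) (at x)"
    and dG: "\<And>x. x \<in> S \<Longrightarrow> (G has_derivative G' x) (at x)"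
    and cont: "\<And>v. continuous_on S (\<lambda>x. G' x v)"
  shows "C2_on S F"
proof -
  define D1 where "D1 x = blinfun_inner_right (G x)" for x
  define D2 where "D2 x = Blinfun (\<lambda>v. blinfun_inner_right (G' x v))" for x
  have bl: "bounded_linear (\<lambda>v. blinfun_inner_right (G' x v))" if "x \<in> S" for x
    using bounded_linear_compose[OF bounded_linear_blinfun_inner_right has_derivative_bounded_linear[OF dG[OF that]]] .
  have D2: "blinfun_apply (D2 x) = (\<lambda>v. blinfun_inner_right (G' x v))" if "x \<in> S" for x
    unfolding D2_def by (rule bounded_linear_Blinfun_apply[OF bl[OF that]])
  have 1: "(F has_derivative blinfun_apply (D1 x)) (at x)" if "x \<in> S" for x
    using dF[OF that] by (simp add: D1_def)
  have 2: "(D1 has_derivative blinfun_apply (D2 x)) (at x)" if "x \<in> S" for x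
    unfolding D2[OF that] D1_def
    by (rule bounded_linear.has_derivative[OF bounded_linear_blinfun_inner_right dG[OF that]])
  have "continuous_on S D2"
  proof (rule continuous_on_blinfun_componentwise)
    fix i :: 'a
    have "continuous_on S (\<lambda>x. blinfun_inner_right (G' x i))"
      by (rule bounded_linear.continuous_on[OF bounded_linear_blinfun_inner_right cont])
    then show "continuous_on S (\<lambda>x. blinfun_apply (D2 x) i)"
      by (rule continuous_on_eq) (simp add: D2)
  qed
  with 1 2 show ?thesis unfolding C2_on_def by blast
qed

lemma euclid_laplacian_of_gradient:
  fixes F :: "'a::euclidean_space \<Rightarrow> real" and G :: "'a \<Rightarrow> 'a"
  assumes S: "open S" "x \<in> S"
    and dF: "\<And>x. x \<in> S \<Longrightarrow> (F has_derivative (\<lambda>v. G x \<bullet> v)) (at x)"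
    and dG: "(G has_derivative G') (at x)"
  shows "euclid_laplacian F x = (\<Sum>b\<in>Basis. G' b \<bullet> b)"
  unfolding euclid_laplacian_def
proof (rule sum.cong[OF refl])
  fix b :: 'a
  have line: "((\<lambda>t. x + t *\<^sub>R b) has_derivative (\<lambda>h. h *\<^sub>R b)) (at t)" for t
    by (auto intro!: derivative_eq_intros)
  have 1: "deriv (\<lambda>t. F (x + t *\<^sub>R b)) t = G (x + t *\<^sub>R b) \<bullet> b" if "x + t *\<^sub>R b \<in> S" for t
  proof (rule DERIV_imp_deriv)
    have "((\<lambda>t. F (x + t *\<^sub>R b)) has_derivative (\<lambda>h. G (x + t *\<^sub>R b) \<bullet> (h *\<^sub>R b))) (at t)"
      by (rule has_derivative_compose[OF line dF[OF that]])
    then show "((\<lambda>t. F (x + t *\<^sub>R b)) has_real_derivative G (x + t *\<^sub>R b) \<bullet> b) (at t)"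
      unfolding has_field_derivative_def by (rule has_derivative_eq_rhs) (auto simp: fun_eq_iff)
  qed
  \<comment> \<open>The outer \<open>deriv\<close> at 0 requires the formula for the inner one in a
    whole neighbourhood of 0.\<close>
  have "\<forall>\<^sub>F t in nhds 0. x + t *\<^sub>R b \<in> S"
  proof (rule eventually_compose_filterlim[OF eventually_nhds_in_open[OF S]])
    have "((\<lambda>t. x + t *\<^sub>R b) \<longlongrightarrow> x + 0 *\<^sub>R b) (nhds 0)" by (intro tendsto_intros filterlim_ident)
    then show "((\<lambda>t. x + t *\<^sub>R b) \<longlongrightarrow> x) (nhds 0)" by simp
  qed
  then have "\<forall>\<^sub>F t in nhds 0. deriv (\<lambda>t. F (x + t *\<^sub>R b)) t = G (x + t *\<^sub>R b) \<bullet> b"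
    by eventually_elim (rule 1)
  then have "deriv (deriv (\<lambda>t. F (x + t *\<^sub>R b))) 0 = deriv (\<lambda>t. G (x + t *\<^sub>R b) \<bullet> b) 0"
    by (rule deriv_cong_ev) simp
  also have "\<dots> = G' b \<bullet> b"
  proof (rule DERIV_imp_deriv)
    have g: "((\<lambda>t. G (x + t *\<^sub>R b)) has_derivative (\<lambda>h. G' (h *\<^sub>R b))) (at 0)"
      by (rule has_derivative_compose[OF line]) (use dG in simp)
    have "linear G'" using has_derivative_linear[OF dG] .
    have "((\<lambda>t. G (x + t *\<^sub>R b) \<bullet> b) has_derivative (\<lambda>h. G' (h *\<^sub>R b) \<bullet> b)) (at 0)"
      by (rule has_derivative_inner_left[OF g])
    then show "((\<lambda>t. G (x + t *\<^sub>R b) \<bullet> b) has_real_derivative G' b \<bullet> b) (at 0)"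
      unfolding has_field_derivative_def
      by (rule has_derivative_eq_rhs) (auto simp: fun_eq_iff linear_scale[OF \<open>linear G'\<close>])
  qed
  finally show "deriv (deriv (\<lambda>t. F (x + t *\<^sub>R b))) 0 = G' b \<bullet> b" .
qed

section \<open>Functions of a projection ratio and their Laplacian\<close>

locale projection_profile =
  fixes P :: "'a::euclidean_space \<Rightarrow> 'a" and W W1 W2 :: "real \<Rightarrow> real"
  assumes P_bl: "bounded_linear P" and P_adj: "\<And>x y. P x \<bullet> y = x \<bullet> P y" and P_idem: "\<And>x. P (P x) = P x"
    and dW: "\<And>s. (W has_real_derivative W1 s) (at s)"
    and dW1: "\<And>s. (W1 has_real_derivative W2 s) (at s)"
    and cW2: "continuous_on UNIV W2"
begin

text \<open>Homogeneous of degree 0: the radially constant extension of s from the unit sphere, to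
  match \<open>ext0\<close>.\<close>

definition \<phi> :: "'a \<Rightarrow> real" where "\<phi> x = 1 - (P x \<bullet> x) / (x \<bullet> x)"

definition grad :: "'a \<Rightarrow> 'a" where
  "grad x = (- 2 / (x \<bullet> x)) *\<^sub>R P x + (2 * (P x \<bullet> x) / (x \<bullet> x)\<^sup>2) *\<^sub>R x"

definition grad' :: "'a \<Rightarrow> 'a \<Rightarrow> 'a" where
  "grad' x v = (4 * (x \<bullet> v) / (x \<bullet> x)\<^sup>2) *\<^sub>R P x + (- 2 / (x \<bullet> x)) *\<^sub>R P v
    + (4 * (P x \<bullet> v) / (x \<bullet> x)\<^sup>2 - 8 * (P x \<bullet> x) * (x \<bullet> v) / (x \<bullet> x) ^ 3) *\<^sub>R x
    + (2 * (P x \<bullet> x) / (x \<bullet> x)\<^sup>2) *\<^sub>R v"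

definition G' :: "'a \<Rightarrow> 'a \<Rightarrow> 'a" where
  "G' x v = (W2 (\<phi> x) * (grad x \<bullet> v)) *\<^sub>R grad x + W1 (\<phi> x) *\<^sub>R grad' x v"

lemma dP: "(P has_derivative P) (at x)"
  by (rule bounded_linear.has_derivative[OF P_bl has_derivative_ident, simplified])

lemma dnorm: "((\<lambda>x. x \<bullet> x) has_derivative (\<lambda>v. 2 * (x \<bullet> v))) (at (x::'a))"
  by (auto intro!: derivative_eq_intros simp: inner_commute)

lemma dquad: "((\<lambda>x. P x \<bullet> x) has_derivative (\<lambda>v. 2 * (P x \<bullet> v))) (at x)"
proof -
  have "P v \<bullet> x = P x \<bullet> v" for v using P_adj[of v x] by (simp add: inner_commute)
  then show ?thesis
    by (intro has_derivative_eq_rhs[OF has_derivative_inner[OF dP has_derivative_ident]]) (auto simp: fun_eq_iff)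
qed

lemma dphi:
  assumes "x \<noteq> 0"
  shows "(\<phi> has_derivative (\<lambda>v. grad x \<bullet> v)) (at x)"
proof -
  have n0: "x \<bullet> x \<noteq> 0" using assms by simp
  define N r where "N = x \<bullet> x" and "r = P x \<bullet> x"
  have "N \<noteq> 0" using n0 by (simp add: N_def)
  then have "0 - (- r * (inverse N * (2 * (x \<bullet> v)) * inverse N) + 2 * (P x \<bullet> v) / N) = grad x \<bullet> v" for v
    unfolding grad_def N_def[symmetric] r_def[symmetric] inner_add_left inner_scaleR_left
    by (simp add: power2_eq_square field_simps)
  then show ?thesis unfolding \<phi>_def[abs_def]
    by (intro has_derivative_eq_rhs[OF has_derivative_diff[OF has_derivative_const has_derivative_divide[OF dquad dnorm n0]]])
      (simp only: N_def r_def fun_eq_iff simp_thms)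
qed

lemma dgrad:
  assumes "x \<noteq> 0"
  shows "(grad has_derivative grad' x) (at x)"
proof -
  define N where "N = x \<bullet> x"
  have n0: "x \<bullet> x \<noteq> 0" and N0: "N \<noteq> 0" using assms by (auto simp: N_def)
  have sq: "((\<lambda>x. (x \<bullet> x)\<^sup>2) has_derivative (\<lambda>v. 2 * (x \<bullet> x) * (2 * (x \<bullet> v)))) (at x)"
    by (rule has_derivative_eq_rhs[OF has_derivative_power[OF dnorm]]) (auto simp: fun_eq_iff)
  have sq0: "(x \<bullet> x)\<^sup>2 \<noteq> 0" using n0 by simp
  have a: "((\<lambda>x. - 2 / (x \<bullet> x)) has_derivative (\<lambda>v. 4 * (x \<bullet> v) / (x \<bullet> x)\<^sup>2)) (at x)"
    by (rule has_derivative_eq_rhs[OF has_derivative_divide[OF has_derivative_const dnorm n0]])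
      (use n0 in \<open>auto simp: fun_eq_iff power2_eq_square divide_simps\<close>)
  have c: "((\<lambda>x. 2 * (P x \<bullet> x) / (x \<bullet> x)\<^sup>2) has_derivative
      (\<lambda>v. 4 * (P x \<bullet> v) / (x \<bullet> x)\<^sup>2 - 8 * (P x \<bullet> x) * (x \<bullet> v) / (x \<bullet> x) ^ 3)) (at x)"
    by (rule has_derivative_eq_rhs[OF has_derivative_divide[OF has_derivative_mult_right[OF dquad] sq sq0]])
      (unfold N_def[symmetric], use N0 in \<open>auto simp: fun_eq_iff power2_eq_square power3_eq_cube field_simps\<close>)
  show ?thesis unfolding grad_def[abs_def]
    by (rule has_derivative_eq_rhs[OF has_derivative_add[OF has_derivative_scaleR[OF a dP] has_derivative_scaleR[OF c has_derivative_ident]]])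
      (auto simp: grad'_def fun_eq_iff)
qed

lemma dF:
  assumes "x \<noteq> 0"
  shows "((\<lambda>x. W (\<phi> x)) has_derivative (\<lambda>v. (W1 (\<phi> x) *\<^sub>R grad x) \<bullet> v)) (at x)"
  by (rule has_derivative_eq_rhs[OF DERIV_compose_FDERIV[OF dW dphi[OF assms]]])
    (auto simp: fun_eq_iff)

lemma dG:
  assumes "x \<noteq> 0"
  shows "((\<lambda>x. W1 (\<phi> x) *\<^sub>R grad x) has_derivative G' x) (at x)"
  by (rule has_derivative_eq_rhs[OF has_derivative_scaleR[OF DERIV_compose_FDERIV[OF dW1 dphi[OF assms]] dgrad[OF assms]]])
    (auto simp: fun_eq_iff G'_def mult.commute)

lemma C2: "C2_on (- {0}) (\<lambda>x. W (\<phi> x))"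
proof (rule C2_on_of_gradient)
  show "\<And>x. x \<in> - {0} \<Longrightarrow> ((\<lambda>x. W (\<phi> x)) has_derivative (\<lambda>v. (W1 (\<phi> x) *\<^sub>R grad x) \<bullet> v)) (at x)"
    using dF by simp
  show "\<And>x. x \<in> - {0} \<Longrightarrow> ((\<lambda>x. W1 (\<phi> x) *\<^sub>R grad x) has_derivative G' x) (at x)"
    using dG by simp
  fix v
  have cP: "continuous_on (- {0}) P" by (rule linear_continuous_on[OF P_bl])
  have c\<phi>: "continuous_on (- {0}) \<phi>" unfolding \<phi>_def by (intro continuous_intros cP) auto
  have cg: "continuous_on (- {0}) grad" unfolding grad_def by (intro continuous_intros cP) auto
  have cg': "continuous_on (- {0}) (\<lambda>x. grad' x v)" unfolding grad'_def by (intro continuous_intros cP) auto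
  have "continuous_on UNIV W1" using DERIV_isCont[OF dW1] by (auto intro: continuous_at_imp_continuous_on)
  then show "continuous_on (- {0}) (\<lambda>x. G' x v)" unfolding G'_def
    by (intro continuous_intros cg cg' continuous_on_compose2[OF cW2 c\<phi>] continuous_on_compose2[OF _ c\<phi>]) auto
qed

text \<open>Chain rule: the Laplacian of W(\<phi>) is W'' |grad \<phi>|^2 plus W' times that of
  \<phi>. As P is an orthogonal projection, |grad \<phi>|^2 = 4 \<rho> (1 - \<rho>) on the sphere;
  the Laplacian of \<phi> involves, besides \<rho>, only the dimension and the trace of P.\<close>

lemma laplacian_on_sphere:
  assumes "x \<bullet> x = 1"
  defines "\<rho> \<equiv> P x \<bullet> x"
  shows "euclid_laplacian (\<lambda>x. W (\<phi> x)) x =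
    W2 (1 - \<rho>) * (4 * \<rho> * (1 - \<rho>)) + W1 (1 - \<rho>) * (2 * \<rho> * real DIM('a) - 2 * (\<Sum>b\<in>Basis. P b \<bullet> b))"
proof -
  have x0: "x \<in> - {0}" using assms(1) by auto
  have "euclid_laplacian (\<lambda>x. W (\<phi> x)) x = (\<Sum>b\<in>Basis. G' x b \<bullet> b)"
    by (rule euclid_laplacian_of_gradient[OF _ x0]) (use x0 in \<open>auto intro: dF dG\<close>)
  also have "\<dots> = W2 (\<phi> x) * (\<Sum>b\<in>Basis. (grad x \<bullet> b) * (grad x \<bullet> b)) + W1 (\<phi> x) * (\<Sum>b\<in>Basis. grad' x b \<bullet> b)"
    by (simp add: G'_def inner_add_left sum.distrib sum_distrib_left mult.assoc)
  also have "(\<Sum>b\<in>Basis. (grad x \<bullet> b) * (grad x \<bullet> b)) = grad x \<bullet> grad x"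
    by (rule euclidean_inner[symmetric])
  also have "grad x \<bullet> grad x = 4 * \<rho> * (1 - \<rho>)"
  proof -
    have PP: "P x \<bullet> P x = \<rho>" using P_adj[of x "P x"] P_idem[of x] by (simp add: \<rho>_def inner_commute)
    have gx: "grad x = (- 2) *\<^sub>R P x + (2 * \<rho>) *\<^sub>R x" using assms(1) by (simp add: grad_def \<rho>_def)
    have "((- 2) *\<^sub>R P x + (2 * \<rho>) *\<^sub>R x) \<bullet> ((- 2) *\<^sub>R P x + (2 * \<rho>) *\<^sub>R x)
        = 4 * (P x \<bullet> P x) - 8 * \<rho> * (P x \<bullet> x) + 4 * \<rho> * \<rho> * (x \<bullet> x)"
      unfolding inner_add_left inner_add_right inner_scaleR_left inner_scaleR_right inner_commute[of x "P x"]
      by (simp add: algebra_simps)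
    then have "grad x \<bullet> grad x = 4 * (P x \<bullet> P x) - 8 * \<rho> * (P x \<bullet> x) + 4 * \<rho> * \<rho> * (x \<bullet> x)"
      unfolding gx .
    then show ?thesis using PP assms(1) by (simp add: algebra_simps flip: \<rho>_def)
  qed
  also have "(\<Sum>b\<in>Basis. grad' x b \<bullet> b) = 2 * \<rho> * real DIM('a) - 2 * (\<Sum>b\<in>Basis. P b \<bullet> b)"
  proof -
    have "grad' x b \<bullet> b = 8 * ((x \<bullet> b) * (P x \<bullet> b)) - 2 * (P b \<bullet> b) - 8 * \<rho> * ((x \<bullet> b) * (x \<bullet> b)) + 2 * \<rho> * (b \<bullet> b)" for b
      using assms(1) by (simp add: grad'_def inner_add_left \<rho>_def algebra_simps)
    then have "(\<Sum>b\<in>Basis. grad' x b \<bullet> b) = 8 * (\<Sum>b\<in>Basis. (x \<bullet> b) * (P x \<bullet> b)) - 2 * (\<Sum>b\<in>Basis. P b \<bullet> b)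
        - 8 * \<rho> * (\<Sum>b\<in>Basis. (x \<bullet> b) * (x \<bullet> b)) + 2 * \<rho> * (\<Sum>b\<in>Basis. b \<bullet> (b::'a))"
      by (simp add: sum.distrib sum_subtractf sum_distrib_left)
    also have "\<dots> = 8 * (x \<bullet> P x) - 2 * (\<Sum>b\<in>Basis. P b \<bullet> b) - 8 * \<rho> * (x \<bullet> x) + 2 * \<rho> * real DIM('a)"
      unfolding euclidean_inner[symmetric] by (simp add: inner_same_Basis)
    also have "\<dots> = 2 * \<rho> * real DIM('a) - 2 * (\<Sum>b\<in>Basis. P b \<bullet> b)"
      using assms(1) by (simp add: \<rho>_def inner_commute)
    finally show ?thesis .
  qed
  finally show ?thesis using assms(1) by (simp add: \<phi>_def \<rho>_def)
qed

end

section \<open>Lifting profiles through the coordinate z_0\<close>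

lemma coordinate_projection:
  fixes i0 :: "'m::finite"
  defines "P \<equiv> \<lambda>x :: complex^'m. axis i0 (x $ i0)"
  shows "bounded_linear P" and "P x \<bullet> y = x \<bullet> P y" and "P (P x) = P x"
    and "P x \<bullet> x = (norm (x $ i0))\<^sup>2" and "(\<Sum>b\<in>Basis. P b \<bullet> b) = 2"
proof -
  show "bounded_linear P"
 proof (rule linear_conv_bounded_linear[THEN iffD1])
    show "linear P" unfolding P_def by (rule linearI) (auto simp: vec_eq_iff axis_def)
  qed
  show "P x \<bullet> y = x \<bullet> P y" by (simp add: P_def inner_axis inner_axis' inner_commute)
  show "P (P x) = P x" by (simp add: P_def)
  show "P x \<bullet> x = (norm (x $ i0))\<^sup>2" by (simp add: P_def inner_axis' power2_norm_eq_inner)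
  \<comment> \<open>Parseval: exchanging the two basis sums turns the trace into the number of real
    basis vectors of the complex line, which is 2.\<close>
  have "P b \<bullet> b = (\<Sum>u\<in>Basis. (axis i0 u \<bullet> b) * (axis i0 u \<bullet> b))" for b
  proof -
    have "axis i0 u \<bullet> b = b $ i0 \<bullet> u" for u by (simp add: inner_axis' inner_commute[of u])
    moreover have "P b \<bullet> b = b $ i0 \<bullet> b $ i0" by (simp add: P_def inner_axis')
    ultimately show ?thesis using euclidean_inner[of "b $ i0" "b $ i0"] by (simp only:)
  qed
  then have "(\<Sum>b\<in>Basis. P b \<bullet> b) = (\<Sum>b\<in>Basis. \<Sum>u\<in>(Basis :: complex set). (axis i0 u \<bullet> b) * (axis i0 u \<bullet> b))" by simp
  also have "\<dots> = (\<Sum>u\<in>(Basis :: complex set). \<Sum>b\<in>Basis. (axis i0 u \<bullet> b) * (axis i0 u \<bullet> (b::complex^'m)))"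
    by (rule sum.swap)
  also have "\<dots> = (\<Sum>u\<in>(Basis :: complex set). axis i0 u \<bullet> (axis i0 u :: complex^'m))"
    by (simp only: euclidean_inner[symmetric])
  also have "\<dots> = (\<Sum>u\<in>(Basis :: complex set). 1)"
    by (rule sum.cong) (auto simp: inner_axis inner_same_Basis)
  finally show "(\<Sum>b\<in>Basis. P b \<bullet> b) = 2" by simp
qed

text \<open>s = 1 - |z_0|^2 is the squared sine of the distance to p_0. With real dimension 2 (n +
  1) and trace 2, the Laplacian is 4 times the operator of the radial equation, whence the parameter
  \<open>lam / 4\<close>.\<close>

lemma profile_solves_equation:
  fixes i0 :: "'m::finite" and W W1 W2 :: "real \<Rightarrow> real"
  assumes card: "CARD('m) = n + 1"
    and profile: "radial_profile n (lam / 4) q W W1 W2"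
  defines "u \<equiv> \<lambda>z :: complex^'m. W (1 - (norm (z $ i0))\<^sup>2)"
  shows "positive_solution lam q u" and "Un_invariant i0 u"
proof -
  have W: "\<And>s. (W has_real_derivative W1 s) (at s)" "\<And>s. (W1 has_real_derivative W2 s) (at s)" "continuous_on UNIV W2"
    and pos: "\<And>s. 0 \<le> s \<Longrightarrow> s \<le> 1 \<Longrightarrow> 0 < W s"
    and ode: "\<And>s. 0 \<le> s \<Longrightarrow> s \<le> 1 \<Longrightarrow>
      s * (1 - s) * W2 s + (real n - (real n + 1) * s) * W1 s + lam / 4 * (W s powr (q - 1) - W s) = 0"
    using profile unfolding radial_profile_def by auto
  define P where "P = (\<lambda>x :: complex^'m. axis i0 (x $ i0))"
  have P: "bounded_linear P" "\<And>x y. P x \<bullet> y = x \<bullet> P y" "\<And>x. P (P x) = P x"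
    "\<And>x. P x \<bullet> x = (norm (x $ i0))\<^sup>2" "(\<Sum>b\<in>Basis. P b \<bullet> b) = 2"
    unfolding P_def by (rule coordinate_projection)+
  interpret projection_profile P W W1 W2
    by (rule projection_profile.intro) (rule P W)+
  have sphere: "0 \<le> 1 - (norm (z $ i0))\<^sup>2" "1 - (norm (z $ i0))\<^sup>2 \<le> 1" if "z \<in> unit_sphere" for z :: "complex^'m"
  proof -
    have "norm (z $ i0) \<le> 1" using Finite_Cartesian_Product.norm_nth_le[of z i0] that by (simp add: unit_sphere_def)
    then show "0 \<le> 1 - (norm (z $ i0))\<^sup>2" by (simp add: power_le_one)
    show "1 - (norm (z $ i0))\<^sup>2 \<le> 1" by simp
  qed
  \<comment> \<open>Valid at x = 0 as well, where the conventions for inverse and division by 0 give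
    W 1 on both sides.\<close>
  have ext: "ext0 u = (\<lambda>x. W (\<phi> x))"
  proof
    fix x :: "complex^'m"
    have "(norm ((inverse (norm x) *\<^sub>R x) $ i0))\<^sup>2 = (norm (x $ i0))\<^sup>2 / (norm x)\<^sup>2"
      by (simp add: power_mult_distrib divide_inverse power_inverse mult.commute)
    also have "\<dots> = (P x \<bullet> x) / (x \<bullet> x)" using P(4)[of x] by (simp add: power2_norm_eq_inner)
    finally show "ext0 u x = W (\<phi> x)" unfolding ext0_def u_def \<phi>_def by simp
  qed
  have "hopf_invariant u" unfolding hopf_invariant_def u_def by (simp add: norm_mult)
  moreover have "C2_on (- {0}) (ext0 u)" unfolding ext by (rule C2)
  moreover have "0 < u z" if "z \<in> unit_sphere" for z unfolding u_def using sphere[OF that] by (rule pos)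
  moreover have "- laplacian_FS u z + lam * u z = lam * u z powr (q - 1)" if z: "z \<in> unit_sphere" for z
  proof -
    define s where "s = 1 - (norm (z $ i0))\<^sup>2"
    have zz: "z \<bullet> z = 1" using z by (simp add: unit_sphere_def norm_eq_1)
    have e: "P z \<bullet> z = 1 - s" using P(4)[of z] by (simp add: s_def)
    have d: "real DIM(complex^'m) = 2 * (real n + 1)" using card by simp
    have "laplacian_FS u z = W2 s * (4 * (1 - s) * s) + W1 s * (4 * (1 - s) * (real n + 1) - 4)"
      unfolding laplacian_FS_def ext laplacian_on_sphere[OF zz] e d P(5) by (simp add: algebra_simps)
    also have "\<dots> = 4 * (s * (1 - s) * W2 s + (real n - (real n + 1) * s) * W1 s)" by (simp add: algebra_simps)
    also have "\<dots> = - lam * (W s powr (q - 1) - W s)"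
      using ode[of s] sphere[OF z] by (simp add: s_def field_simps)
    finally show ?thesis by (simp add: u_def s_def algebra_simps)
  qed
  ultimately show "positive_solution lam q u" unfolding positive_solution_def by blast
  show "Un_invariant i0 u" unfolding Un_invariant_def
  proof (intro ballI)
    fix A :: "complex^'m^'m" and z :: "complex^'m" assume A: "A \<in> Un_block i0"
    have "(A *v z) $ i0 = (\<Sum>j\<in>UNIV. A $ i0 $ j * z $ j)" by (simp add: matrix_vector_mult_def)
    also have "\<dots> = (\<Sum>j\<in>UNIV. if j = i0 then z $ j else 0)"
      using A by (intro sum.cong) (auto simp: Un_block_def)
    also have "\<dots> = z $ i0" by simp
    finally show "u (A *v z) = u z" by (simp add: u_def)
  qed
qed

theorem theorem1p1:
  fixes i0 :: "'m::finite" and n k :: nat and q lam :: real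
  assumes "CARD('m) = n + 1" and "n \<ge> 2"
    and "2 < q" and "q < 2 * real n / (real n - 1)"
    and "k \<ge> 1"
    and "4 * real k * (real k + real n) / (q - 2) < lam"
    and "lam \<le> 4 * real (k + 1) * (real (k + 1) + real n) / (q - 2)"
  shows "\<exists>us :: nat \<Rightarrow> (complex^'m \<Rightarrow> real).
           (\<forall>i<k. positive_solution lam q (us i) \<and> Un_invariant i0 (us i)) \<and>
           (\<forall>i<k. \<forall>j<k. i \<noteq> j \<longrightarrow> (\<exists>z\<in>unit_sphere. us i z \<noteq> us j z))"
proof -
  have gap: "real k * (real k + real n) < lam / 4 * (q - 2)"
    using assms(3,6) by (simp add: field_simps)
  have "0 \<le> 4 * real k * (real k + real n) / (q - 2)" using assms(3) by simp
  then have lam: "0 < lam / 4" using assms(6) by linarith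
  have n1: "n \<ge> 1" using assms(2) by simp
  obtain W W1 W2 :: "nat \<Rightarrow> real \<Rightarrow> real" where W:
    "\<And>j. j < k \<Longrightarrow> radial_profile n (lam / 4) q (W j) (W1 j) (W2 j)"
    "\<And>i j. i < k \<Longrightarrow> j < k \<Longrightarrow> i \<noteq> j \<Longrightarrow> W i 0 \<noteq> W j 0"
    using radial_profiles_exist[OF n1 assms(3) lam assms(5) gap] by blast
  define us where "us j = (\<lambda>z :: complex^'m. W j (1 - (norm (z $ i0))\<^sup>2))" for j
  have sol: "positive_solution lam q (us j) \<and> Un_invariant i0 (us j)" if "j < k" for j
    unfolding us_def using profile_solves_equation[OF assms(1) W(1)[OF that]] by blast
  \<comment> \<open>The fixed point p_0 of the action, where s = 0, separates the solutions.\<close>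
  define p :: "complex^'m" where "p = axis i0 1"
  have p: "p \<in> unit_sphere" by (simp add: p_def unit_sphere_def norm_eq_1 inner_axis')
  have "us j p = W j 0" for j by (simp add: us_def p_def)
  then have "\<exists>z\<in>unit_sphere. us i z \<noteq> us j z" if "i < k" "j < k" "i \<noteq> j" for i j
    using W(2)[OF that] p by metis
  with sol show ?thesis by blast
qed

end
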